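(* Let $X\subset \mathbb{P}^2\times \mathbb{P}^1$ be the biprojective surface with coordinates $(x_0, x_1, x_2; y_1, y_2)$ defined by $x_1y_2=x_2y_1$. Then the morphism $\varphi: X \to W$ defined by $$ \varphi(x_0, x_1, x_2; y_1, y_2)= (x_1y_1,\ x_1y_2,\ x_0y_1+ x_2y_2,\ x_0y_2) $$ is a desingularisation of $W$ such that the open subvariety $U$ of $X$ where $x_1\neq 0$ is sent isomorphically onto the subset $V$ of $W$ where $t_0\neq 0$.
   Context: Everything is over $\mathbb{Q}$. $W\subset\mathbb{P}^3$ is the Cayley ruled cubic surface with equation $t_0t_1t_2-t_0^2t_3-t_1^3=0$ in homogeneous coordinates $(t_0,t_1,t_2,t_3)$. The open subset $V\subset W$ is the complement $W\setminus\{t_0=t_1=0\}$ of the double line, which equals the subset of $W$ where $t_0\neq 0$. A desingularisation of $W$ is a proper birational morphism to $W$ from a non-singular variety. *)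

theory Defs
  imports "HOL-Analysis.Analysis" "HOL-Library.Poly_Mapping" "HOL-Library.Extended_Nat" "HOL-Library.Function_Algebras"
    "HOL-Computational_Algebra.Polynomial"
begin

text \<open>
  Quasi-projective varieties over \<open>\<rat>\<close> are treated classically: \<open>'k\<close> is an algebraically closed
  field of characteristic 0, a variety is a set of \<open>'k\<close>-points of a multiprojective space, and all
  closed sets, ideals and morphisms are defined by polynomials with rational coefficients.

  A list \<open>ns = [n\<^sub>0, \<dots>, n\<^sub>r]\<close> stands for the space $P^{n_0} \times \cdots \times P^{n_r}$.  A point
  of it is a list of points of the factors, and a point of $P^n$ is the set of all its homogeneous
  coordinate vectors.  So the product of two spaces is given by appending lists, and the lists of
  coordinate vectors of a point \<open>p\<close> are the elements of \<open>listset p\<close>.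
\<close>

type_synonym 'k mpoint = "'k list set list"

definition proj :: "'k::field list \<Rightarrow> 'k list set" where
  "proj v = {map ((*) c) v | c. c \<noteq> 0}"

definition proj_space :: "nat \<Rightarrow> 'k::field list set set" where
  "proj_space n = {proj v | v. length v = Suc n \<and> (\<exists>a\<in>set v. a \<noteq> 0)}"

definition mproj :: "nat list \<Rightarrow> 'k::field mpoint set" where
  "mproj ns = {p. list_all2 (\<lambda>P n. P \<in> proj_space n) p ns}"


subsection \<open>Multihomogeneous polynomials over the rationals\<close>

text \<open>The variable \<open>(i, j)\<close> is the \<open>j\<close>-th homogeneous coordinate of the \<open>i\<close>-th factor.\<close>

type_synonym mpoly = "((nat \<times> nat) \<Rightarrow>\<^sub>0 nat) \<Rightarrow>\<^sub>0 rat"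

definition peval :: "mpoly \<Rightarrow> 'k::field_char_0 list list \<Rightarrow> 'k" where
  "peval F x = (\<Sum>m\<in>Poly_Mapping.keys F. of_rat (Poly_Mapping.lookup F m) *
      (\<Prod>(i, j)\<in>Poly_Mapping.keys m. (x ! i ! j) ^ Poly_Mapping.lookup m (i, j)))"

definition partial_deriv :: "nat \<times> nat \<Rightarrow> mpoly \<Rightarrow> mpoly" where
  "partial_deriv v F = (\<Sum>m\<in>Poly_Mapping.keys F.
      Poly_Mapping.single (m - Poly_Mapping.single v 1)
        (of_nat (Poly_Mapping.lookup m v) * Poly_Mapping.lookup F m))"

definition multihom :: "nat list \<Rightarrow> (nat \<Rightarrow> nat) \<Rightarrow> mpoly \<Rightarrow> bool" where
  "multihom ns d F \<longleftrightarrow> (\<forall>m\<in>Poly_Mapping.keys F.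
      (\<forall>(i, j)\<in>Poly_Mapping.keys m. i < length ns \<and> j \<le> ns ! i) \<and>
      (\<forall>i<length ns. (\<Sum>j\<le>ns ! i. Poly_Mapping.lookup m (i, j)) = d i))"


subsection \<open>The Zariski topology\<close>

text \<open>
  This is the \<open>\<rat>\<close>-topology.  The basic open sets are the non-vanishing loci of forms; whether a form
  vanishes at \<open>p\<close> does not depend on the choice of coordinates \<open>x \<in> listset p\<close>.
\<close>

definition zariski :: "nat list \<Rightarrow> 'k::field_char_0 mpoint topology" where
  "zariski ns = topology_generated_by
      {{p \<in> mproj ns. \<exists>x\<in>listset p. peval F x \<noteq> 0} | F d. multihom ns d F}"

abbreviation zariski_on :: "nat list \<Rightarrow> 'k::field_char_0 mpoint set \<Rightarrow> 'k mpoint topology" where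
  "zariski_on ns X \<equiv> subtopology (zariski ns) X"

definition irreducible_in :: "'a topology \<Rightarrow> 'a set \<Rightarrow> bool" where
  "irreducible_in T S \<longleftrightarrow> S \<subseteq> topspace T \<and> S \<noteq> {} \<and>
      (\<forall>A B. closedin T A \<and> closedin T B \<and> S \<subseteq> A \<union> B \<longrightarrow> S \<subseteq> A \<or> S \<subseteq> B)"

definition krull_dim :: "'a topology \<Rightarrow> enat" where
  "krull_dim T = Sup {enat n | n. \<exists>C :: nat \<Rightarrow> 'a set.
      (\<forall>i\<le>n. closedin T (C i) \<and> irreducible_in T (C i)) \<and> (\<forall>i<n. C i \<subset> C (Suc i))}"

definition quasi_projective :: "nat list \<Rightarrow> 'k::field_char_0 mpoint set \<Rightarrow> bool" where
  "quasi_projective ns X \<longleftrightarrow>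
      (\<exists>A B. openin (zariski ns) A \<and> closedin (zariski ns) B \<and> X = A \<inter> B)"

definition variety :: "nat list \<Rightarrow> 'k::field_char_0 mpoint set \<Rightarrow> bool" where
  "variety ns X \<longleftrightarrow> quasi_projective ns X \<and> irreducible_in (zariski ns) X"


subsection \<open>Non-singular varieties\<close>

definition vanishing_forms :: "nat list \<Rightarrow> 'k::field_char_0 mpoint set \<Rightarrow> mpoly set" where
  "vanishing_forms ns X =
      {F. (\<exists>d. multihom ns d F) \<and> (\<forall>p\<in>X. \<forall>x\<in>listset p. peval F x = 0)}"

definition gradient :: "mpoly \<Rightarrow> 'k::field_char_0 list list \<Rightarrow> nat \<times> nat \<Rightarrow> 'k" where
  "gradient F x = (\<lambda>v. peval (partial_deriv v F) x)"

definition jacobian_rank ::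
  "nat list \<Rightarrow> 'k::field_char_0 mpoint set \<Rightarrow> 'k list list \<Rightarrow> nat" where
  "jacobian_rank ns X x =
      vector_space.dim (\<lambda>(c::'k) w v. c * w v) {gradient F x | F. F \<in> vanishing_forms ns X}"

text \<open>
  Jacobian criterion in homogeneous coordinates: at each geometric point the rank of the Jacobian
  matrix of the full ideal of the variety is its codimension in the ambient space.  By Euler's
  relations this is also the rank of the Jacobian matrix in affine coordinates.
\<close>

definition nonsingular :: "nat list \<Rightarrow> 'k::field_char_0 mpoint set \<Rightarrow> bool" where
  "nonsingular ns X \<longleftrightarrow> (\<forall>p\<in>X. \<forall>x\<in>listset p.
      enat (jacobian_rank ns X x) + krull_dim (zariski_on ns X) = enat (sum_list ns))"


subsection \<open>Morphisms\<close>

text \<open>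
  A representation of a map to \<open>mproj ms\<close> by forms consists, for each factor of the target, of the list
  of its homogeneous coordinates; these are forms of the same multidegree.
\<close>

definition form_system :: "nat list \<Rightarrow> nat list \<Rightarrow> mpoly list list \<Rightarrow> bool" where
  "form_system ns ms Fs \<longleftrightarrow>
      list_all2 (\<lambda>G m. length G = Suc m \<and> (\<exists>d. \<forall>F\<in>set G. multihom ns d F)) Fs ms"

definition defined_at :: "mpoly list list \<Rightarrow> 'k::field_char_0 list list \<Rightarrow> bool" where
  "defined_at Fs x \<longleftrightarrow> (\<forall>G\<in>set Fs. \<exists>F\<in>set G. peval F x \<noteq> 0)"

definition form_value :: "mpoly list list \<Rightarrow> 'k::field_char_0 list list \<Rightarrow> 'k mpoint" where
  "form_value Fs x = map (\<lambda>G. proj (map (\<lambda>F. peval F x) G)) Fs"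

text \<open>
  Locally on \<open>X\<close> the map is given by forms.  The domain of definition of a system of forms is open, and
  it can be shrunk to any basic open set by multiplying all its forms by a further form; so it can
  serve as the neighbourhood of \<open>p\<close>.
\<close>

definition morphism :: "nat list \<Rightarrow> 'k::field_char_0 mpoint set \<Rightarrow> nat list \<Rightarrow> 'k mpoint set \<Rightarrow>
    ('k mpoint \<Rightarrow> 'k mpoint) \<Rightarrow> bool" where
  "morphism ns X ms Y f \<longleftrightarrow> f ` X \<subseteq> Y \<and>
      (\<forall>p\<in>X. \<exists>Fs. form_system ns ms Fs \<and> (\<forall>x\<in>listset p. defined_at Fs x) \<and>
        (\<forall>q\<in>X. \<forall>x\<in>listset q. defined_at Fs x \<longrightarrow> f q = form_value Fs x))"

definition isomorphism :: "nat list \<Rightarrow> 'k::field_char_0 mpoint set \<Rightarrow> nat list \<Rightarrow> 'k mpoint set \<Rightarrow>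
    ('k mpoint \<Rightarrow> 'k mpoint) \<Rightarrow> bool" where
  "isomorphism ns X ms Y f \<longleftrightarrow> morphism ns X ms Y f \<and>
      (\<exists>g. morphism ms Y ns X g \<and> (\<forall>p\<in>X. g (f p) = p) \<and> (\<forall>q\<in>Y. f (g q) = q))"

definition birational_morphism :: "nat list \<Rightarrow> 'k::field_char_0 mpoint set \<Rightarrow> nat list \<Rightarrow>
    'k mpoint set \<Rightarrow> ('k mpoint \<Rightarrow> 'k mpoint) \<Rightarrow> bool" where
  "birational_morphism ns X ms Y f \<longleftrightarrow> morphism ns X ms Y f \<and>
      (\<exists>A B. openin (zariski_on ns X) A \<and> zariski_on ns X closure_of A = X \<and>
             openin (zariski_on ms Y) B \<and> zariski_on ms Y closure_of B = Y \<and>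
             isomorphism ns A ms B f)"

definition fibre_product :: "'k mpoint set \<Rightarrow> 'k mpoint set \<Rightarrow> ('k mpoint \<Rightarrow> 'k mpoint) \<Rightarrow>
    ('k mpoint \<Rightarrow> 'k mpoint) \<Rightarrow> 'k mpoint set" where
  "fibre_product X Z f g = {p @ q | p q. p \<in> X \<and> q \<in> Z \<and> f p = g q}"

text \<open>
  Morphisms of quasi-projective varieties are separated and of finite type, so proper means universally
  closed: for every base change along a morphism \<open>g: Z \<rightarrow> Y\<close> the projection to \<open>Z\<close> is closed.
\<close>

definition proper_morphism :: "nat list \<Rightarrow> 'k::field_char_0 mpoint set \<Rightarrow> nat list \<Rightarrow>
    'k mpoint set \<Rightarrow> ('k mpoint \<Rightarrow> 'k mpoint) \<Rightarrow> bool" where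
  "proper_morphism ns X ms Y f \<longleftrightarrow> morphism ns X ms Y f \<and>
      (\<forall>ks Z g. quasi_projective ks Z \<and> morphism ks Z ms Y g \<longrightarrow>
        closed_map (zariski_on (ns @ ks) (fibre_product X Z f g)) (zariski_on ks Z)
          (drop (length ns)))"

definition desingularisation :: "nat list \<Rightarrow> 'k::field_char_0 mpoint set \<Rightarrow> nat list \<Rightarrow>
    'k mpoint set \<Rightarrow> ('k mpoint \<Rightarrow> 'k mpoint) \<Rightarrow> bool" where
  "desingularisation ns X ms Y f \<longleftrightarrow> variety ns X \<and> nonsingular ns X \<and> variety ms Y \<and>
      proper_morphism ns X ms Y f \<and> birational_morphism ns X ms Y f"


subsection \<open>The Cayley ruled cubic surface\<close>

definition cayley_W :: "'k::field mpoint set" where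
  "cayley_W = {p \<in> mproj [3]. \<forall>t0 t1 t2 t3. [[t0, t1, t2, t3]] \<in> listset p \<longrightarrow>
      t0 * t1 * t2 - t0^2 * t3 - t1^3 = 0}"

definition cayley_V :: "'k::field mpoint set" where
  "cayley_V = {p \<in> cayley_W. \<forall>t0 t1 t2 t3. [[t0, t1, t2, t3]] \<in> listset p \<longrightarrow> t0 \<noteq> 0}"

definition cayley_X :: "'k::field mpoint set" where
  "cayley_X = {p \<in> mproj [2, 1]. \<forall>x0 x1 x2 y1 y2. [[x0, x1, x2], [y1, y2]] \<in> listset p \<longrightarrow>
      x1 * y2 = x2 * y1}"

definition cayley_U :: "'k::field mpoint set" where
  "cayley_U = {p \<in> cayley_X. \<forall>x0 x1 x2 y1 y2. [[x0, x1, x2], [y1, y2]] \<in> listset p \<longrightarrow> x1 \<noteq> 0}"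

definition cayley_phi :: "'k::field mpoint \<Rightarrow> 'k mpoint" where
  "cayley_phi p = (THE q. \<exists>x0 x1 x2 y1 y2. p = [proj [x0, x1, x2], proj [y1, y2]] \<and>
      q = [proj [x1 * y1, x1 * y2, x0 * y1 + x2 * y2, x0 * y2]])"

lemma self_in_proj: "v \<in> proj v"
  unfolding proj_def by (rule CollectI, rule exI[of _ 1]) (simp add: map_idI)

lemma proj_map: assumes "(c::'k::field) \<noteq> 0" shows "proj (map ((*) c) v) = proj v"
proof -
  have "map ((*) d) v = map ((*) (d / c)) (map ((*) c) v)" for d
    using assms by simp
  moreover have "map ((*) d) (map ((*) c) v) = map ((*) (d * c)) v" for d
    by (simp add: mult.assoc)
  ultimately show ?thesis
    unfolding proj_def using assms by (smt (verit, best) Collect_cong divide_eq_0_iff mult_eq_0_iff)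
qed

lemma cayley_phi_formula:
  "cayley_phi [proj [x0, x1, x2], proj [y1, y2]] =
    [proj [x1 * y1, x1 * y2, x0 * y1 + x2 * y2, x0 * y2]]"
  unfolding cayley_phi_def
proof (rule the_equality)
  show "\<exists>x0' x1' x2' y1' y2'. [proj [x0, x1, x2], proj [y1, y2]] =
      [proj [x0', x1', x2'], proj [y1', y2']] \<and>
      [proj [x1 * y1, x1 * y2, x0 * y1 + x2 * y2, x0 * y2]] =
      [proj [x1' * y1', x1' * y2', x0' * y1' + x2' * y2', x0' * y2']]"
    by blast
next
  fix q
  assume "\<exists>x0' x1' x2' y1' y2'. [proj [x0, x1, x2], proj [y1, y2]] =
      [proj [x0', x1', x2'], proj [y1', y2']] \<and>
      q = [proj [x1' * y1', x1' * y2', x0' * y1' + x2' * y2', x0' * y2']]"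
  then obtain a b c d e where
    eq: "proj [x0, x1, x2] = proj [a, b, c]" "proj [y1, y2] = proj [d, e]" and
    q: "q = [proj [b * d, b * e, a * d + c * e, a * e]]" by auto
  have "[a, b, c] \<in> proj [x0, x1, x2]" "[d, e] \<in> proj [y1, y2]"
    unfolding eq by (rule self_in_proj)+
  then obtain s t where st: "s \<noteq> 0" "t \<noteq> 0" "a = s * x0" "b = s * x1" "c = s * x2"
    "d = t * y1" "e = t * y2" by (auto simp: proj_def)
  have "[b * d, b * e, a * d + c * e, a * e] =
      map ((*) (s * t)) [x1 * y1, x1 * y2, x0 * y1 + x2 * y2, x0 * y2]"
    by (simp add: st algebra_simps)
  then show "q = [proj [x1 * y1, x1 * y2, x0 * y1 + x2 * y2, x0 * y2]]"
    using q proj_map[of "s * t" "[x1 * y1, x1 * y2, x0 * y1 + x2 * y2, x0 * y2]"] st(1,2) by (metis mult_eq_0_iff)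
qed

end

theory Submission
  imports Defs
begin

text \<open>
  On \<open>X\<close> the vector \<open>(x\<^sub>1, x\<^sub>2)\<close> is a multiple \<open>s\<close> of \<open>(y\<^sub>1, y\<^sub>2)\<close>.  So \<open>X\<close> is a bundle of projective
  lines over the line with coordinates \<open>y\<close>, with the coordinates \<open>(x\<^sub>0, s)\<close> on the fibres, and it is
  parametrized by \<open>(x\<^sub>0, s, u, v)\<close> with \<open>y = (u, v)\<close>.  In these parameters
  $\varphi = (s u^2, s u v, x_0 u + s v^2, x_0 v)$.  Every claim is read off from this.

  Irreducibility: two points of \<open>X\<close>, hence two points of its image \<open>W\<close>, are joined by a polynomial curve
  (\<open>irreducible_in_by_curves\<close>), and a product of two polynomials in one variable is nonzero if both
  factors are.

  Dimension: for each member of a chain of irreducible closed sets there is a form that vanishes on it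
  but not on the next member.  Products of such forms are independent, so a chain of length \<open>n\<close> forces
  the number of independent forms to grow like the \<open>n\<close>-th power of their degree (\<open>indep_forms_chain\<close>).
  On \<open>X\<close> the forms of bidegree \<open>(D, D)\<close> are spanned by \<open>(D + 1) (2 D + 1)\<close> monomials in \<open>(x\<^sub>0, s, u, v)\<close>, so that the dimension is at most 2; a point on a line
  on \<open>X\<close> shows that it is 2.

  Smoothness: the cone over \<open>X\<close> contains four lines through each of its points, in the directions in
  which one parameter varies.  The gradient of a form that vanishes on \<open>X\<close> is orthogonal to them, and
  the orthogonal complement is one-dimensional (\<open>gradient_vanishing_on_X\<close>).

  Birationality: where \<open>t\<^sub>0\<close> does not vanish, \<open>y = (t\<^sub>0, t\<^sub>1)\<close> and
  $x = (t_0 t_2 - t_1^2, t_0^2, t_0 t_1)$ invert \<open>\<phi>\<close>, by forms.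

  Properness: the morphism is finite, which makes explicit elimination possible in place of a general
  theorem.  Over a point \<open>t\<close> of \<open>W\<close> the vector \<open>y\<close> is a root of the binary quadratic form
  $t_3 y_1^2 - t_2 y_1 y_2 + t_1 y_2^2$, and \<open>x\<close> is given by forms in \<open>y\<close> and \<open>t\<close>.  A form on a fibre
  product over \<open>Z\<close> thus becomes a form in \<open>y\<close> with coefficients on \<open>Z\<close>, and its norm with respect to the
  quadratic form is a form on \<open>Z\<close> (\<open>eliminate_quadratic_root\<close>).  If the first form vanishes on a closed
  set, then the norm vanishes on its projection to \<open>Z\<close>.
\<close>

section \<open>Functions given by rational forms\<close>

definition monomial_value :: "((nat \<times> nat) \<Rightarrow>\<^sub>0 nat) \<Rightarrow> 'k::field_char_0 list list \<Rightarrow> 'k" where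
  "monomial_value m x =
    (\<Prod>v\<in>Poly_Mapping.keys m. (x ! fst v ! snd v) ^ Poly_Mapping.lookup m v)"

lemma peval_monomials:
  "peval F x = (\<Sum>m\<in>Poly_Mapping.keys F. of_rat (Poly_Mapping.lookup F m) * monomial_value m x)"
  unfolding peval_def monomial_value_def by (simp add: case_prod_beta)

lemma monomial_value_superset:
  assumes "finite S" "Poly_Mapping.keys m \<subseteq> S"
  shows "monomial_value m x = (\<Prod>v\<in>S. (x ! fst v ! snd v) ^ Poly_Mapping.lookup m v)"
  unfolding monomial_value_def using assms
  by (intro prod.mono_neutral_left) (auto simp: in_keys_iff)

lemma monomial_value_0 [simp]: "monomial_value 0 x = 1"
  by (simp add: monomial_value_def)

lemma monomial_value_add: "monomial_value (m + n) x = monomial_value m x * monomial_value n x"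
proof -
  let ?S = "Poly_Mapping.keys m \<union> Poly_Mapping.keys n"
  have "monomial_value (m + n) x =
      (\<Prod>v\<in>?S. (x ! fst v ! snd v) ^ Poly_Mapping.lookup (m + n) v)"
    using Poly_Mapping.keys_add[of m n] by (intro monomial_value_superset) auto
  also have "\<dots> = (\<Prod>v\<in>?S. (x ! fst v ! snd v) ^ Poly_Mapping.lookup m v) *
      (\<Prod>v\<in>?S. (x ! fst v ! snd v) ^ Poly_Mapping.lookup n v)"
    by (simp add: lookup_add power_add prod.distrib)
  also have "\<dots> = monomial_value m x * monomial_value n x"
    by (simp add: monomial_value_superset[of ?S])
  finally show ?thesis .
qed

lemma peval_0 [simp]: "peval 0 x = 0"
  by (simp add: peval_monomials)

lemma peval_add: "peval (F + G) x = peval F x + peval G x"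
  unfolding peval_monomials
  by (rule setsum_keys_plus_distrib[where f = "\<lambda>m c. of_rat c * monomial_value m x"])
    (simp_all add: of_rat_add distrib_right)

lemma peval_sum: "peval (\<Sum>i\<in>I. F i) x = (\<Sum>i\<in>I. peval (F i) x)"
  by (induction I rule: infinite_finite_induct) (simp_all add: peval_add)

lemma peval_single: "peval (Poly_Mapping.single m c) x = of_rat c * monomial_value m x"
  by (simp add: peval_monomials)

lemma sum_of_monomials:
  fixes F :: "'a \<Rightarrow>\<^sub>0 'b::comm_monoid_add"
  shows "(\<Sum>m\<in>Poly_Mapping.keys F. Poly_Mapping.single m (Poly_Mapping.lookup F m)) = F"
proof (rule poly_mapping_eqI)
  fix k
  have "(\<Sum>m\<in>Poly_Mapping.keys F. Poly_Mapping.lookup (Poly_Mapping.single m (Poly_Mapping.lookup F m)) k)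
      = (\<Sum>m\<in>Poly_Mapping.keys F. if m = k then Poly_Mapping.lookup F m else 0)"
    by (intro sum.cong) (auto simp: lookup_single when_def)
  then show "Poly_Mapping.lookup (\<Sum>m\<in>Poly_Mapping.keys F.
      Poly_Mapping.single m (Poly_Mapping.lookup F m)) k = Poly_Mapping.lookup F k"
    by (simp add: lookup_sum in_keys_iff)
qed

lemma peval_mult: "peval (F * G) x = peval F x * peval G x"
proof -
  have "peval (F * G) x = (\<Sum>m\<in>Poly_Mapping.keys F. \<Sum>n\<in>Poly_Mapping.keys G.
      peval (Poly_Mapping.single m (Poly_Mapping.lookup F m) *
             Poly_Mapping.single n (Poly_Mapping.lookup G n)) x)"
    by (subst (1) sum_of_monomials[symmetric, of F], subst (1) sum_of_monomials[symmetric, of G])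
      (simp only: sum_product peval_sum)
  also have "\<dots> = peval F x * peval G x"
    by (simp add: mult_single peval_single monomial_value_add of_rat_mult sum_product
        peval_monomials[of F] peval_monomials[of G] mult_ac)
  finally show ?thesis .
qed

lemma multihom_add: "multihom ns d F \<Longrightarrow> multihom ns d G \<Longrightarrow> multihom ns d (F + G)"
  using subsetD[OF Poly_Mapping.keys_add[of F G]] unfolding multihom_def by blast

lemma multihom_mult:
  assumes "multihom ns d F" "multihom ns e G"
  shows "multihom ns (\<lambda>i. d i + e i) (F * G)"
  unfolding multihom_def
proof (intro ballI conjI allI impI)
  fix m assume "m \<in> Poly_Mapping.keys (F * G)"
  then obtain a b where m: "m = a + b" "a \<in> Poly_Mapping.keys F" "b \<in> Poly_Mapping.keys G"
    using Poly_Mapping.keys_mult[of F G] by blast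
  { fix v assume "v \<in> Poly_Mapping.keys m"
    then have "v \<in> Poly_Mapping.keys a \<union> Poly_Mapping.keys b"
      using m(1) Poly_Mapping.keys_add[of a b] by blast
    then show "case v of (i, j) \<Rightarrow> i < length ns \<and> j \<le> ns ! i"
      using assms m unfolding multihom_def by fastforce }
  { fix i assume "i < length ns"
    then show "(\<Sum>j\<le>ns ! i. Poly_Mapping.lookup m (i, j)) = d i + e i"
      using assms m unfolding multihom_def by (simp add: lookup_add sum.distrib) }
qed

lemma multihom_cong:
  "(\<And>i. i < length ns \<Longrightarrow> d i = e i) \<Longrightarrow> multihom ns d F = multihom ns e F"
  unfolding multihom_def by auto

text \<open>
  Forms are handled as the functions that they define.  Substituting forms for the variables is then
  composition of functions, and no substitution has to be defined on formal polynomials.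
\<close>

definition form_fun ::
  "nat list \<Rightarrow> (nat \<Rightarrow> nat) \<Rightarrow> ('k::field_char_0 list list \<Rightarrow> 'k) \<Rightarrow> bool" where
  "form_fun ns d f \<longleftrightarrow> (\<exists>F. multihom ns d F \<and> (\<forall>x. f x = peval F x))"

lemma form_fun_peval: "multihom ns d F \<Longrightarrow> form_fun ns d (peval F)"
  unfolding form_fun_def by auto

lemma form_fun_cong: "form_fun ns d f \<Longrightarrow> (\<And>i. i < length ns \<Longrightarrow> d i = e i) \<Longrightarrow> form_fun ns e f"
  unfolding form_fun_def using multihom_cong by blast

lemma form_fun_0: "form_fun ns d (\<lambda>x. 0)"
  unfolding form_fun_def by (rule exI[of _ 0]) (simp add: multihom_def)

lemma form_fun_const: "form_fun ns (\<lambda>_. 0) (\<lambda>x. of_rat c)"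
  unfolding form_fun_def
  by (rule exI[of _ "Poly_Mapping.single 0 c"]) (simp add: multihom_def peval_single)

lemma form_fun_var:
  assumes "i < length ns" "j \<le> ns ! i"
  shows "form_fun ns (\<lambda>k. if k = i then 1 else 0) (\<lambda>x. x ! i ! j)"
proof -
  have "(\<Sum>l\<le>ns ! k. Poly_Mapping.lookup (Poly_Mapping.single (i, j) (1::nat)) (k, l)) =
      (if k = i then 1 else 0)" for k
  proof -
    have "(\<Sum>l\<le>ns ! k. Poly_Mapping.lookup (Poly_Mapping.single (i, j) (1::nat)) (k, l)) =
        (\<Sum>l\<le>ns ! k. if l = j then if k = i then 1 else 0 else 0)"
      by (intro sum.cong) (auto simp: lookup_single when_def)
    then show ?thesis using assms by auto
  qed
  then have "multihom ns (\<lambda>k. if k = i then 1 else 0)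
      (Poly_Mapping.single (Poly_Mapping.single (i, j) 1) 1)"
    using assms by (simp add: multihom_def)
  then show ?thesis unfolding form_fun_def
    by (intro exI[of _ "Poly_Mapping.single (Poly_Mapping.single (i, j) 1) 1"])
      (simp add: peval_single monomial_value_def)
qed

lemma form_fun_add:
  "form_fun ns d f \<Longrightarrow> form_fun ns d g \<Longrightarrow> form_fun ns d (\<lambda>x. f x + g x)"
  unfolding form_fun_def using multihom_add peval_add by (metis (no_types, lifting))

lemma form_fun_mult:
  "form_fun ns d f \<Longrightarrow> form_fun ns e g \<Longrightarrow> form_fun ns (\<lambda>i. d i + e i) (\<lambda>x. f x * g x)"
  unfolding form_fun_def using multihom_mult peval_mult by (metis (no_types, lifting))

lemma form_fun_scale: "form_fun ns d f \<Longrightarrow> form_fun ns d (\<lambda>x. of_rat c * f x)"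
  using form_fun_mult[OF form_fun_const, of ns d f c] by simp

lemma form_fun_diff:
  "form_fun ns d f \<Longrightarrow> form_fun ns d g \<Longrightarrow> form_fun ns d (\<lambda>x. f x - g x)"
  using form_fun_add[of ns d f "\<lambda>x. of_rat (-1) * g x"] form_fun_scale[of ns d g "-1"] by simp

lemma form_fun_sum:
  "(\<And>i. i \<in> I \<Longrightarrow> form_fun ns d (f i)) \<Longrightarrow> form_fun ns d (\<lambda>x. \<Sum>i\<in>I. f i x)"
  by (induction I rule: infinite_finite_induct) (auto intro: form_fun_0 form_fun_add)

lemma form_fun_power: "form_fun ns d f \<Longrightarrow> form_fun ns (\<lambda>i. n * d i) (\<lambda>x. f x ^ n)"
proof (induction n)
  case 0
  show ?case using form_fun_const[of ns 1] by simp
next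
  case (Suc n)
  then show ?case using form_fun_mult[of ns d f "\<lambda>i. n * d i" "\<lambda>x. f x ^ n"] by simp
qed

lemma form_fun_prod:
  "(\<And>i. i \<in> I \<Longrightarrow> form_fun ns (d i) (f i)) \<Longrightarrow>
    form_fun ns (\<lambda>k. \<Sum>i\<in>I. d i k) (\<lambda>x. \<Prod>i\<in>I. f i x)"
proof (induction I rule: infinite_finite_induct)
  case (insert a I)
  then show ?case
    using form_fun_mult[of ns "d a" "f a" "\<lambda>k. \<Sum>i\<in>I. d i k" "\<lambda>x. \<Prod>i\<in>I. f i x"] by simp
qed (use form_fun_const[of ns 1] in simp_all)

text \<open>
  All monomials become products over one index set, grouped by the factors of the space; so exponents
  that belong to the same factor can be added up.
\<close>

lemma monomial_value_multihom:
  assumes "multihom ns d F" "m \<in> Poly_Mapping.keys F"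
  shows "monomial_value m x =
    (\<Prod>i<length ns. \<Prod>j\<le>ns ! i. (x ! i ! j) ^ Poly_Mapping.lookup m (i, j))"
proof -
  have "Poly_Mapping.keys m \<subseteq> (SIGMA i:{..<length ns}. {..ns ! i})"
    using assms unfolding multihom_def by auto
  then have "monomial_value m x = (\<Prod>v\<in>(SIGMA i:{..<length ns}. {..ns ! i}).
      (x ! fst v ! snd v) ^ Poly_Mapping.lookup m v)"
    by (intro monomial_value_superset) auto
  then show ?thesis by (simp add: prod.Sigma case_prod_beta)
qed

lemma monomial_degree:
  assumes "multihom ns d F" "m \<in> Poly_Mapping.keys F" "i < length ns"
  shows "(\<Sum>j\<le>ns ! i. Poly_Mapping.lookup m (i, j)) = d i"
  using assms unfolding multihom_def by auto

text \<open>
  If the coordinates of the \<open>i\<close>-th factor are replaced by forms of degree \<open>e i\<close>, then a monomial in which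
  \<open>d i\<close> of them occur, with multiplicities, contributes \<open>d i * e i\<close> to the degree.
\<close>

lemma form_fun_compose:
  assumes f: "form_fun ns d f"
    and s: "\<And>i j. i < length ns \<Longrightarrow> j \<le> ns ! i \<Longrightarrow> form_fun ms (e i) (\<lambda>z. s z ! i ! j)"
  shows "form_fun ms (\<lambda>k. \<Sum>i<length ns. d i * e i k) (\<lambda>z. f (s z))"
proof -
  obtain F where F: "multihom ns d F" "\<And>x. f x = peval F x"
    using f unfolding form_fun_def by auto
  have "form_fun ms (\<lambda>k. \<Sum>i<length ns. d i * e i k) (\<lambda>z. monomial_value m (s z))"
    if m: "m \<in> Poly_Mapping.keys F" for m
  proof -
    have "form_fun ms (\<lambda>k. \<Sum>i<length ns. \<Sum>j\<le>ns ! i. Poly_Mapping.lookup m (i, j) * e i k)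
        (\<lambda>z. \<Prod>i<length ns. \<Prod>j\<le>ns ! i. (s z ! i ! j) ^ Poly_Mapping.lookup m (i, j))"
      by (intro form_fun_prod form_fun_power s) auto
    moreover have "(\<Sum>j\<le>ns ! i. Poly_Mapping.lookup m (i, j) * e i k) = d i * e i k"
      if "i < length ns" for i k
      using monomial_degree[OF F(1) m that] by (simp flip: sum_distrib_right)
    ultimately show ?thesis
      by (simp add: monomial_value_multihom[OF F(1) m])
  qed
  then show ?thesis
    unfolding F(2) peval_monomials by (intro form_fun_sum form_fun_scale)
qed

text \<open>
  This is why the vanishing of a form at a point is independent of the coordinates.
\<close>

lemma form_fun_rescale:
  assumes f: "form_fun ns d f"
    and x: "\<And>i j. i < length ns \<Longrightarrow> j \<le> ns ! i \<Longrightarrow> x' ! i ! j = c i * x ! i ! j"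
  shows "f x' = (\<Prod>i<length ns. c i ^ d i) * f x"
proof -
  obtain F where F: "multihom ns d F" "\<And>x. f x = peval F x"
    using f unfolding form_fun_def by auto
  have "monomial_value m x' = (\<Prod>i<length ns. c i ^ d i) * monomial_value m x"
    if m: "m \<in> Poly_Mapping.keys F" for m
  proof -
    have "monomial_value m x' = (\<Prod>i<length ns. \<Prod>j\<le>ns ! i.
        c i ^ Poly_Mapping.lookup m (i, j) * (x ! i ! j) ^ Poly_Mapping.lookup m (i, j))"
      by (simp add: monomial_value_multihom[OF F(1) m] x power_mult_distrib)
    also have "\<dots> = (\<Prod>i<length ns. c i ^ d i) * monomial_value m x"
      by (simp add: prod.distrib monomial_value_multihom[OF F(1) m] monomial_degree[OF F(1) m]
          flip: power_sum)
    finally show ?thesis .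
  qed
  then show ?thesis by (simp add: F(2) peval_monomials sum_distrib_left mult_ac)
qed


section \<open>Coordinate vectors and closed sets\<close>

text \<open>
  Points are sets of coordinate vectors, whereas all computations take place in coordinates.  The map
  \<open>map proj\<close> goes from the vectors below to the points that they represent.
\<close>

definition homog_coords :: "nat list \<Rightarrow> 'k::field list list set" where
  "homog_coords ns = {x. list_all2 (\<lambda>v n. length v = Suc n \<and> (\<exists>a\<in>set v. a \<noteq> 0)) x ns}"

lemma in_listset: "x \<in> listset p \<longleftrightarrow> list_all2 (\<in>) x p"
  by (induction p arbitrary: x) (auto simp: set_Cons_def list_all2_Cons2)

lemma proj_eqI: "u \<in> proj v \<Longrightarrow> proj u = proj (v :: 'k::field list)"
  by (auto simp: proj_def[of v] proj_map)

lemma proj_nonzero: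
  assumes "length v = Suc n" "\<exists>a\<in>set v. a \<noteq> (0::'k::field)" "u \<in> proj v"
  shows "length u = Suc n \<and> (\<exists>a\<in>set u. a \<noteq> 0)"
  using assms by (auto simp: proj_def)

lemma proj_space_iff:
  "P \<in> proj_space n \<and> u \<in> P \<longleftrightarrow>
    (length u = Suc n \<and> (\<exists>a\<in>set u. a \<noteq> (0::'k::field))) \<and> P = proj u"
proof
  assume P: "P \<in> proj_space n \<and> u \<in> P"
  then obtain v where v: "P = proj v" "length v = Suc n" "\<exists>a\<in>set v. a \<noteq> 0"
    unfolding proj_space_def by blast
  then show "(length u = Suc n \<and> (\<exists>a\<in>set u. a \<noteq> 0)) \<and> P = proj u"
    using proj_nonzero[OF v(2,3), of u] proj_eqI[of u v] P by simp
next
  assume "(length u = Suc n \<and> (\<exists>a\<in>set u. a \<noteq> 0)) \<and> P = proj u"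
  then show "P \<in> proj_space n \<and> u \<in> P"
    using self_in_proj[of u] unfolding proj_space_def by blast
qed

lemma mproj_coords: "p \<in> mproj ns \<and> x \<in> listset p \<longleftrightarrow> x \<in> homog_coords ns \<and> p = map proj x"
proof -
  have "p \<in> mproj ns \<and> x \<in> listset p \<longleftrightarrow>
      length p = length ns \<and> length x = length ns \<and>
      (\<forall>i<length ns. p ! i \<in> proj_space (ns ! i) \<and> x ! i \<in> p ! i)"
    by (auto simp: mproj_def in_listset list_all2_conv_all_nth)
  also have "\<dots> \<longleftrightarrow> length p = length ns \<and> length x = length ns \<and>
      (\<forall>i<length ns. (length (x ! i) = Suc (ns ! i) \<and> (\<exists>a\<in>set (x ! i). a \<noteq> 0)) \<and> p ! i = proj (x ! i))"
    unfolding proj_space_iff ..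
  also have "\<dots> \<longleftrightarrow> x \<in> homog_coords ns \<and> length p = length x \<and> (\<forall>i<length x. p ! i = map proj x ! i)"
    unfolding homog_coords_def mem_Collect_eq list_all2_conv_all_nth
    by (metis nth_map)
  also have "\<dots> \<longleftrightarrow> x \<in> homog_coords ns \<and> p = map proj x"
    using list_eq_iff_nth_eq[of p "map proj x"] by auto
  finally show ?thesis .
qed

lemma map_proj_in_mproj: "x \<in> homog_coords ns \<Longrightarrow> map proj x \<in> mproj ns"
  and in_listset_map_proj: "x \<in> homog_coords ns \<Longrightarrow> x \<in> listset (map proj x)"
  using mproj_coords by blast+

lemma mproj_obtain_coords:
  assumes "p \<in> mproj ns"
  obtains x where "x \<in> listset p" "x \<in> homog_coords ns" "p = map proj x"
proof -
  have *: "\<exists>v\<in>P. True" if "P \<in> proj_space n" for P :: "'a list set" and n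
    using that self_in_proj unfolding proj_space_def by blast
  have "\<exists>x. x \<in> listset p"
    using assms unfolding mproj_def mem_Collect_eq
  proof (induction rule: list_all2_induct)
    case (Cons P p n ns)
    then obtain v x where "v \<in> P" "x \<in> listset p" using * by blast
    then have "v # x \<in> listset (P # p)" by (auto simp: set_Cons_def)
    then show ?case by blast
  qed simp
  then show ?thesis using that mproj_coords assms by blast
qed

lemma homog_coordsD:
  assumes "x \<in> homog_coords ns"
  shows "length x = length ns"
    and "i < length ns \<Longrightarrow> length (x ! i) = Suc (ns ! i)"
    and "i < length ns \<Longrightarrow> \<exists>j\<le>ns ! i. x ! i ! j \<noteq> 0"
proof -
  show "length x = length ns" and len: "i < length ns \<Longrightarrow> length (x ! i) = Suc (ns ! i)"
    using assms unfolding homog_coords_def list_all2_conv_all_nth by auto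
  assume i: "i < length ns"
  then obtain a where "a \<in> set (x ! i)" "a \<noteq> 0"
    using assms unfolding homog_coords_def list_all2_conv_all_nth by auto
  then show "\<exists>j\<le>ns ! i. x ! i ! j \<noteq> 0"
    using len[OF i] by (auto simp: in_set_conv_nth less_Suc_eq_le)
qed

lemma coords_rescale:
  assumes "p \<in> mproj ns" "x \<in> listset p" "x' \<in> listset p"
  obtains c where "\<And>i. i < length ns \<Longrightarrow> c i \<noteq> 0"
    and "\<And>i. i < length ns \<Longrightarrow> x' ! i = map ((*) (c i)) (x ! i)"
    and "\<And>i j. i < length ns \<Longrightarrow> j \<le> ns ! i \<Longrightarrow> x' ! i ! j = c i * x ! i ! j"
proof -
  have x: "x \<in> homog_coords ns" "p = map proj x" and x': "x' \<in> homog_coords ns" "p = map proj x'"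
    using assms mproj_coords by blast+
  have "\<exists>c. c \<noteq> 0 \<and> x' ! i = map ((*) c) (x ! i)" if "i < length ns" for i
  proof -
    have "proj (x ! i) = proj (x' ! i)"
      using that arg_cong[OF trans[OF x(2)[symmetric] x'(2)], of "\<lambda>l. l ! i"]
        homog_coordsD(1)[OF x(1)] homog_coordsD(1)[OF x'(1)] by simp
    then show ?thesis using self_in_proj[of "x' ! i"] by (auto simp: proj_def)
  qed
  then have "\<forall>i\<in>{..<length ns}. \<exists>c. c \<noteq> 0 \<and> x' ! i = map ((*) c) (x ! i)" by blast
  then obtain c where c: "\<And>i. i < length ns \<Longrightarrow> c i \<noteq> 0 \<and> x' ! i = map ((*) (c i)) (x ! i)"
    using bchoice[of "{..<length ns}" "\<lambda>i c. c \<noteq> 0 \<and> x' ! i = map ((*) c) (x ! i)"] by blast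
  show ?thesis
    by (rule that[of c]) (use c homog_coordsD(2)[OF x(1)] in auto)
qed

lemma form_fun_zero_iff:
  assumes "form_fun ns d f" "p \<in> mproj ns" "x \<in> listset p" "x' \<in> listset p"
  shows "f x = 0 \<longleftrightarrow> f x' = 0"
proof -
  obtain c where c: "\<And>i. i < length ns \<Longrightarrow> c i \<noteq> 0"
    "\<And>i j. i < length ns \<Longrightarrow> j \<le> ns ! i \<Longrightarrow> x' ! i ! j = c i * x ! i ! j"
    by (rule coords_rescale[OF assms(2-4)]) blast
  have "f x' = (\<Prod>i<length ns. c i ^ d i) * f x"
    by (rule form_fun_rescale[OF assms(1)]) (use c in auto)
  then show ?thesis using c(1) by auto
qed

text \<open>
  A product of powers of one nonzero coordinate from each factor.
\<close>

lemma form_fun_nonzero_at: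
  assumes "x \<in> homog_coords ns"
  obtains h where "form_fun ns d h" "h x \<noteq> (0::'k::field_char_0)"
proof -
  obtain J where J: "\<And>i. i < length ns \<Longrightarrow> J i \<le> ns ! i \<and> x ! i ! J i \<noteq> 0"
    using bchoice[of "{..<length ns}" "\<lambda>i j. j \<le> ns ! i \<and> x ! i ! j \<noteq> 0"]
      homog_coordsD(3)[OF assms] by blast
  define h where "h = (\<lambda>x::'k list list. \<Prod>i<length ns. (x ! i ! J i) ^ d i)"
  have "form_fun ns (\<lambda>k. \<Sum>i<length ns. d i * (if k = i then 1 else 0)) h"
    unfolding h_def using J by (intro form_fun_prod form_fun_power form_fun_var) auto
  then have "form_fun ns d h"
    by (rule form_fun_cong) (simp add: if_distrib cong: if_cong)
  moreover have "h x \<noteq> 0" using J by (auto simp: h_def)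
  ultimately show ?thesis using that by blast
qed

definition vanishes_on :: "('k list list \<Rightarrow> 'k::zero) \<Rightarrow> 'k mpoint set \<Rightarrow> bool" where
  "vanishes_on f S \<longleftrightarrow> (\<forall>p\<in>S. \<forall>x\<in>listset p. f x = 0)"

text \<open>
  Forms that come from the definition of closed sets have unrelated degrees.  Before two of them can be
  added or compared, they are multiplied by forms that do not vanish at the point considered.
\<close>

lemma form_fun_raise_degree:
  assumes "form_fun ns d f" "x \<in> homog_coords ns" "f x \<noteq> 0"
    and "\<And>i. i < length ns \<Longrightarrow> d i \<le> e i"
  obtains g where "form_fun ns e g" "g x \<noteq> (0::'k::field_char_0)" "\<And>y. f y = 0 \<Longrightarrow> g y = 0"
proof -
  obtain h where h: "form_fun ns (\<lambda>i. e i - d i) h" "h x \<noteq> 0"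
    using form_fun_nonzero_at[OF assms(2)] .
  have "form_fun ns (\<lambda>i. d i + (e i - d i)) (\<lambda>y. f y * h y)"
    by (rule form_fun_mult[OF assms(1) h(1)])
  then have "form_fun ns e (\<lambda>y. f y * h y)"
    by (rule form_fun_cong) (use assms(4) in simp)
  then show ?thesis using that[of "\<lambda>y. f y * h y"] h assms by auto
qed

lemma topspace_zariski [simp]: "topspace (zariski ns) = mproj ns"
proof -
  have "p \<in> {p \<in> mproj ns. \<exists>x\<in>listset p. peval 1 x \<noteq> 0}" if p: "p \<in> mproj ns" for p :: "'a mpoint"
  proof -
    obtain x where "x \<in> listset p" using mproj_obtain_coords[OF p] by blast
    moreover have "peval 1 x = (1 :: 'a)"
      using peval_single[of 0 1 x] by simp
    ultimately show ?thesis using p by force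
  qed
  moreover have "multihom ns (\<lambda>_. 0) 1" by (simp add: multihom_def)
  ultimately show ?thesis unfolding zariski_def by auto
qed

lemma openin_nonvanishing:
  assumes "form_fun ns d f"
  shows "openin (zariski_on ns Y) {p \<in> Y \<inter> mproj ns. \<exists>x\<in>listset p. f x \<noteq> 0}"
proof -
  obtain F where "multihom ns d F" "\<And>x. f x = peval F x"
    using assms unfolding form_fun_def by auto
  then have "openin (zariski ns) {p \<in> mproj ns. \<exists>x\<in>listset p. f x \<noteq> 0}"
    unfolding zariski_def by (intro topology_generated_by_Basis) auto
  then show ?thesis unfolding openin_subtopology by blast
qed

lemma closedin_zariskiI:
  assumes "C \<subseteq> Y" "C \<subseteq> mproj ns"
    and "\<And>p. p \<in> Y \<Longrightarrow> p \<in> mproj ns \<Longrightarrow> p \<notin> C \<Longrightarrow>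
        \<exists>d f. form_fun ns d f \<and> (\<exists>x\<in>listset p. f x \<noteq> 0) \<and> vanishes_on f C"
  shows "closedin (zariski_on ns Y) C"
  unfolding closedin_def
proof
  show "C \<subseteq> topspace (zariski_on ns Y)" using assms by (simp add: topspace_subtopology)
  show "openin (zariski_on ns Y) (topspace (zariski_on ns Y) - C)"
  proof (subst openin_subopen, intro ballI)
    fix p assume "p \<in> topspace (zariski_on ns Y) - C"
    then have p: "p \<in> Y" "p \<in> mproj ns" "p \<notin> C" by (auto simp: topspace_subtopology)
    then obtain d f where f: "form_fun ns d f" "\<exists>x\<in>listset p. f x \<noteq> 0" "vanishes_on f C"
      using assms(3) by blast
    show "\<exists>T. openin (zariski_on ns Y) T \<and> p \<in> T \<and> T \<subseteq> topspace (zariski_on ns Y) - C"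
      using openin_nonvanishing[OF f(1), of Y] p f(2,3)
      by (intro exI[of _ "{p \<in> Y \<inter> mproj ns. \<exists>x\<in>listset p. f x \<noteq> 0}"])
        (auto simp: topspace_subtopology vanishes_on_def)
  qed
qed

lemma closedin_zero_set:
  assumes "form_fun ns d f"
  shows "closedin (zariski_on ns Y) {p \<in> Y \<inter> mproj ns. \<forall>x\<in>listset p. f x = 0}"
  by (rule closedin_zariskiI) (use assms in \<open>auto simp: vanishes_on_def\<close>)

lemma nonvanishing_set_eq:
  assumes "form_fun ns d f" "Y \<subseteq> mproj ns"
  shows "{p \<in> Y \<inter> mproj ns. \<exists>x\<in>listset p. f x \<noteq> 0} = {p \<in> Y. \<forall>x\<in>listset p. f x \<noteq> 0}"
proof -
  have "(\<exists>x\<in>listset p. f x \<noteq> 0) \<longleftrightarrow> (\<forall>x\<in>listset p. f x \<noteq> 0)" if "p \<in> Y" for p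
  proof -
    have p: "p \<in> mproj ns" using assms(2) that by blast
    obtain x where "x \<in> listset p" using mproj_obtain_coords[OF p] by blast
    then show ?thesis using form_fun_zero_iff[OF assms(1) p] by blast
  qed
  then show ?thesis using assms(2) by blast
qed

text \<open>
  The non-vanishing loci are a base and not only a subbase of the topology, because the intersection of
  two of them is the non-vanishing locus of a product.
\<close>

lemma open_contains_nonvanishing:
  assumes "openin (zariski ns) U" "p \<in> U"
  shows "\<exists>d f. form_fun ns d f \<and> (\<forall>x\<in>listset p. f x \<noteq> (0::'k::field_char_0)) \<and>
    {q \<in> mproj ns. \<exists>x\<in>listset q. f x \<noteq> 0} \<subseteq> U"
proof -
  have pm: "p \<in> mproj ns" using assms openin_subset by fastforce
  have "generate_topology_on {{p \<in> mproj ns. \<exists>x\<in>listset p. peval F x \<noteq> (0::'k)} | F d. multihom ns d F} U"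
    using assms(1) unfolding zariski_def by (rule openin_topology_generated_by)
  then show ?thesis using assms(2)
  proof induction
    case Empty
    then show ?case by simp
  next
    case (Int a b)
    then obtain d f e g where
      f: "form_fun ns d f" "\<forall>x\<in>listset p. f x \<noteq> 0" "{q \<in> mproj ns. \<exists>x\<in>listset q. f x \<noteq> 0} \<subseteq> a" and
      g: "form_fun ns e g" "\<forall>x\<in>listset p. g x \<noteq> 0" "{q \<in> mproj ns. \<exists>x\<in>listset q. g x \<noteq> 0} \<subseteq> b"
      by auto
    show ?case
      using form_fun_mult[OF f(1) g(1)] f g
      by (intro exI[of _ "\<lambda>i. d i + e i"] exI[of _ "\<lambda>x. f x * g x"]) auto
  next
    case (UN K)
    then obtain k where k: "k \<in> K" "p \<in> k" by auto
    then show ?case using UN.IH[OF k] by blast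
  next
    case (Basis s)
    then obtain F d where F: "multihom ns d F"
      and s: "s = {p \<in> mproj ns. \<exists>x\<in>listset p. peval F x \<noteq> 0}" by auto
    have "\<forall>x\<in>listset p. peval F x \<noteq> 0"
      using Basis s form_fun_zero_iff[OF form_fun_peval[OF F] pm] by blast
    then show ?case
      using s form_fun_peval[OF F] by blast
  qed
qed

text \<open>
  Together with \<open>closedin_zariskiI\<close> this reduces questions on closed sets to the existence of one form.
\<close>

lemma closedin_separate:
  assumes "closedin (zariski_on ns Y) C" "p \<in> Y" "p \<in> mproj ns" "p \<notin> C"
  obtains d f where "form_fun ns d f" "\<And>x. x \<in> listset p \<Longrightarrow> f x \<noteq> (0::'k::field_char_0)"
    "vanishes_on f C"
proof -
  have CY: "C \<subseteq> Y" "C \<subseteq> mproj ns"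
    using closedin_subset[OF assms(1)] by (auto simp: topspace_subtopology)
  obtain U where U: "openin (zariski ns) U" "topspace (zariski_on ns Y) - C = U \<inter> Y"
    using assms(1) unfolding closedin_def openin_subtopology by auto
  then have "p \<in> U" using assms by (auto simp: topspace_subtopology)
  from open_contains_nonvanishing[OF U(1) this] obtain d f where
    f: "form_fun ns d f" "\<forall>x\<in>listset p. f x \<noteq> 0" "{q \<in> mproj ns. \<exists>x\<in>listset q. f x \<noteq> 0} \<subseteq> U"
    by auto
  have "vanishes_on f C"
    using f(3) U(2) CY unfolding vanishes_on_def by blast
  then show ?thesis using that f by auto
qed


section \<open>Irreducible sets\<close>

text \<open>
  Forms are restricted to curves given by expressions in \<open>t\<close>.  Closure rules for the resulting functions
  avoid the corresponding expressions of type \<open>poly\<close>.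
\<close>

definition poly_fun :: "('k::comm_ring_1 \<Rightarrow> 'k) \<Rightarrow> bool" where
  "poly_fun h \<longleftrightarrow> (\<exists>Q. \<forall>t. h t = poly Q t)"

lemma poly_fun_const: "poly_fun (\<lambda>t. c)"
  unfolding poly_fun_def by (rule exI[of _ "[:c:]"]) simp

lemma poly_fun_id: "poly_fun (\<lambda>t. t)"
  unfolding poly_fun_def by (rule exI[of _ "[:0, 1:]"]) simp

lemma poly_fun_add: "poly_fun f \<Longrightarrow> poly_fun g \<Longrightarrow> poly_fun (\<lambda>t. f t + g t)"
  unfolding poly_fun_def by (metis poly_add)

lemma poly_fun_mult: "poly_fun f \<Longrightarrow> poly_fun g \<Longrightarrow> poly_fun (\<lambda>t. f t * g t)"
  unfolding poly_fun_def by (metis poly_mult)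

lemma poly_fun_power: "poly_fun f \<Longrightarrow> poly_fun (\<lambda>t. f t ^ n)"
  unfolding poly_fun_def by (metis poly_power)

lemma poly_fun_sum: "(\<And>i. i \<in> I \<Longrightarrow> poly_fun (f i)) \<Longrightarrow> poly_fun (\<lambda>t. \<Sum>i\<in>I. f i t)"
  by (induction I rule: infinite_finite_induct) (auto intro: poly_fun_const poly_fun_add)

lemma poly_fun_prod: "(\<And>i. i \<in> I \<Longrightarrow> poly_fun (f i)) \<Longrightarrow> poly_fun (\<lambda>t. \<Prod>i\<in>I. f i t)"
  by (induction I rule: infinite_finite_induct) (auto intro: poly_fun_const poly_fun_mult)

lemma finite_zeros_poly_fun:
  assumes "poly_fun f" "f s \<noteq> (0::'k::field_char_0)"
  shows "finite {t. f t = 0}"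
proof -
  obtain Q where Q: "\<And>t. f t = poly Q t" using assms(1) unfolding poly_fun_def by auto
  then have "Q \<noteq> 0" using assms(2) by auto
  then show ?thesis using poly_roots_finite Q by simp
qed

lemma form_fun_on_curve:
  assumes "form_fun ns d f"
    and x: "\<And>i j. i < length ns \<Longrightarrow> j \<le> ns ! i \<Longrightarrow> poly_fun (\<lambda>t. x t ! i ! j)"
  shows "poly_fun (\<lambda>t. f (x t))"
proof -
  obtain F where F: "multihom ns d F" "\<And>x. f x = peval F x"
    using assms(1) unfolding form_fun_def by auto
  have "poly_fun (\<lambda>t. monomial_value m (x t))" if m: "m \<in> Poly_Mapping.keys F" for m
    unfolding monomial_value_multihom[OF F(1) m]
    by (intro poly_fun_prod poly_fun_power x) auto
  then show ?thesis
    unfolding F(2) peval_monomials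
    by (intro poly_fun_sum poly_fun_mult poly_fun_const) auto
qed

text \<open>
  If \<open>A\<close> and \<open>B\<close> cover \<open>S\<close>, a form vanishing on \<open>A\<close> but not at \<open>p\<close> and a form vanishing on \<open>B\<close> but not at
  \<open>q\<close> restrict to nonzero polynomials on a curve from \<open>p\<close> to \<open>q\<close>, so that neither vanishes at a general
  point of the curve.  The curve runs in the space of coordinate vectors.  It may leave the cone over
  \<open>S\<close> at finitely many parameters, where the coordinates of a factor become zero.
\<close>

lemma irreducible_in_by_curves:
  assumes S: "S \<subseteq> Y" "S \<subseteq> mproj ns" "S \<noteq> {}"
    and curve: "\<And>p q. p \<in> S \<Longrightarrow> q \<in> S \<Longrightarrow> \<exists>x :: 'k::field_char_0 \<Rightarrow> 'k list list.
      (\<forall>i<length ns. \<forall>j\<le>ns ! i. poly_fun (\<lambda>t. x t ! i ! j)) \<and>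
      x 0 \<in> listset p \<and> x 1 \<in> listset q \<and> finite {t. \<not> (\<exists>r\<in>S. x t \<in> listset r)}"
  shows "irreducible_in (zariski_on ns Y) S"
  unfolding irreducible_in_def
proof (intro conjI allI impI)
  show "S \<subseteq> topspace (zariski_on ns Y)" using S by (simp add: topspace_subtopology)
  show "S \<noteq> {}" by (rule S)
  fix A B
  assume AB: "closedin (zariski_on ns Y) A \<and> closedin (zariski_on ns Y) B \<and> S \<subseteq> A \<union> B"
  show "S \<subseteq> A \<or> S \<subseteq> B"
  proof (rule ccontr)
    assume "\<not> (S \<subseteq> A \<or> S \<subseteq> B)"
    then obtain p q where pq: "p \<in> S" "p \<notin> A" "q \<in> S" "q \<notin> B" by blast
    obtain d f where f: "form_fun ns d f" "\<And>x. x \<in> listset p \<Longrightarrow> f x \<noteq> 0" "vanishes_on f A"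
      using closedin_separate[of ns Y A p] AB pq S by blast
    obtain e g where g: "form_fun ns e g" "\<And>x. x \<in> listset q \<Longrightarrow> g x \<noteq> 0" "vanishes_on g B"
      using closedin_separate[of ns Y B q] AB pq S by blast
    obtain x :: "'k \<Rightarrow> 'k list list" where
      x: "\<And>i j. i < length ns \<Longrightarrow> j \<le> ns ! i \<Longrightarrow> poly_fun (\<lambda>t. x t ! i ! j)"
        "x 0 \<in> listset p" "x 1 \<in> listset q" "finite {t. \<not> (\<exists>r\<in>S. x t \<in> listset r)}"
      using curve[OF pq(1,3)] by blast
    have "finite {t. f (x t) = 0}"
      by (rule finite_zeros_poly_fun[OF form_fun_on_curve[OF f(1) x(1)] f(2)[OF x(2)]])
    moreover have "finite {t. g (x t) = 0}"
      by (rule finite_zeros_poly_fun[OF form_fun_on_curve[OF g(1) x(1)] g(2)[OF x(3)]])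
    ultimately have fin: "finite ({t. f (x t) = 0} \<union> {t. g (x t) = 0} \<union> {t. \<not> (\<exists>r\<in>S. x t \<in> listset r)})"
      using x(4) by simp
    obtain t where "t \<notin> {t. f (x t) = 0} \<union> {t. g (x t) = 0} \<union> {t. \<not> (\<exists>r\<in>S. x t \<in> listset r)}"
      using ex_new_if_finite[OF infinite_UNIV_char_0 fin] by blast
    then have t: "f (x t) \<noteq> 0" "g (x t) \<noteq> 0" "\<exists>r\<in>S. x t \<in> listset r" by simp_all
    then show False using AB f(3) g(3) unfolding vanishes_on_def by blast
  qed
qed

text \<open>
  The forms modulo those that vanish on an irreducible set have no zero divisors.
\<close>

lemma irreducible_in_prime:
  assumes irr: "irreducible_in (zariski_on ns Y) C"
    and f: "form_fun ns d f" and g: "form_fun ns e g"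
    and fg: "vanishes_on (\<lambda>x. f x * g x) (C :: 'k::field_char_0 mpoint set)"
  shows "vanishes_on f C \<or> vanishes_on g C"
proof -
  let ?A = "{p \<in> Y \<inter> mproj ns. \<forall>x\<in>listset p. f x = 0}"
  let ?B = "{p \<in> Y \<inter> mproj ns. \<forall>x\<in>listset p. g x = 0}"
  have C: "C \<subseteq> Y \<inter> mproj ns"
    using irr unfolding irreducible_in_def by (auto simp: topspace_subtopology)
  have "p \<in> ?A \<union> ?B" if "p \<in> C" for p
  proof -
    have pm: "p \<in> mproj ns" using C that by auto
    obtain x where x: "x \<in> listset p" using mproj_obtain_coords[OF pm] by blast
    then have "f x * g x = 0" using fg that unfolding vanishes_on_def by blast
    then have "f x = 0 \<or> g x = 0" by simp
    then have "(\<forall>x\<in>listset p. f x = 0) \<or> (\<forall>x\<in>listset p. g x = 0)"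
      using form_fun_zero_iff[OF f pm x] form_fun_zero_iff[OF g pm x] by blast
    then show ?thesis using C that by blast
  qed
  then have "C \<subseteq> ?A \<union> ?B" by blast
  then have "C \<subseteq> ?A \<or> C \<subseteq> ?B"
    using irr closedin_zero_set[OF f, of Y] closedin_zero_set[OF g, of Y]
    unfolding irreducible_in_def by presburger
  then show ?thesis unfolding vanishes_on_def by blast
qed

text \<open>
  The curves are the images of straight lines in the space of parameters.  The parameters are taken in
  two pairs, as in the coordinates of a bundle of projective lines over a projective line, and \<open>E\<close>
  describes an affine subspace that cuts out a part of it.
\<close>

lemma irreducible_in_parametrized:
  fixes P :: "'k::field_char_0 \<Rightarrow> 'k \<Rightarrow> 'k \<Rightarrow> 'k \<Rightarrow> 'k list list"
  assumes S: "S \<subseteq> Y" "S \<subseteq> mproj ns" "S \<noteq> {}"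
    and poly: "\<And>i j a b c d. i < length ns \<Longrightarrow> j \<le> ns ! i \<Longrightarrow> poly_fun a \<Longrightarrow> poly_fun b \<Longrightarrow>
      poly_fun c \<Longrightarrow> poly_fun d \<Longrightarrow> poly_fun (\<lambda>t. P (a t) (b t) (c t) (d t) ! i ! j)"
    and affine: "\<And>a b c d a' b' c' d' t. E a b c d \<Longrightarrow> E a' b' c' d' \<Longrightarrow>
      E (a + t * (a' - a)) (b + t * (b' - b)) (c + t * (c' - c)) (d + t * (d' - d))"
    and onto: "\<And>p. p \<in> S \<Longrightarrow> \<exists>a b c d. E a b c d \<and> (a \<noteq> 0 \<or> b \<noteq> 0) \<and> (c \<noteq> 0 \<or> d \<noteq> 0) \<and>
      P a b c d \<in> listset p"
    and into: "\<And>a b c d. E a b c d \<Longrightarrow> a \<noteq> 0 \<or> b \<noteq> 0 \<Longrightarrow> c \<noteq> 0 \<or> d \<noteq> 0 \<Longrightarrow>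
      \<exists>p\<in>S. P a b c d \<in> listset p"
  shows "irreducible_in (zariski_on ns Y) S"
proof (rule irreducible_in_by_curves[OF S])
  fix p q assume "p \<in> S" "q \<in> S"
  then obtain a b c d a' b' c' d' where
    p: "E a b c d" "a \<noteq> 0 \<or> b \<noteq> 0" "c \<noteq> 0 \<or> d \<noteq> 0" "P a b c d \<in> listset p" and
    q: "E a' b' c' d'" "P a' b' c' d' \<in> listset q"
    using onto by metis
  define l where "l u u' t = u + t * (u' - u)" for u u' t :: 'k
  have l: "poly_fun (l u u')" for u u'
    unfolding l_def by (intro poly_fun_add poly_fun_mult poly_fun_const poly_fun_id)
  define x where "x t = P (l a a' t) (l b b' t) (l c c' t) (l d d' t)" for t
  have fin: "finite {t. l u u' t = 0 \<and> l v v' t = 0}" if "u \<noteq> 0 \<or> v \<noteq> 0" for u u' v v'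
    using that finite_zeros_poly_fun[OF l, of u u' 0] finite_zeros_poly_fun[OF l, of v v' 0]
    by (auto simp: l_def elim: rev_finite_subset)
  have "{t. \<not> (\<exists>r\<in>S. x t \<in> listset r)} \<subseteq>
      {t. l a a' t = 0 \<and> l b b' t = 0} \<union> {t. l c c' t = 0 \<and> l d d' t = 0}"
    using into[OF affine[OF p(1) q(1)]] unfolding x_def l_def by blast
  then have "finite {t. \<not> (\<exists>r\<in>S. x t \<in> listset r)}"
    using fin[OF p(2)] fin[OF p(3)] by (meson finite_UnI finite_subset)
  moreover have "\<forall>i<length ns. \<forall>j\<le>ns ! i. poly_fun (\<lambda>t. x t ! i ! j)"
    unfolding x_def using l by (intro allI impI poly)
  ultimately show "\<exists>x. (\<forall>i<length ns. \<forall>j\<le>ns ! i. poly_fun (\<lambda>t. x t ! i ! j)) \<and>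
      x 0 \<in> listset p \<and> x 1 \<in> listset q \<and> finite {t. \<not> (\<exists>r\<in>S. x t \<in> listset r)}"
    using p(4) q(2) by (intro exI[of _ x]) (simp add: x_def l_def)
qed

lemma irreducible_open_dense:
  assumes "irreducible_in T X" "topspace T = X" "openin T U" "U \<noteq> {}"
  shows "T closure_of U = X"
proof -
  have "closedin T (T closure_of U)" "closedin T (X - U)"
    using closedin_diff[OF closedin_topspace assms(3)] assms(2) by simp_all
  moreover have UX: "U \<subseteq> X" using assms(2,3) openin_subset by blast
  then have "X \<subseteq> T closure_of U \<union> (X - U)"
    using closure_of_subset[of U T] assms(2) by blast
  ultimately have "X \<subseteq> T closure_of U \<or> X \<subseteq> X - U"
    using assms(1) unfolding irreducible_in_def by blast
  then show ?thesis using UX assms(2,4) closure_of_subset_topspace[of T U] by blast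
qed

lemma variety_of_zero_set:
  assumes "form_fun ns d f" "irreducible_in (zariski ns) {p \<in> mproj ns. \<forall>x\<in>listset p. f x = 0}"
  shows "variety ns {p \<in> mproj ns. \<forall>x\<in>listset p. f x = 0}"
proof -
  have "closedin (zariski ns) {p \<in> mproj ns. \<forall>x\<in>listset p. f x = 0}"
    using closedin_zero_set[OF assms(1), of UNIV] by simp
  moreover have "openin (zariski ns) (mproj ns)"
    using openin_topspace[of "zariski ns"] by simp
  ultimately have "quasi_projective ns {p \<in> mproj ns. \<forall>x\<in>listset p. f x = 0}"
    unfolding quasi_projective_def by blast
  then show ?thesis using assms(2) unfolding variety_def by blast
qed


section \<open>Chains of irreducible sets and independent forms\<close>

text \<open>
  The Hilbert function of \<open>C\<close> is at least \<open>N\<close> at the multidegree that is \<open>D\<close> in each factor.  Scalars are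
  rational, since irreducibility refers to forms with rational coefficients.
\<close>

definition indep_forms ::
  "nat list \<Rightarrow> 'k::field_char_0 mpoint set \<Rightarrow> nat \<Rightarrow> nat \<Rightarrow> bool" where
  "indep_forms ns C D N \<longleftrightarrow> (\<exists>g :: nat \<Rightarrow> 'k list list \<Rightarrow> 'k.
      (\<forall>i<N. form_fun ns (\<lambda>_. D) (g i)) \<and>
      (\<forall>c. vanishes_on (\<lambda>x. \<Sum>i<N. of_rat (c i) * g i x) C \<longrightarrow> (\<forall>i<N. c i = 0)))"

lemma vanishes_on_subset: "vanishes_on f S \<Longrightarrow> T \<subseteq> S \<Longrightarrow> vanishes_on f T"
  unfolding vanishes_on_def by blast

lemma indep_forms_superset:
  assumes "indep_forms ns C D N" "C \<subseteq> C'"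
  shows "indep_forms ns C' D N"
  using assms vanishes_on_subset[OF _ assms(2)] unfolding indep_forms_def by blast

lemma indep_forms_fewer:
  assumes "indep_forms ns C D N" "M \<le> N"
  shows "indep_forms ns (C :: 'k::field_char_0 mpoint set) D M"
proof -
  obtain g :: "nat \<Rightarrow> 'k list list \<Rightarrow> 'k" where
    g: "\<And>i. i < N \<Longrightarrow> form_fun ns (\<lambda>_. D) (g i)"
       "\<And>c i. vanishes_on (\<lambda>x. \<Sum>i<N. of_rat (c i) * g i x) C \<Longrightarrow> i < N \<Longrightarrow> c i = 0"
    using assms(1) unfolding indep_forms_def by blast
  have "c i = 0" if v: "vanishes_on (\<lambda>x. \<Sum>i<M. of_rat (c i) * g i x) C" and i: "i < M" for c i
  proof -
    have "(\<Sum>i<N. of_rat (if i < M then c i else 0) * g i x) = (\<Sum>i<M. of_rat (c i) * g i x)" for x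
      using assms(2) by (intro sum.mono_neutral_cong_right) auto
    then have "vanishes_on (\<lambda>x. \<Sum>i<N. of_rat (if i < M then c i else 0) * g i x) C"
      using v by simp
    from g(2)[OF this, of i] show ?thesis using i assms(2) by simp
  qed
  then show ?thesis unfolding indep_forms_def using g(1) assms(2)
    by (intro exI[of _ g]) auto
qed

lemma sum_lessThan_add:
  "(\<Sum>i<m + n. f i) = (\<Sum>i<m. f i) + (\<Sum>i<n. f (m + i))" for f :: "nat \<Rightarrow> 'a::comm_monoid_add"
  by (induction n) (auto simp: add_ac)

text \<open>
  Forms that are independent on \<open>C'\<close> stay independent on \<open>C\<close> when multiples of \<open>f\<close> are added to them:
  restriction to \<open>C'\<close> kills the multiples of \<open>f\<close>, and afterwards \<open>f\<close> can be cancelled on the irreducible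
  set \<open>C\<close>.
\<close>

lemma indep_forms_extend:
  assumes C': "indep_forms ns C' (e + D) M" and C: "indep_forms ns C D N"
    and irr: "irreducible_in (zariski_on ns Y) C" and "C' \<subseteq> C"
    and f: "form_fun ns (\<lambda>_. e) f" "vanishes_on f C'" "\<not> vanishes_on f C"
  shows "indep_forms ns (C :: 'k::field_char_0 mpoint set) (e + D) (M + N)"
proof -
  obtain g :: "nat \<Rightarrow> 'k list list \<Rightarrow> 'k" where
    g: "\<And>i. i < M \<Longrightarrow> form_fun ns (\<lambda>_. e + D) (g i)"
       "\<And>c i. vanishes_on (\<lambda>x. \<Sum>i<M. of_rat (c i) * g i x) C' \<Longrightarrow> i < M \<Longrightarrow> c i = 0"
    using C' unfolding indep_forms_def by blast
  obtain h :: "nat \<Rightarrow> 'k list list \<Rightarrow> 'k" where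
    h: "\<And>i. i < N \<Longrightarrow> form_fun ns (\<lambda>_. D) (h i)"
       "\<And>c i. vanishes_on (\<lambda>x. \<Sum>i<N. of_rat (c i) * h i x) C \<Longrightarrow> i < N \<Longrightarrow> c i = 0"
    using C unfolding indep_forms_def by blast
  define k where "k = (\<lambda>i x. if i < M then g i x else f x * h (i - M) x)"
  have k: "form_fun ns (\<lambda>_. e + D) (k i)" if "i < M + N" for i
  proof (cases "i < M")
    case True
    then show ?thesis using g(1) unfolding k_def by simp
  next
    case False
    then have "form_fun ns (\<lambda>_. e + D) (\<lambda>x. f x * h (i - M) x)"
      using that by (intro form_fun_mult f(1) h(1)) simp
    then show ?thesis using False unfolding k_def by simp
  qed
  have split: "(\<Sum>i<M + N. of_rat (c i) * k i x) =
      (\<Sum>i<M. of_rat (c i) * g i x) + f x * (\<Sum>i<N. of_rat (c (M + i)) * h i x)" for c x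
    by (simp add: sum_lessThan_add k_def sum_distrib_left mult_ac)
  have "c i = 0" if v: "vanishes_on (\<lambda>x. \<Sum>i<M + N. of_rat (c i) * k i x) C" and i: "i < M + N" for c i
  proof -
    have "vanishes_on (\<lambda>x. \<Sum>i<M. of_rat (c i) * g i x) C'"
      using vanishes_on_subset[OF v \<open>C' \<subseteq> C\<close>] f(2) unfolding vanishes_on_def split by simp
    then have c0: "c j = 0" if "j < M" for j using g(2) that by blast
    then have prod0: "vanishes_on (\<lambda>x. f x * (\<Sum>i<N. of_rat (c (M + i)) * h i x)) C"
      using v unfolding split by simp
    have "form_fun ns (\<lambda>_. D) (\<lambda>x. \<Sum>i<N. of_rat (c (M + i)) * h i x)"
      by (intro form_fun_sum form_fun_scale h(1)) simp
    then have "vanishes_on (\<lambda>x. \<Sum>i<N. of_rat (c (M + i)) * h i x) C"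
      using irreducible_in_prime[OF irr f(1) _ prod0] f(3) by blast
    then have c1: "c (M + j) = 0" if "j < N" for j using h(2)[of "\<lambda>j. c (M + j)"] that by blast
    show ?thesis
    proof (cases "i < M")
      case False
      then show ?thesis using c1[of "i - M"] i by simp
    qed (rule c0)
  qed
  then show ?thesis unfolding indep_forms_def using k by (intro exI[of _ k]) blast
qed

lemma indep_forms_one:
  assumes "C \<noteq> {}" "C \<subseteq> mproj ns"
  shows "indep_forms ns (C :: 'k::field_char_0 mpoint set) D 1"
proof -
  obtain p where p: "p \<in> C" using assms by blast
  then obtain x where x: "x \<in> listset p" "x \<in> homog_coords ns"
    using mproj_obtain_coords assms(2) by blast
  obtain h :: "'k list list \<Rightarrow> 'k" where "form_fun ns (\<lambda>_. D) h" "h x \<noteq> 0"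
    using form_fun_nonzero_at[OF x(2)] by blast
  then show ?thesis unfolding indep_forms_def
    using p x by (intro exI[of _ "\<lambda>_. h"]) (auto simp: vanishes_on_def)
qed

text \<open>
  By Pascal's rule the number of independent forms grows as for a polynomial ring in \<open>n + 1\<close> variables.
  The step from \<open>m\<close> to \<open>m + 1\<close> adds the forms from \<open>C n\<close> to the multiples of a form \<open>g\<close> that vanishes on
  \<open>C n\<close> but not on the next set of the chain.
\<close>

lemma indep_forms_chain:
  assumes "\<And>i. i \<le> n \<Longrightarrow> closedin (zariski_on ns Y) (C i) \<and> irreducible_in (zariski_on ns Y) (C i)"
    and "\<And>i. i < n \<Longrightarrow> C i \<subset> C (Suc i)"
  shows "\<exists>e>0. \<forall>m. indep_forms ns (C n :: 'k::field_char_0 mpoint set) (e * m) ((m + n) choose n)"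
  using assms
proof (induction n)
  case 0
  have "C 0 \<noteq> {}" "C 0 \<subseteq> mproj ns"
    using 0(1)[of 0] unfolding irreducible_in_def by (auto simp: topspace_subtopology)
  then have "indep_forms ns (C 0) m 1" for m by (rule indep_forms_one)
  then show ?case by (intro exI[of _ 1]) simp
next
  case (Suc n)
  obtain e where e: "e > 0" "\<And>m. indep_forms ns (C n) (e * m) ((m + n) choose n)"
    using Suc.IH Suc.prems by auto
  have irr: "irreducible_in (zariski_on ns Y) (C (Suc n))" using Suc.prems(1) by blast
  then have C: "C (Suc n) \<noteq> {}" "C (Suc n) \<subseteq> Y" "C (Suc n) \<subseteq> mproj ns"
    unfolding irreducible_in_def by (auto simp: topspace_subtopology)
  have CC: "C n \<subseteq> C (Suc n)" using Suc.prems(2)[of n] by blast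
  obtain p where p: "p \<in> C (Suc n)" "p \<notin> C n" using Suc.prems(2)[of n] by blast
  then obtain x where x: "x \<in> listset p" "x \<in> homog_coords ns"
    using mproj_obtain_coords C by blast
  obtain d f where f: "form_fun ns d f" "\<And>x. x \<in> listset p \<Longrightarrow> f x \<noteq> 0" "vanishes_on f (C n)"
  proof -
    have "closedin (zariski_on ns Y) (C n)" "p \<in> Y" "p \<in> mproj ns"
      using Suc.prems(1)[of n] p(1) C by auto
    then show ?thesis using closedin_separate p(2) that by blast
  qed
  (* The degree of g has to be a multiple of e, to which the induction hypothesis applies, and it has
     to exceed all degrees of f. *)
  define k where "k = Suc (\<Sum>i<length ns. d i)"
  have "d i \<le> e * k" if "i < length ns" for i
  proof -
    have "d i \<le> k" using member_le_sum[of i "{..<length ns}" d] that by (simp add: k_def)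
    also have "\<dots> \<le> e * k" using e(1) by simp
    finally show ?thesis .
  qed
  then obtain g where g: "form_fun ns (\<lambda>_. e * k) g" "g x \<noteq> 0" "\<And>y. f y = 0 \<Longrightarrow> g y = 0"
    using form_fun_raise_degree[OF f(1) x(2) f(2)[OF x(1)], of "\<lambda>_. e * k"] by blast
  have gC: "vanishes_on g (C n)" "\<not> vanishes_on g (C (Suc n))"
    using f(3) g p x unfolding vanishes_on_def by blast+
  have "indep_forms ns (C (Suc n)) (e * k * m) ((m + Suc n) choose Suc n)" for m
  proof (induction m)
    case 0
    show ?case using indep_forms_one C by simp
  next
    case (Suc m)
    have "Suc m \<le> k * Suc m" unfolding k_def by simp
    then have "((Suc m + n) choose n) \<le> ((k * Suc m + n) choose n)"
      by (intro binomial_right_mono) simp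
    then have "indep_forms ns (C n) (e * (k * Suc m)) ((Suc m + n) choose n)"
      using indep_forms_fewer[OF e(2)] by blast
    then have *: "indep_forms ns (C n) (e * k + e * k * m) ((Suc m + n) choose n)"
      by (simp add: algebra_simps)
    from indep_forms_extend[OF * Suc.IH irr CC g(1) gC] show ?case
      by (simp add: algebra_simps)
  qed
  moreover have "e * k > 0" using e(1) by (simp add: k_def)
  ultimately show ?case by blast
qed

lemma power_le_fact_binomial: "(m + 1) ^ n \<le> fact n * ((m + n) choose n)"
proof (induction n)
  case (Suc n)
  have "(m + 1) ^ Suc n \<le> Suc (m + n) * (fact n * ((m + n) choose n))"
    using mult_le_mono[OF _ Suc.IH, of "m + 1" "Suc (m + n)"] by simp
  also have "\<dots> = fact n * (Suc n * (Suc (m + n) choose Suc n))"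
    using Suc_times_binomial_eq[of "m + n" n] by (simp only: ac_simps)
  also have "\<dots> = fact (Suc n) * ((m + Suc n) choose Suc n)"
    by (simp add: algebra_simps del: binomial_Suc_Suc)
  finally show ?case .
qed simp

text \<open>
  A Hilbert function bounded by a polynomial of degree \<open>r\<close> leaves no room for the growth of degree
  \<open>r + 1\<close> that a longer chain would cause.
\<close>

lemma krull_dim_le:
  assumes bound: "\<And>D N. indep_forms ns Y D N \<Longrightarrow> N \<le> K * (D + 1) ^ r"
  shows "krull_dim (zariski_on ns (Y :: 'k::field_char_0 mpoint set)) \<le> enat r"
  unfolding krull_dim_def
proof (rule Sup_least, clarify)
  fix n and C :: "nat \<Rightarrow> 'k mpoint set"
  assume C: "\<forall>i\<le>n. closedin (zariski_on ns Y) (C i) \<and> irreducible_in (zariski_on ns Y) (C i)"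
    "\<forall>i<n. C i \<subset> C (Suc i)"
  show "enat n \<le> enat r"
  proof (rule ccontr)
    assume "\<not> enat n \<le> enat r"
    then have n: "Suc r \<le> n" by simp
    obtain e where e: "e > 0" "\<And>m. indep_forms ns (C (Suc r)) (e * m) ((m + Suc r) choose Suc r)"
      using indep_forms_chain[of "Suc r" ns Y C] C n by auto
    have "C (Suc r) \<subseteq> Y"
      using C(1) n unfolding irreducible_in_def by (auto simp: topspace_subtopology)
    then have le: "((m + Suc r) choose Suc r) \<le> K * (e * m + 1) ^ r" for m
      using bound[OF indep_forms_superset[OF e(2)]] by blast
    (* At this m the two bounds on the number of independent forms contradict each other. *)
    define m where "m = fact (Suc r) * K * (e + 1) ^ r"
    have "(m + 1) ^ r * (m + 1) \<le> fact (Suc r) * ((m + Suc r) choose Suc r)"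
      using power_le_fact_binomial[of m "Suc r"] by (simp add: mult.commute del: binomial_Suc_Suc fact_Suc)
    also have "\<dots> \<le> fact (Suc r) * (K * (e * m + 1) ^ r)"
      by (intro mult_le_mono le) simp
    also have "\<dots> \<le> fact (Suc r) * (K * ((e + 1) * (m + 1)) ^ r)"
      by (intro mult_le_mono power_mono) auto
    also have "\<dots> = (m + 1) ^ r * m"
      by (simp only: m_def power_mult_distrib ac_simps)
    finally show False by simp
  qed
qed

lemma sum_fun_apply: "(\<Sum>i\<in>I. f i) x = (\<Sum>i\<in>I. f i x)" for f :: "'i \<Rightarrow> 'a \<Rightarrow> 'b::comm_monoid_add"
  by (induction I rule: infinite_finite_induct) auto

text \<open>
  The bound on the size of an independent set, applied to the functions with values in \<open>'k\<close> as a vector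
  space over the rationals.
\<close>

lemma rational_linear_relation:
  fixes h :: "nat \<Rightarrow> 'a \<Rightarrow> 'k::field_char_0" and b :: "'b \<Rightarrow> 'a \<Rightarrow> 'k"
  assumes B: "finite B" "card B < N"
    and h: "\<And>i. i < N \<Longrightarrow> \<exists>c. \<forall>w. h i w = (\<Sum>j\<in>B. of_rat (c j) * b j w)"
  shows "\<exists>c. (\<exists>i<N. c i \<noteq> 0) \<and> (\<forall>w. (\<Sum>i<N. of_rat (c i) * h i w) = 0)"
proof -
  interpret Q: vector_space "\<lambda>(q::rat) (f :: 'a \<Rightarrow> 'k) w. of_rat q * f w"
    by unfold_locales (auto simp: fun_eq_iff of_rat_add of_rat_mult algebra_simps)
  show ?thesis
  proof (cases "inj_on h {..<N}")
    case False
    then obtain i j where ij: "i < N" "j < N" "i \<noteq> j" "h i = h j" by (auto simp: inj_on_def)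
    define c :: "nat \<Rightarrow> rat" where "c l = (if l = i then 1 else if l = j then - 1 else 0)" for l
    have "(\<Sum>l<N. of_rat (c l) * h l w) = 0" for w
    proof -
      have "(\<Sum>l<N. of_rat (c l) * h l w) = (\<Sum>l\<in>{i, j}. of_rat (c l) * h l w)"
        using ij by (intro sum.mono_neutral_right) (auto simp: c_def)
      then show ?thesis using ij by (simp add: c_def)
    qed
    then show ?thesis using ij by (intro exI[of _ c]) (auto simp: c_def)
  next
    case True
    have "h i \<in> Q.span (b ` B)" if i: "i < N" for i
    proof -
      obtain c where c: "\<And>w. h i w = (\<Sum>j\<in>B. of_rat (c j) * b j w)" using h[OF i] by blast
      have "h i = (\<Sum>j\<in>B. (\<lambda>w. of_rat (c j) * b j w))"
        by (simp add: fun_eq_iff c sum_fun_apply)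
      also have "\<dots> \<in> Q.span (b ` B)"
        by (intro Q.span_sum Q.span_scale Q.span_base) auto
      finally show ?thesis .
    qed
    then have span: "h ` {..<N} \<subseteq> Q.span (b ` B)" by blast
    have "card (b ` B) < card (h ` {..<N})"
      using True card_image_le[OF B(1), of b] B(2) by (simp add: card_image)
    then have "Q.dependent (h ` {..<N})"
      using Q.independent_span_bound[OF _ _ span] B(1) by force
    then obtain u where u: "\<exists>v\<in>h ` {..<N}. u v \<noteq> 0"
      "(\<Sum>v\<in>h ` {..<N}. (\<lambda>w. of_rat (u v) * v w)) = 0"
      using Q.dependent_finite[of "h ` {..<N}"] by auto
    have "(\<Sum>i<N. of_rat (u (h i)) * h i w) = 0" for w
    proof -
      have "(\<Sum>v\<in>h ` {..<N}. of_rat (u v) * v w) = (0 :: 'k)"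
        using fun_cong[OF u(2), of w] by (simp add: sum_fun_apply)
      then show ?thesis by (simp add: sum.reindex[OF True])
    qed
    then show ?thesis using u(1) by (intro exI[of _ "\<lambda>i. u (h i)"]) auto
  qed
qed


section \<open>Gradients\<close>

abbreviation variables :: "nat list \<Rightarrow> (nat \<times> nat) set" where
  "variables ns \<equiv> (SIGMA i:{..<length ns}. {..ns ! i})"

lemma multihom_keys: "multihom ns d F \<Longrightarrow> m \<in> Poly_Mapping.keys F \<Longrightarrow> Poly_Mapping.keys m \<subseteq> variables ns"
  unfolding multihom_def by auto

lemma gradient_outside_variables:
  assumes "multihom ns d F" "v \<notin> variables ns"
  shows "gradient F x v = 0"
proof -
  have "Poly_Mapping.lookup m v = 0" if "m \<in> Poly_Mapping.keys F" for m
    using multihom_keys[OF assms(1) that] assms(2) by (auto simp: in_keys_iff)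
  then have "partial_deriv v F = 0"
    unfolding partial_deriv_def by (intro sum.neutral) simp
  then show ?thesis by (simp add: gradient_def)
qed

lemma gradient_monomials:
  assumes "multihom ns d F" "v \<in> variables ns"
  shows "gradient F x v = (\<Sum>m\<in>Poly_Mapping.keys F. of_rat (Poly_Mapping.lookup F m) *
    (of_nat (Poly_Mapping.lookup m v) * (x ! fst v ! snd v) ^ (Poly_Mapping.lookup m v - 1) *
      (\<Prod>u\<in>variables ns - {v}. (x ! fst u ! snd u) ^ Poly_Mapping.lookup m u)))"
proof -
  have "monomial_value (m - Poly_Mapping.single v 1) x =
      (x ! fst v ! snd v) ^ (Poly_Mapping.lookup m v - 1) *
      (\<Prod>u\<in>variables ns - {v}. (x ! fst u ! snd u) ^ Poly_Mapping.lookup m u)"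
    if m: "m \<in> Poly_Mapping.keys F" for m
  proof -
    have "Poly_Mapping.keys (m - Poly_Mapping.single v 1) \<subseteq> Poly_Mapping.keys m"
      by (auto simp: in_keys_iff lookup_minus)
    then have "Poly_Mapping.keys (m - Poly_Mapping.single v 1) \<subseteq> variables ns"
      using multihom_keys[OF assms(1) m] by (rule subset_trans)
    then have "monomial_value (m - Poly_Mapping.single v 1) x =
        (\<Prod>u\<in>variables ns. (x ! fst u ! snd u) ^ Poly_Mapping.lookup (m - Poly_Mapping.single v 1) u)"
      by (intro monomial_value_superset) auto
    also have "\<dots> = (x ! fst v ! snd v) ^ (Poly_Mapping.lookup (m - Poly_Mapping.single v 1) v) *
        (\<Prod>u\<in>variables ns - {v}. (x ! fst u ! snd u) ^ Poly_Mapping.lookup (m - Poly_Mapping.single v 1) u)"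
      using assms(2) by (intro prod.remove) auto
    also have "(\<Prod>u\<in>variables ns - {v}. (x ! fst u ! snd u) ^ Poly_Mapping.lookup (m - Poly_Mapping.single v 1) u)
        = (\<Prod>u\<in>variables ns - {v}. (x ! fst u ! snd u) ^ Poly_Mapping.lookup m u)"
      by (intro prod.cong) (auto simp: lookup_minus lookup_single when_def)
    finally show ?thesis by (simp add: lookup_minus)
  qed
  then show ?thesis
    unfolding gradient_def partial_deriv_def peval_sum peval_single
    by (intro sum.cong) (simp_all add: of_rat_mult mult_ac)
qed

lemma pderiv_sum: "pderiv (sum f A) = (\<Sum>x\<in>A. pderiv (f x))"
  using higher_pderiv_sum[of 1 f A] by simp

text \<open>
  The chain rule along the line through \<open>x 0\<close> in the direction \<open>w\<close>, with the formal derivative of the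
  polynomial that the form induces on the line.
\<close>

lemma gradient_along_line:
  assumes F: "multihom ns d F"
    and x: "\<And>t i j. i < length ns \<Longrightarrow> j \<le> ns ! i \<Longrightarrow> x t ! i ! j = x 0 ! i ! j + t * w (i, j)"
    and R: "\<And>t :: 'k::field_char_0. peval F (x t) = poly R t"
  shows "(\<Sum>i<length ns. \<Sum>j\<le>ns ! i. w (i, j) * gradient F (x 0) (i, j)) = poly (pderiv R) 0"
proof -
  define X where "X v = x 0 ! fst v ! snd v" for v
  define P where "P m = (\<Prod>v\<in>variables ns. [:X v, w v:] ^ Poly_Mapping.lookup m v)" for m
  define Q where "Q = (\<Sum>m\<in>Poly_Mapping.keys F. smult (of_rat (Poly_Mapping.lookup F m)) (P m))"
  have fin: "finite (variables ns)" by auto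
  have "poly Q t = poly R t" for t
  proof -
    have "poly (P m) t = monomial_value m (x t)" if "m \<in> Poly_Mapping.keys F" for m
    proof -
      have "monomial_value m (x t) = (\<Prod>v\<in>variables ns. (x t ! fst v ! snd v) ^ Poly_Mapping.lookup m v)"
        by (rule monomial_value_superset[OF fin multihom_keys[OF F that]])
      also have "\<dots> = (\<Prod>v\<in>variables ns. (X v + t * w v) ^ Poly_Mapping.lookup m v)"
        by (intro prod.cong) (auto simp: X_def x[of _ _ t])
      finally show ?thesis by (simp add: P_def poly_prod)
    qed
    then show ?thesis by (simp add: Q_def poly_sum peval_monomials flip: R)
  qed
  then have "R = Q" using poly_eq_poly_eq_iff[of Q R] by (simp add: fun_eq_iff)
  have "poly (pderiv (P m)) 0 = (\<Sum>v\<in>variables ns.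
      (\<Prod>u\<in>variables ns - {v}. X u ^ Poly_Mapping.lookup m u) *
      (of_nat (Poly_Mapping.lookup m v) * X v ^ (Poly_Mapping.lookup m v - 1) * w v))" for m
    by (simp add: P_def pderiv_prod poly_sum poly_prod pderiv_power pderiv_pCons mult_ac)
  then have "poly (pderiv R) 0 = (\<Sum>m\<in>Poly_Mapping.keys F. \<Sum>v\<in>variables ns.
      of_rat (Poly_Mapping.lookup F m) * ((\<Prod>u\<in>variables ns - {v}. X u ^ Poly_Mapping.lookup m u) *
      (of_nat (Poly_Mapping.lookup m v) * X v ^ (Poly_Mapping.lookup m v - 1) * w v)))"
    unfolding \<open>R = Q\<close> Q_def by (simp add: pderiv_sum poly_sum pderiv_smult sum_distrib_left)
  also have "\<dots> = (\<Sum>v\<in>variables ns. \<Sum>m\<in>Poly_Mapping.keys F.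
      of_rat (Poly_Mapping.lookup F m) * ((\<Prod>u\<in>variables ns - {v}. X u ^ Poly_Mapping.lookup m u) *
      (of_nat (Poly_Mapping.lookup m v) * X v ^ (Poly_Mapping.lookup m v - 1) * w v)))"
    by (rule sum.swap)
  also have "\<dots> = (\<Sum>v\<in>variables ns. w v * gradient F (x 0) v)"
  proof (rule sum.cong[OF refl])
    fix v assume v: "v \<in> variables ns"
    show "(\<Sum>m\<in>Poly_Mapping.keys F. of_rat (Poly_Mapping.lookup F m) *
        ((\<Prod>u\<in>variables ns - {v}. X u ^ Poly_Mapping.lookup m u) *
        (of_nat (Poly_Mapping.lookup m v) * X v ^ (Poly_Mapping.lookup m v - 1) * w v))) =
      w v * gradient F (x 0) v"
      unfolding gradient_monomials[OF F v] X_def sum_distrib_left by (simp add: mult_ac)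
  qed
  also have "\<dots> = (\<Sum>i<length ns. \<Sum>j\<le>ns ! i. w (i, j) * gradient F (x 0) (i, j))"
    by (simp add: sum.Sigma)
  finally show ?thesis by simp
qed

section \<open>Elimination of the root of a binary quadratic form\<close>

text \<open>
  For a root \<open>y\<close> of $A y^2 - B y + C$ the product $A^k y^k$ is $a + b y$, where the pair \<open>(a, b)\<close> is
  the value of \<open>quad_reduce\<close> at \<open>k\<close>.  The power of \<open>A\<close> avoids denominators.
\<close>

fun quad_reduce :: "'k::comm_ring_1 \<Rightarrow> 'k \<Rightarrow> 'k \<Rightarrow> nat \<Rightarrow> 'k \<times> 'k" where
  "quad_reduce A B C 0 = (1, 0)"
| "quad_reduce A B C (Suc k) = (case quad_reduce A B C k of (a, b) \<Rightarrow> (- (C * b), A * a + B * b))"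

lemma quad_reduce:
  assumes "A * y1^2 - B * y1 * y2 + C * y2^2 = (0 :: 'k::comm_ring_1)"
  shows "A ^ k * y1 ^ k * y2 =
    (fst (quad_reduce A B C k) * y2 + snd (quad_reduce A B C k) * y1) * y2 ^ k"
proof (induction k)
  case (Suc k)
  obtain a b where ab: "quad_reduce A B C k = (a, b)" by fastforce
  have "A ^ Suc k * y1 ^ Suc k * y2 = A * y1 * (A ^ k * y1 ^ k * y2)" by (simp add: mult_ac)
  also have "\<dots> = A * y1 * ((a * y2 + b * y1) * y2 ^ k)" using Suc ab by simp
  also have "\<dots> = (A * a * y1 * y2 + b * (A * y1^2)) * y2 ^ k"
    by (simp add: algebra_simps power2_eq_square)
  also have "A * y1^2 = B * y1 * y2 - C * y2^2" using assms by (simp add: algebra_simps)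
  finally show ?case by (simp add: ab algebra_simps power2_eq_square)
qed simp

lemma form_fun_quad_reduce:
  assumes "form_fun ks d A" "form_fun ks d B" "form_fun ks d C"
  shows "form_fun ks (\<lambda>i. k * d i) (\<lambda>z. fst (quad_reduce (A z) (B z) (C z) k)) \<and>
         form_fun ks (\<lambda>i. k * d i) (\<lambda>z. snd (quad_reduce (A z) (B z) (C z) k))"
proof (induction k)
  case 0
  show ?case using form_fun_const[of ks 1, where 'a = 'a] form_fun_0 by simp
next
  case (Suc k)
  let ?a = "\<lambda>z. fst (quad_reduce (A z) (B z) (C z) k)"
  let ?b = "\<lambda>z. snd (quad_reduce (A z) (B z) (C z) k)"
  have "form_fun ks (\<lambda>i. d i + k * d i) (\<lambda>z. 0 - C z * ?b z)"
    "form_fun ks (\<lambda>i. d i + k * d i) (\<lambda>z. A z * ?a z + B z * ?b z)"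
    using Suc assms by (intro form_fun_diff form_fun_0 form_fun_mult form_fun_add; simp)+
  then show ?case by (simp add: case_prod_beta)
qed

text \<open>
  The remainder of a form \<open>f\<close> in \<open>y\<close> and \<open>z\<close> modulo a binary quadratic form in \<open>y\<close>.  The coefficients of the
  quadratic form and of the remainder are forms in \<open>z\<close>.
\<close>

lemma form_fun_quad_remainder:
  assumes f: "form_fun (1 # ks) e f"
    and ABC: "form_fun ks d A" "form_fun ks d B" "form_fun ks d (C :: 'k::field_char_0 list list \<Rightarrow> 'k)"
  shows "\<exists>c a b. form_fun ks c a \<and> form_fun ks c b \<and>
    (\<forall>z y1 y2. A z * y1^2 - B z * y1 * y2 + C z * y2^2 = 0 \<longrightarrow>
      A z ^ e 0 * f ([y1, y2] # z) * y2 = (a z * y2 + b z * y1) * y2 ^ e 0)"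
proof -
  obtain F where F: "multihom (1 # ks) e F" "\<And>x. f x = peval F x"
    using f unfolding form_fun_def by auto
  define R where "R m z = (\<Prod>i<length ks. \<Prod>j\<le>ks ! i. (z ! i ! j) ^ Poly_Mapping.lookup m (Suc i, j))"
    for m and z :: "'k list list"
  define r where "r m z = quad_reduce (A z) (B z) (C z) (Poly_Mapping.lookup m (0, 0))"
    for m :: "nat \<times> nat \<Rightarrow>\<^sub>0 nat" and z
  define S where "S g z = (\<Sum>m\<in>Poly_Mapping.keys F. of_rat (Poly_Mapping.lookup F m) *
      (g (r m z) * A z ^ Poly_Mapping.lookup m (0, 1) * R m z))"
    for g :: "'k \<times> 'k \<Rightarrow> 'k" and z
  have deg0: "Poly_Mapping.lookup m (0, 0) + Poly_Mapping.lookup m (0, 1) = e 0"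
    if "m \<in> Poly_Mapping.keys F" for m
    using monomial_degree[OF F(1) that, of 0] by simp
  have R: "form_fun ks (\<lambda>i. e (Suc i)) (R m)" if m: "m \<in> Poly_Mapping.keys F" for m
  proof -
    have "form_fun ks (\<lambda>k. \<Sum>i<length ks. \<Sum>j\<le>ks ! i.
        Poly_Mapping.lookup m (Suc i, j) * (if k = i then 1 else 0)) (R m)"
      unfolding R_def by (intro form_fun_prod form_fun_power form_fun_var) auto
    moreover have "(\<Sum>i<length ks. \<Sum>j\<le>ks ! i. Poly_Mapping.lookup m (Suc i, j) * (if k = i then 1 else 0)) =
        (\<Sum>i<length ks. if k = i then e (Suc i) else 0)" for k
      using monomial_degree[OF F(1) m, of "Suc _"]
      by (intro sum.cong refl) (simp flip: sum_distrib_right)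
    ultimately show ?thesis
      by (elim form_fun_cong) simp
  qed
  have S: "form_fun ks (\<lambda>i. e 0 * d i + e (Suc i)) (S g)" if g: "g = fst \<or> g = snd" for g
    unfolding S_def
  proof (intro form_fun_sum form_fun_scale)
    fix m assume m: "m \<in> Poly_Mapping.keys F"
    have "form_fun ks (\<lambda>i. Poly_Mapping.lookup m (0, 0) * d i + Poly_Mapping.lookup m (0, 1) * d i + e (Suc i))
        (\<lambda>z. g (r m z) * A z ^ Poly_Mapping.lookup m (0, 1) * R m z)"
      using form_fun_quad_reduce[OF ABC] g unfolding r_def
      by (intro form_fun_mult form_fun_power ABC R m) auto
    then show "form_fun ks (\<lambda>i. e 0 * d i + e (Suc i))
        (\<lambda>z. g (r m z) * A z ^ Poly_Mapping.lookup m (0, 1) * R m z)"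
      by (rule form_fun_cong) (simp flip: deg0[OF m] add: algebra_simps)
  qed
  have red: "A z ^ e 0 * f ([y1, y2] # z) * y2 = (S fst z * y2 + S snd z * y1) * y2 ^ e 0"
    if q: "A z * y1^2 - B z * y1 * y2 + C z * y2^2 = 0" for z y1 y2
  proof -
    have mon: "A z ^ e 0 * monomial_value m ([y1, y2] # z) * y2 =
        (fst (r m z) * y2 + snd (r m z) * y1) * A z ^ Poly_Mapping.lookup m (0, 1) * R m z * y2 ^ e 0"
      if m: "m \<in> Poly_Mapping.keys F" for m
    proof -
      have "monomial_value m ([y1, y2] # z) =
          y1 ^ Poly_Mapping.lookup m (0, 0) * y2 ^ Poly_Mapping.lookup m (0, 1) * R m z"
        unfolding monomial_value_multihom[OF F(1) m] R_def
        by (simp add: prod.lessThan_Suc_shift del: prod.lessThan_Suc)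
      then have "A z ^ e 0 * monomial_value m ([y1, y2] # z) * y2 =
          (A z ^ Poly_Mapping.lookup m (0, 0) * y1 ^ Poly_Mapping.lookup m (0, 0) * y2) *
          (A z ^ Poly_Mapping.lookup m (0, 1) * y2 ^ Poly_Mapping.lookup m (0, 1) * R m z)"
        by (simp flip: deg0[OF m] add: power_add mult_ac)
      also have "\<dots> = (fst (r m z) * y2 + snd (r m z) * y1) * y2 ^ Poly_Mapping.lookup m (0, 0) *
          (A z ^ Poly_Mapping.lookup m (0, 1) * y2 ^ Poly_Mapping.lookup m (0, 1) * R m z)"
        unfolding r_def quad_reduce[OF q] ..
      also have "\<dots> = (fst (r m z) * y2 + snd (r m z) * y1) * A z ^ Poly_Mapping.lookup m (0, 1) * R m z * y2 ^ e 0"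
        by (simp flip: deg0[OF m] add: power_add mult_ac)
      finally show ?thesis .
    qed
    have "A z ^ e 0 * f ([y1, y2] # z) * y2 = (\<Sum>m\<in>Poly_Mapping.keys F.
        of_rat (Poly_Mapping.lookup F m) * (A z ^ e 0 * monomial_value m ([y1, y2] # z) * y2))"
      by (simp add: F(2) peval_monomials sum_distrib_left sum_distrib_right mult_ac)
    also have "\<dots> = (\<Sum>m\<in>Poly_Mapping.keys F.
        of_rat (Poly_Mapping.lookup F m) * ((fst (r m z) * y2 + snd (r m z) * y1) *
          A z ^ Poly_Mapping.lookup m (0, 1) * R m z * y2 ^ e 0))"
      by (intro sum.cong refl) (simp only: mon)
    also have "\<dots> = (S fst z * y2 + S snd z * y1) * y2 ^ e 0"
      unfolding S_def by (simp add: sum_distrib_left sum_distrib_right algebra_simps sum.distrib)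
    finally show ?thesis .
  qed
  show ?thesis
    by (intro exI[of _ "S fst"] exI[of _ "S snd"] exI conjI allI impI)
      (use S red in auto)
qed

lemma quadratic_has_root:
  assumes "A \<noteq> (0 :: 'k::alg_closed_field)"
  obtains y where "A * y^2 - B * y + C = 0"
proof -
  have "degree [:C, - B, A:] > 0" using assms by simp
  then obtain y where "poly [:C, - B, A:] y = 0" using alg_closed_imp_poly_has_root by blast
  then show ?thesis by (intro that[of y]) (simp add: algebra_simps power2_eq_square)
qed

text \<open>
  The form \<open>N\<close> is the product of \<open>A\<close> and the norm \<open>A a^2 + B a b + C b^2\<close> of the remainder \<open>a + b y\<close> of \<open>f\<close>.
  Up to powers of \<open>A\<close> the norm is the product of the values of \<open>f\<close> at the two roots.  If it vanishes and
  \<open>b\<close> does not, then \<open>- a / b\<close> is a common root, so that only the case \<open>a = b = 0\<close> uses the existence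
  of roots.  The factor \<open>A\<close> takes care of a root at infinity.
\<close>

lemma eliminate_quadratic_root_leading:
  fixes f :: "'k::{alg_closed_field, field_char_0} list list \<Rightarrow> 'k"
  assumes f: "form_fun (1 # ks) e f"
    and ABC: "form_fun ks d A" "form_fun ks d B" "form_fun ks d C"
    and A: "A z0 \<noteq> 0"
    and nz: "\<And>y1 y2. y1 \<noteq> 0 \<or> y2 \<noteq> 0 \<Longrightarrow> A z0 * y1^2 - B z0 * y1 * y2 + C z0 * y2^2 = 0 \<Longrightarrow>
        f ([y1, y2] # z0) \<noteq> 0"
  shows "\<exists>c N. form_fun ks c N \<and> N z0 \<noteq> 0 \<and>
    (\<forall>z y1 y2. (y1 \<noteq> 0 \<or> y2 \<noteq> 0) \<and> A z * y1^2 - B z * y1 * y2 + C z * y2^2 = 0 \<and>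
        f ([y1, y2] # z) = 0 \<longrightarrow> N z = 0)"
proof -
  obtain c a b where ab: "form_fun ks c a" "form_fun ks c b"
    and red: "\<And>z y1 y2. A z * y1^2 - B z * y1 * y2 + C z * y2^2 = 0 \<Longrightarrow>
      A z ^ e 0 * f ([y1, y2] # z) * y2 = (a z * y2 + b z * y1) * y2 ^ e 0"
    using form_fun_quad_remainder[OF f ABC] by blast
  define N where "N z = A z * (A z * (a z * a z) + B z * (a z * b z) + C z * (b z * b z))" for z
  have "form_fun ks (\<lambda>i. d i + (d i + (c i + c i))) N"
    unfolding N_def by (intro form_fun_mult form_fun_add ABC ab)
  moreover have "N z0 \<noteq> 0"
  proof
    assume "N z0 = 0"
    then have n0: "A z0 * (a z0 * a z0) + B z0 * (a z0 * b z0) + C z0 * (b z0 * b z0) = 0"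
      using A by (simp add: N_def)
    show False
    proof (cases "b z0 = 0")
      case True
      then have "a z0 = 0" using n0 A by simp
      obtain y where y: "A z0 * y^2 - B z0 * y + C z0 = 0" using quadratic_has_root[OF A] .
      then show False using red[of z0 y 1] nz[of y 1] \<open>a z0 = 0\<close> True A by simp
    next
      case False
      have "A z0 * (- a z0)^2 - B z0 * (- a z0) * b z0 + C z0 * (b z0)^2 = 0"
        using n0 by (simp add: power2_eq_square algebra_simps)
      then show False using red[of z0 "- a z0" "b z0"] nz[of "- a z0" "b z0"] False A by simp
    qed
  qed
  moreover have "N z = 0" if y: "y1 \<noteq> 0 \<or> y2 \<noteq> 0" "A z * y1^2 - B z * y1 * y2 + C z * y2^2 = 0"
    "f ([y1, y2] # z) = 0" for z y1 y2
  proof (cases "A z = 0")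
    case False
    then have y2: "y2 \<noteq> 0" using y by auto
    then have ay: "a z * y2 = - (b z * y1)"
      using red[OF y(2)] y(3) by (simp add: eq_neg_iff_add_eq_0)
    have "(A z * (a z * a z) + B z * (a z * b z) + C z * (b z * b z)) * y2^2 =
        A z * ((a z * y2) * (a z * y2)) + B z * ((a z * y2) * (b z * y2)) + C z * (b z * b z) * y2^2"
      by (simp add: power2_eq_square algebra_simps)
    also have "\<dots> = b z * b z * (A z * y1^2 - B z * y1 * y2 + C z * y2^2)"
      unfolding ay by (simp add: power2_eq_square algebra_simps)
    finally show ?thesis using y(2) y2 by (simp add: N_def)
  qed (simp add: N_def)
  ultimately show ?thesis by blast
qed

text \<open>
  Where the quadratic form does not vanish identically, a rational change of the coordinates \<open>y\<close> makes
  its leading coefficient nonzero.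
\<close>

lemma eliminate_quadratic_root:
  fixes f :: "'k::{alg_closed_field, field_char_0} list list \<Rightarrow> 'k"
  assumes f: "form_fun (1 # ks) e f"
    and ABC: "form_fun ks d A" "form_fun ks d B" "form_fun ks d C"
    and z0: "length z0 = length ks" "A z0 \<noteq> 0 \<or> B z0 \<noteq> 0 \<or> C z0 \<noteq> 0"
    and nz: "\<And>y1 y2. y1 \<noteq> 0 \<or> y2 \<noteq> 0 \<Longrightarrow> A z0 * y1^2 - B z0 * y1 * y2 + C z0 * y2^2 = 0 \<Longrightarrow>
        f ([y1, y2] # z0) \<noteq> 0"
  obtains c N where "form_fun ks c N" "N z0 \<noteq> 0"
    "\<And>z y1 y2. length z = length ks \<Longrightarrow> y1 \<noteq> 0 \<or> y2 \<noteq> 0 \<Longrightarrow>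
      A z * y1^2 - B z * y1 * y2 + C z * y2^2 = 0 \<Longrightarrow> f ([y1, y2] # z) = 0 \<Longrightarrow> N z = 0"
proof -
  (* The leading coefficient after the substitution of y2 + q y1 for y2; one of q = 0, 1, -1 will do. *)
  have "\<exists>q :: rat. A z0 - of_rat q * B z0 + of_rat (q * q) * C z0 \<noteq> 0"
  proof (rule ccontr)
    assume "\<not> ?thesis"
    then have "A z0 - of_rat q * B z0 + of_rat (q * q) * C z0 = 0" for q by blast
    from this[of 0] this[of 1] this[of "-1"] have "A z0 = 0" "C z0 = B z0" "B z0 + C z0 = 0"
      by (simp_all add: of_rat_minus)
    then show False using z0(2) by simp
  qed
  then obtain q :: rat where q: "A z0 - of_rat q * B z0 + of_rat (q * q) * C z0 \<noteq> 0" by blast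
  define r :: 'k where "r = of_rat q"
  define s where "s w = [w ! 0 ! 0, w ! 0 ! 1 + r * w ! 0 ! 0] # map (\<lambda>i. w ! Suc i) [0..<length ks]"
    for w :: "'k list list"
  have s: "s ([y1, y2] # z) = [y1, y2 + r * y1] # z" if "length z = length ks" for y1 y2 z
  proof -
    have "map (\<lambda>i. z ! i) [0..<length ks] = z" using map_nth[of z] that by simp
    then show ?thesis by (simp add: s_def)
  qed
  define A' where "A' z = A z - of_rat q * B z + of_rat (q * q) * C z" for z
  define B' where "B' z = B z - of_rat (2 * q) * C z" for z
  have eq: "A' z * y1^2 - B' z * y1 * y2 + C z * y2^2 =
      A z * y1^2 - B z * y1 * (y2 + r * y1) + C z * (y2 + r * y1)^2" for z y1 y2
    by (simp add: A'_def B'_def r_def of_rat_mult power2_eq_square algebra_simps)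
  have f': "form_fun (1 # ks) (\<lambda>k. \<Sum>i<length (1 # ks). e i * (if k = i then 1 else 0)) (\<lambda>w. f (s w))"
  proof (rule form_fun_compose[OF f])
    fix i j assume ij: "i < length (1 # ks)" "j \<le> (1 # ks) ! i"
    show "form_fun (1 # ks) (\<lambda>k. if k = i then 1 else 0) (\<lambda>w. s w ! i ! j)"
    proof (cases i)
      case 0
      have v: "form_fun (1 # ks) (\<lambda>k. if k = 0 then 1 else 0) (\<lambda>w. w ! 0 ! 0)"
        "form_fun (1 # ks) (\<lambda>k. if k = 0 then 1 else 0) (\<lambda>w. w ! 0 ! 1)"
        by (rule form_fun_var; simp)+
      have "j = 0 \<or> j = 1" using ij 0 by auto
      then show ?thesis
        using v(1) form_fun_add[OF v(2) form_fun_scale[OF v(1), of q]] 0 by (auto simp: s_def r_def)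
    next
      case (Suc l)
      then show ?thesis using form_fun_var[OF ij] ij by (simp add: s_def)
    qed
  qed
  have "\<exists>c N. form_fun ks c N \<and> N z0 \<noteq> 0 \<and>
    (\<forall>z y1 y2. (y1 \<noteq> 0 \<or> y2 \<noteq> 0) \<and> A' z * y1^2 - B' z * y1 * y2 + C z * y2^2 = 0 \<and>
        f (s ([y1, y2] # z)) = 0 \<longrightarrow> N z = 0)"
  proof (rule eliminate_quadratic_root_leading[OF f'])
    show "form_fun ks d A'" "form_fun ks d B'" "form_fun ks d C"
      unfolding A'_def B'_def by (intro form_fun_add form_fun_diff form_fun_scale ABC)+
    show "A' z0 \<noteq> 0" using q by (simp add: A'_def)
    fix y1 y2 :: 'k assume "y1 \<noteq> 0 \<or> y2 \<noteq> 0" "A' z0 * y1^2 - B' z0 * y1 * y2 + C z0 * y2^2 = 0"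
    then show "f (s ([y1, y2] # z0)) \<noteq> 0"
      using nz[of y1 "y2 + r * y1"] unfolding eq s[OF z0(1)] by auto
  qed
  then obtain c N where N: "form_fun ks c N" "N z0 \<noteq> 0"
    "\<And>z y1 y2. y1 \<noteq> 0 \<or> y2 \<noteq> 0 \<Longrightarrow> A' z * y1^2 - B' z * y1 * y2 + C z * y2^2 = 0 \<Longrightarrow>
        f (s ([y1, y2] # z)) = 0 \<Longrightarrow> N z = 0" by blast
  show ?thesis
  proof (rule that[OF N(1,2)])
    fix z y1 y2
    assume "length z = length ks" "y1 \<noteq> 0 \<or> y2 \<noteq> 0"
      "A z * y1^2 - B z * y1 * y2 + C z * y2^2 = 0" "f ([y1, y2] # z) = 0"
    then show "N z = 0"
      using N(3)[of y1 "y2 - r * y1" z] eq[of z y1 "y2 - r * y1"] s[of z y1 "y2 - r * y1"] by auto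
  qed
qed


section \<open>Morphisms given by one system of forms\<close>

lemma morphism_of_forms:
  fixes s :: "'k::field_char_0 list list \<Rightarrow> 'k list list"
  assumes X: "X \<subseteq> mproj ns"
    and s: "\<And>i j. i < length ms \<Longrightarrow> j \<le> ms ! i \<Longrightarrow> form_fun ns (d i) (\<lambda>x. s x ! i ! j)"
    and f: "\<And>p x. p \<in> X \<Longrightarrow> x \<in> listset p \<Longrightarrow>
      s x \<in> homog_coords ms \<and> f p = map proj (s x) \<and> f p \<in> Y"
  shows "morphism ns X ms Y f"
proof -
  have "\<forall>i j. \<exists>F. i < length ms \<and> j \<le> ms ! i \<longrightarrow> multihom ns (d i) F \<and> (\<forall>x. s x ! i ! j = peval F x)"
    using s unfolding form_fun_def by blast
  then obtain F where F: "\<And>i j. i < length ms \<Longrightarrow> j \<le> ms ! i \<Longrightarrow> multihom ns (d i) (F i j)"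
    "\<And>i j x. i < length ms \<Longrightarrow> j \<le> ms ! i \<Longrightarrow> peval (F i j) x = s x ! i ! j" by metis
  define Fs where "Fs = map (\<lambda>i. map (F i) [0..<Suc (ms ! i)]) [0..<length ms]"
  have "form_system ns ms Fs"
    unfolding form_system_def list_all2_conv_all_nth
  proof (intro conjI allI impI)
    fix i assume "i < length Fs"
    then have i: "i < length ms" "Fs ! i = map (F i) [0..<Suc (ms ! i)]" by (auto simp: Fs_def)
    then show "length (Fs ! i) = Suc (ms ! i)" by simp
    show "\<exists>d. \<forall>F\<in>set (Fs ! i). multihom ns d F"
      using i F(1) by (intro exI[of _ "d i"]) (auto simp: less_Suc_eq_le)
  qed (simp add: Fs_def)
  moreover have val: "form_value Fs x = map proj (s x)" and def: "defined_at Fs x"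
    if "s x \<in> homog_coords ms" for x
  proof -
    note sx = homog_coordsD[OF that]
    have "map (\<lambda>F. peval F x) (Fs ! i) = s x ! i" if "i < length ms" for i
      using that sx F(2) by (intro nth_equalityI) (auto simp: Fs_def less_Suc_eq_le simp del: upt_Suc)
    then show "form_value Fs x = map proj (s x)"
      unfolding form_value_def using sx by (intro nth_equalityI) (auto simp: Fs_def)
    show "defined_at Fs x"
      unfolding defined_at_def
    proof
      fix G assume "G \<in> set Fs"
      then obtain i where i: "i < length ms" "G = map (F i) [0..<Suc (ms ! i)]" by (auto simp: Fs_def)
      obtain j where j: "j \<le> ms ! i" "s x ! i ! j \<noteq> 0" using sx(3) i(1) by blast
      have "F i j \<in> set G" using i(2) j(1) by (auto simp: less_Suc_eq_le simp del: upt_Suc)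
      then show "\<exists>F\<in>set G. peval F x \<noteq> 0" using F(2)[OF i(1) j(1)] j(2) by metis
    qed
  qed
  ultimately have *: "\<forall>p\<in>X. form_system ns ms Fs \<and> (\<forall>x\<in>listset p. defined_at Fs x) \<and>
        (\<forall>q\<in>X. \<forall>x\<in>listset q. defined_at Fs x \<longrightarrow> f q = form_value Fs x)"
    using f by (auto simp: val def)
  have "f ` X \<subseteq> Y"
  proof (rule image_subsetI)
    fix p assume p: "p \<in> X"
    then obtain x where "x \<in> listset p" using mproj_obtain_coords X by blast
    then show "f p \<in> Y" using f p by blast
  qed
  then show ?thesis unfolding morphism_def using * by blast
qed

section \<open>The surfaces in coordinates\<close>

lemma homog_coords_2_1:
  "x \<in> homog_coords [2, 1] \<longleftrightarrow> (\<exists>x0 x1 x2 y1 y2. x = [[x0, x1, x2], [y1, y2]] \<and>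
    (x0 \<noteq> 0 \<or> x1 \<noteq> 0 \<or> x2 \<noteq> 0) \<and> (y1 \<noteq> 0 \<or> y2 \<noteq> 0))"
  by (fastforce simp: homog_coords_def list_all2_Cons2 length_Suc_conv numeral_2_eq_2)

lemma homog_coords_3:
  "x \<in> homog_coords [3] \<longleftrightarrow> (\<exists>t0 t1 t2 t3. x = [[t0, t1, t2, t3]] \<and>
    (t0 \<noteq> 0 \<or> t1 \<noteq> 0 \<or> t2 \<noteq> 0 \<or> t3 \<noteq> 0))"
  by (fastforce simp: homog_coords_def list_all2_Cons2 length_Suc_conv numeral_3_eq_3)

definition X_form :: "'k::field list list \<Rightarrow> 'k" where
  "X_form x = x ! 0 ! 1 * x ! 1 ! 1 - x ! 0 ! 2 * x ! 1 ! 0"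

definition W_form :: "'k::field list list \<Rightarrow> 'k" where
  "W_form t = t ! 0 ! 0 * t ! 0 ! 1 * t ! 0 ! 2 - t ! 0 ! 0 ^ 2 * t ! 0 ! 3 - t ! 0 ! 1 ^ 3"

lemma form_fun_2_1:
  "j \<le> 2 \<Longrightarrow> form_fun [2, 1] (\<lambda>k. if k = 0 then 1 else 0) (\<lambda>x. x ! 0 ! j)"
  "j \<le> 1 \<Longrightarrow> form_fun [2, 1] (\<lambda>k. if k = 1 then 1 else 0) (\<lambda>x. x ! 1 ! j)"
  using form_fun_var[of 0 "[2, 1]" j] form_fun_var[of 1 "[2, 1]" j] by simp_all

lemma form_fun_3: "j \<le> 3 \<Longrightarrow> form_fun [3] (\<lambda>_. 1) (\<lambda>x. x ! 0 ! j)"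
  using form_fun_var[of 0 "[3]" j] by (auto elim: form_fun_cong)

lemma form_fun_bilinear:
  assumes "i \<le> 2" "j \<le> 1"
  shows "form_fun [2, 1] (\<lambda>_. 1) (\<lambda>x. x ! 0 ! i * x ! 1 ! j)"
  by (rule form_fun_cong[OF form_fun_mult[OF form_fun_2_1(1)[OF assms(1)] form_fun_2_1(2)[OF assms(2)]]])
    (auto simp: less_Suc_eq)

lemma form_fun_X_form: "form_fun [2, 1] (\<lambda>_. 1) X_form"
  unfolding X_form_def by (intro form_fun_diff form_fun_bilinear) auto

lemma form_fun_W_form: "form_fun [3] (\<lambda>_. 3) W_form"
proof -
  have "form_fun [3] (\<lambda>_. 1 + 1 + 1) (\<lambda>t. t ! 0 ! 0 * t ! 0 ! 1 * t ! 0 ! 2)"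
    "form_fun [3] (\<lambda>_. 2 * 1 + 1) (\<lambda>t. t ! 0 ! 0 ^ 2 * t ! 0 ! 3)"
    "form_fun [3] (\<lambda>_. 3 * 1) (\<lambda>t. t ! 0 ! 1 ^ 3)"
    by (intro form_fun_mult form_fun_power form_fun_3; simp)+
  then show ?thesis unfolding W_form_def by (intro form_fun_diff) (simp_all add: eval_nat_numeral)
qed

lemma coords_2_1: "p \<in> mproj [2, 1] \<Longrightarrow> x \<in> listset p \<Longrightarrow> x \<in> homog_coords [2, 1] \<and> p = map proj x"
  and coords_3: "q \<in> mproj [3] \<Longrightarrow> t \<in> listset q \<Longrightarrow> t \<in> homog_coords [3] \<and> q = map proj t"
  using mproj_coords by blast+

lemma cayley_X_eq: "cayley_X = {p \<in> mproj [2, 1]. \<forall>x\<in>listset p. X_form x = 0}"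
proof -
  have "(\<forall>x0 x1 x2 y1 y2. [[x0, x1, x2], [y1, y2]] \<in> listset p \<longrightarrow> x1 * y2 = x2 * y1) \<longleftrightarrow>
      (\<forall>x\<in>listset p. X_form x = 0)" if p: "p \<in> mproj [2, 1]" for p :: "'a mpoint"
    using coords_2_1[OF p] unfolding homog_coords_2_1 X_form_def by fastforce
  then show ?thesis unfolding cayley_X_def by blast
qed

lemma cayley_W_eq: "cayley_W = {p \<in> mproj [3]. \<forall>x\<in>listset p. W_form x = 0}"
proof -
  have "(\<forall>t0 t1 t2 t3. [[t0, t1, t2, t3]] \<in> listset p \<longrightarrow> t0 * t1 * t2 - t0^2 * t3 - t1^3 = 0) \<longleftrightarrow>
      (\<forall>x\<in>listset p. W_form x = 0)" if p: "p \<in> mproj [3]" for p :: "'a mpoint"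
    using coords_3[OF p] unfolding homog_coords_3 W_form_def by fastforce
  then show ?thesis unfolding cayley_W_def by blast
qed

lemma cayley_U_eq: "cayley_U = {p \<in> cayley_X. \<forall>x\<in>listset p. x ! 0 ! 1 \<noteq> 0}"
proof -
  have "(\<forall>x0 x1 x2 y1 y2. [[x0, x1, x2], [y1, y2]] \<in> listset p \<longrightarrow> x1 \<noteq> 0) \<longleftrightarrow>
      (\<forall>x\<in>listset p. x ! 0 ! 1 \<noteq> 0)" if p: "p \<in> mproj [2, 1]" for p :: "'a mpoint"
    using coords_2_1[OF p] unfolding homog_coords_2_1 by fastforce
  then show ?thesis unfolding cayley_U_def by (auto simp: cayley_X_eq)
qed

lemma cayley_V_eq: "cayley_V = {p \<in> cayley_W. \<forall>x\<in>listset p. x ! 0 ! 0 \<noteq> 0}"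
proof -
  have "(\<forall>t0 t1 t2 t3. [[t0, t1, t2, t3]] \<in> listset p \<longrightarrow> t0 \<noteq> 0) \<longleftrightarrow>
      (\<forall>x\<in>listset p. x ! 0 ! 0 \<noteq> 0)" if p: "p \<in> mproj [3]" for p :: "'a mpoint"
    using coords_3[OF p] unfolding homog_coords_3 by fastforce
  then show ?thesis unfolding cayley_V_def by (auto simp: cayley_W_eq)
qed

lemma map_proj_in_cayley_X:
  "x \<in> homog_coords [2, 1] \<Longrightarrow> X_form (x :: 'k::field_char_0 list list) = 0 \<Longrightarrow> map proj x \<in> cayley_X"
  unfolding cayley_X_eq
  using form_fun_zero_iff[OF form_fun_X_form map_proj_in_mproj in_listset_map_proj] map_proj_in_mproj
  by blast

lemma map_proj_in_cayley_W:
  "t \<in> homog_coords [3] \<Longrightarrow> W_form (t :: 'k::field_char_0 list list) = 0 \<Longrightarrow> map proj t \<in> cayley_W"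
  unfolding cayley_W_eq
  using form_fun_zero_iff[OF form_fun_W_form map_proj_in_mproj in_listset_map_proj] map_proj_in_mproj
  by blast

lemma map_proj_in_cayley_U:
  assumes "map proj x \<in> cayley_X" "x \<in> homog_coords [2, 1]" "x ! 0 ! 1 \<noteq> (0::'k::field_char_0)"
  shows "map proj x \<in> cayley_U"
  unfolding cayley_U_eq
  using form_fun_zero_iff[OF form_fun_2_1(1)[of 1] map_proj_in_mproj in_listset_map_proj] assms
  by auto

lemma map_proj_in_cayley_V:
  assumes "map proj t \<in> cayley_W" "t \<in> homog_coords [3]" "t ! 0 ! 0 \<noteq> (0::'k::field_char_0)"
  shows "map proj t \<in> cayley_V"
  unfolding cayley_V_eq
  using form_fun_zero_iff[OF form_fun_3[of 0] map_proj_in_mproj in_listset_map_proj] assms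
  by auto

text \<open>
  The cone over \<open>X\<close> as the image of an affine space: on \<open>X\<close> the vector \<open>(x\<^sub>1, x\<^sub>2)\<close> is \<open>s\<close> times \<open>(u, v)\<close>.
\<close>

definition X_param :: "'k::field \<Rightarrow> 'k \<Rightarrow> 'k \<Rightarrow> 'k \<Rightarrow> 'k list list" where
  "X_param x0 s u v = [[x0, s * u, s * v], [u, v]]"

lemma X_param_in_coords:
  assumes "x0 \<noteq> 0 \<or> s \<noteq> 0" "u \<noteq> 0 \<or> v \<noteq> (0::'k::field_char_0)"
  shows "X_param x0 s u v \<in> homog_coords [2, 1]" "map proj (X_param x0 s u v) \<in> cayley_X"
proof -
  show c: "X_param x0 s u v \<in> homog_coords [2, 1]"
    using assms unfolding homog_coords_2_1 X_param_def by auto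
  show "map proj (X_param x0 s u v) \<in> cayley_X"
    by (rule map_proj_in_cayley_X[OF c]) (simp add: X_form_def X_param_def)
qed

lemma cayley_X_obtain_param:
  assumes "p \<in> cayley_X" "x \<in> listset p"
  obtains x0 s u v where "x = X_param x0 s u v" "x0 \<noteq> 0 \<or> s \<noteq> 0" "u \<noteq> 0 \<or> v \<noteq> (0::'k::field_char_0)"
proof -
  have p: "p \<in> mproj [2, 1]" and e: "X_form x = 0" using assms by (auto simp: cayley_X_eq)
  obtain x0 x1 x2 y1 y2 where x: "x = [[x0, x1, x2], [y1, y2]]" "x0 \<noteq> 0 \<or> x1 \<noteq> 0 \<or> x2 \<noteq> 0"
    "y1 \<noteq> 0 \<or> y2 \<noteq> 0"
    using coords_2_1[OF p assms(2)] unfolding homog_coords_2_1 by blast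
  have eq: "x1 * y2 = x2 * y1" using e by (simp add: x X_form_def)
  have "\<exists>s. x1 = s * y1 \<and> x2 = s * y2"
  proof (cases "y1 = 0")
    case True
    then show ?thesis using eq x(3) by (intro exI[of _ "x2 / y2"]) auto
  next
    case False
    then show ?thesis using eq by (intro exI[of _ "x1 / y1"]) (simp add: field_simps)
  qed
  then obtain s where "x1 = s * y1" "x2 = s * y2" by blast
  then show ?thesis using x by (intro that[of x0 s y1 y2]) (auto simp: X_param_def)
qed

definition phi_coords :: "'k::field list list \<Rightarrow> 'k list list" where
  "phi_coords x = [[x ! 0 ! 1 * x ! 1 ! 0, x ! 0 ! 1 * x ! 1 ! 1,
    x ! 0 ! 0 * x ! 1 ! 0 + x ! 0 ! 2 * x ! 1 ! 1, x ! 0 ! 0 * x ! 1 ! 1]]"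

text \<open>
  The inverse of \<open>\<phi>\<close> where \<open>t\<^sub>0\<close> does not vanish.  The fibre coordinate over \<open>y = (t\<^sub>0, t\<^sub>1)\<close> is
  \<open>s = 1 / t\<^sub>0\<close>, because \<open>t\<^sub>0 = s u\<^sup>2\<close>, and the equation for \<open>t\<^sub>2\<close> gives \<open>x\<^sub>0\<close>; then \<open>x\<close> is multiplied by
  \<open>t\<^sub>0\<^sup>2\<close>.
\<close>

definition psi_coords :: "'k::field list list \<Rightarrow> 'k list list" where
  "psi_coords t = [[t ! 0 ! 0 * t ! 0 ! 2 - t ! 0 ! 1 ^ 2, t ! 0 ! 0 ^ 2, t ! 0 ! 0 * t ! 0 ! 1],
    [t ! 0 ! 0, t ! 0 ! 1]]"

lemma phi_coords_param:
  "phi_coords (X_param x0 s u v) = [[s * u^2, s * u * v, x0 * u + s * v^2, x0 * v]]"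
  by (simp add: phi_coords_def X_param_def power2_eq_square)

lemma phi_coords_X:
  assumes "p \<in> cayley_X" "x \<in> listset p"
  shows "phi_coords x \<in> homog_coords [3]" "cayley_phi p = map proj (phi_coords x)"
    "cayley_phi p \<in> (cayley_W :: 'k::field_char_0 mpoint set)"
proof -
  obtain x0 s u v where x: "x = X_param x0 s u v" "x0 \<noteq> 0 \<or> s \<noteq> 0" "u \<noteq> 0 \<or> v \<noteq> 0"
    by (rule cayley_X_obtain_param[OF assms])
  have "p = map proj x" using assms coords_2_1 by (auto simp: cayley_X_eq)
  then show phi: "cayley_phi p = map proj (phi_coords x)"
    by (simp add: x X_param_def cayley_phi_formula phi_coords_def)
  show c: "phi_coords x \<in> homog_coords [3]"
    unfolding x(1) phi_coords_param homog_coords_3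
    using x(2,3) by (cases "u = 0"; cases "s = 0") auto
  show "cayley_phi p \<in> (cayley_W :: 'k mpoint set)"
    unfolding phi by (rule map_proj_in_cayley_W[OF c])
      (simp add: x phi_coords_param W_form_def algebra_simps eval_nat_numeral)
qed

lemma form_fun_phi_coords:
  assumes "i < length [3]" "j \<le> [3] ! i"
  shows "form_fun [2, 1] (\<lambda>_. 1) (\<lambda>x. phi_coords x ! i ! j)"
proof -
  have ij: "i = 0 \<and> (j = 0 \<or> j = 1 \<or> j = 2 \<or> j = 3)" using assms by auto
  have "form_fun [2, 1] (\<lambda>_. 1) (\<lambda>x. x ! 0 ! 1 * x ! 1 ! 0)"
    "form_fun [2, 1] (\<lambda>_. 1) (\<lambda>x. x ! 0 ! 1 * x ! 1 ! 1)"
    "form_fun [2, 1] (\<lambda>_. 1) (\<lambda>x. x ! 0 ! 0 * x ! 1 ! 0 + x ! 0 ! 2 * x ! 1 ! 1)"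
    "form_fun [2, 1] (\<lambda>_. 1) (\<lambda>x. x ! 0 ! 0 * x ! 1 ! 1)"
    by (intro form_fun_add form_fun_bilinear; simp)+
  then show ?thesis
    using ij unfolding phi_coords_def by (elim conjE disjE) simp_all
qed

lemma morphism_cayley_phi:
  assumes "X \<subseteq> cayley_X" "\<And>p. p \<in> X \<Longrightarrow> cayley_phi p \<in> Y"
  shows "morphism [2, 1] X [3] (Y :: 'k::field_char_0 mpoint set) cayley_phi"
proof (rule morphism_of_forms[OF _ form_fun_phi_coords])
  show "X \<subseteq> mproj [2, 1]" using assms(1) by (auto simp: cayley_X_eq)
  show "phi_coords x \<in> homog_coords [3] \<and> cayley_phi p = map proj (phi_coords x) \<and> cayley_phi p \<in> Y"
    if "p \<in> X" "x \<in> listset p" for p x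
    using phi_coords_X that assms by blast
qed

lemma form_fun_psi_coords:
  assumes "i < length [2, 1]" "j \<le> [2, 1] ! i"
  shows "form_fun [3] (\<lambda>_. if i = 0 then 2 else 1) (\<lambda>t. psi_coords t ! i ! j)"
proof -
  have c: "i = 0 \<and> (j = 0 \<or> j = 1 \<or> j = 2) \<or> i = 1 \<and> (j = 0 \<or> j = 1)"
    using assms by (auto simp: less_Suc_eq)
  have "form_fun [3] (\<lambda>_. 1 + 1) (\<lambda>t. t ! 0 ! 0 * t ! 0 ! 2)" "form_fun [3] (\<lambda>_. 1 + 1) (\<lambda>t. t ! 0 ! 0 * t ! 0 ! 1)"
    "form_fun [3] (\<lambda>_. 2 * 1) (\<lambda>t. t ! 0 ! 1 ^ 2)" "form_fun [3] (\<lambda>_. 2 * 1) (\<lambda>t. t ! 0 ! 0 ^ 2)"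
    by (intro form_fun_mult form_fun_power form_fun_3; simp)+
  then have q: "form_fun [3] (\<lambda>_. 2) (\<lambda>t. t ! 0 ! 0 * t ! 0 ! 2)"
    "form_fun [3] (\<lambda>_. 2) (\<lambda>t. t ! 0 ! 1 ^ 2)"
    "form_fun [3] (\<lambda>_. 2) (\<lambda>t. t ! 0 ! 0 * t ! 0 ! 1)"
    "form_fun [3] (\<lambda>_. 2) (\<lambda>t. t ! 0 ! 0 ^ 2)"
    unfolding one_add_one mult_1_right by blast+
  show ?thesis unfolding psi_coords_def
    using c form_fun_3[of 0] form_fun_3[of 1] q(3,4) form_fun_diff[OF q(1,2)]
    by (elim disjE conjE) simp_all
qed

definition cayley_psi :: "'k::field mpoint \<Rightarrow> 'k mpoint" where
  "cayley_psi q = map proj (psi_coords (SOME t. t \<in> listset q))"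

text \<open>
  The point is independent of the chosen coordinates, because both rows of \<open>psi_coords\<close> are homogeneous.
\<close>

lemma cayley_psi_eq:
  assumes "q \<in> mproj [3]" "t \<in> listset q" "t ! 0 ! 0 \<noteq> (0 :: 'k::field_char_0)"
  shows "cayley_psi q = map proj (psi_coords t)"
proof -
  define t' where "t' = (SOME t. t \<in> listset q)"
  have t': "t' \<in> listset q" unfolding t'_def using assms(2) by (rule someI)
  obtain c where c: "c \<noteq> 0" "t' ! 0 = map ((*) c) (t ! 0)"
  proof (rule coords_rescale[OF assms(1,2) t'])
    fix c assume "\<And>i. i < length [3] \<Longrightarrow> c i \<noteq> (0 :: 'k)"
      "\<And>i. i < length [3] \<Longrightarrow> t' ! i = map ((*) (c i)) (t ! i)"
    then show ?thesis using that[of "c 0"] by simp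
  qed
  obtain t0 t1 t2 t3 where t: "t = [[t0, t1, t2, t3]]"
    using coords_3[OF assms(1,2)] unfolding homog_coords_3 by blast
  have e: "psi_coords t' = [map ((*) (c ^ 2)) (psi_coords t ! 0), map ((*) c) (psi_coords t ! 1)]"
    unfolding psi_coords_def c(2) by (simp add: t power2_eq_square algebra_simps)
  have "map proj (psi_coords t') = [proj (psi_coords t ! 0), proj (psi_coords t ! 1)]"
    unfolding e using c(1) by (simp add: proj_map)
  also have "\<dots> = map proj (psi_coords t)" by (simp add: psi_coords_def)
  finally show ?thesis by (simp add: cayley_psi_def t'_def)
qed

lemma psi_coords_V:
  assumes "q \<in> cayley_W" "t \<in> listset q" "t ! 0 ! 0 \<noteq> (0 :: 'k::field_char_0)"
  shows "psi_coords t \<in> homog_coords [2, 1]" "map proj (psi_coords t) \<in> cayley_U"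
    "map proj (phi_coords (psi_coords t)) = q"
proof -
  have q: "q \<in> mproj [3]" "W_form t = 0" using assms by (auto simp: cayley_W_eq)
  obtain t0 t1 t2 t3 where t: "t = [[t0, t1, t2, t3]]"
    using coords_3[OF q(1) assms(2)] unfolding homog_coords_3 by blast
  have t0: "t0 \<noteq> 0" and W: "t0 * t1 * t2 - t0^2 * t3 - t1^3 = 0"
    using assms(3) q(2) by (simp_all add: t W_form_def)
  have e: "psi_coords t = X_param (t0 * t2 - t1^2) t0 t0 t1"
    by (simp add: psi_coords_def X_param_def t power2_eq_square)
  then show c: "psi_coords t \<in> homog_coords [2, 1]"
    using X_param_in_coords(1) t0 by auto
  show "map proj (psi_coords t) \<in> cayley_U"
    by (rule map_proj_in_cayley_U[OF _ c]) (use e X_param_in_coords(2) t0 in \<open>auto simp: X_param_def\<close>)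
  have "t0 * t1 * t2 - t1 ^ 3 = t0^2 * t3" using W by (simp add: algebra_simps)
  then have "phi_coords (psi_coords t) = [map ((*) (t0^2)) (t ! 0)]"
    unfolding e phi_coords_param by (simp add: t power2_eq_square eval_nat_numeral algebra_simps)
  then have "map proj (phi_coords (psi_coords t)) = [proj (t ! 0)]" using t0 by (simp add: proj_map)
  then show "map proj (phi_coords (psi_coords t)) = q"
    using coords_3[OF q(1) assms(2)] by (simp add: t)
qed

lemma isomorphism_cayley_U_V:
  "isomorphism [2, 1] cayley_U [3] (cayley_V :: 'k::field_char_0 mpoint set) cayley_phi"
proof -
  have U: "cayley_phi p \<in> cayley_V \<and> cayley_psi (cayley_phi p) = p" if p: "p \<in> cayley_U" for p :: "'k mpoint"
  proof -
    have pX: "p \<in> cayley_X" using p by (simp add: cayley_U_eq)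
    then have pm: "p \<in> mproj [2, 1]" by (simp add: cayley_X_eq)
    then obtain x where x: "x \<in> listset p" using mproj_obtain_coords by blast
    then obtain x0 s u v where xp: "x = X_param x0 s u v" "u \<noteq> 0 \<or> v \<noteq> 0"
      using cayley_X_obtain_param[OF pX] by metis
    have su: "s * u \<noteq> 0" using p x xp by (auto simp: cayley_U_eq X_param_def)
    note phi = phi_coords_X[OF pX x]
    have q: "phi_coords x \<in> listset (cayley_phi p)" "cayley_phi p \<in> mproj [3]"
      using phi in_listset_map_proj map_proj_in_mproj by auto
    have "cayley_phi p \<in> cayley_V"
      using map_proj_in_cayley_V[of "phi_coords x"] phi su by (simp add: xp phi_coords_param)
    moreover have "cayley_psi (cayley_phi p) = map proj (psi_coords (phi_coords x))"
      using cayley_psi_eq[OF q(2,1)] su by (simp add: xp phi_coords_param)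
    moreover have "psi_coords (phi_coords x) =
        [map ((*) (s * u^3)) (x ! 0), map ((*) (s * u)) (x ! 1)]"
      unfolding xp(1) phi_coords_param
      by (simp add: psi_coords_def X_param_def algebra_simps eval_nat_numeral)
    moreover have "map proj [map ((*) (s * u^3)) (x ! 0), map ((*) (s * u)) (x ! 1)] = map proj x"
      using su proj_map[of "s * u^3" "x ! 0"] proj_map[of "s * u" "x ! 1"]
      by (simp add: xp(1) X_param_def)
    ultimately show ?thesis using coords_2_1[OF pm x] by simp
  qed
  have V: "cayley_psi q \<in> cayley_U \<and> cayley_phi (cayley_psi q) = q \<and>
      psi_coords t \<in> homog_coords [2, 1] \<and> cayley_psi q = map proj (psi_coords t)"
    if q: "q \<in> cayley_V" and t: "t \<in> listset q" for q :: "'k mpoint" and t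
  proof -
    have qW: "q \<in> cayley_W" "q \<in> mproj [3]" and t0: "t ! 0 ! 0 \<noteq> 0"
      using q t by (auto simp: cayley_V_eq cayley_W_eq)
    note psi = psi_coords_V[OF qW(1) t t0]
    have e: "cayley_psi q = map proj (psi_coords t)" by (rule cayley_psi_eq[OF qW(2) t t0])
    have "map proj (psi_coords t) \<in> cayley_X" using psi(2) by (simp add: cayley_U_eq)
    from phi_coords_X(2)[OF this in_listset_map_proj[OF psi(1)]] show ?thesis
      using psi e by simp
  qed
  have "morphism [3] cayley_V [2, 1] (cayley_U :: 'k mpoint set) cayley_psi"
  proof (rule morphism_of_forms[OF _ form_fun_psi_coords])
    show "cayley_V \<subseteq> mproj [3]" by (auto simp: cayley_V_eq cayley_W_eq)
    show "psi_coords t \<in> homog_coords [2, 1] \<and> cayley_psi q = map proj (psi_coords t) \<and>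
        cayley_psi q \<in> cayley_U" if "q \<in> cayley_V" "t \<in> listset q" for q :: "'k mpoint" and t
      using V[OF that] by blast
  qed
  moreover have "morphism [2, 1] (cayley_U :: 'k mpoint set) [3] cayley_V cayley_phi"
    using U by (intro morphism_cayley_phi) (auto simp: cayley_U_eq)
  moreover have "\<forall>q\<in>cayley_V. cayley_phi (cayley_psi q) = (q :: 'k mpoint)"
  proof
    fix q :: "'k mpoint" assume q: "q \<in> cayley_V"
    then have "q \<in> mproj [3]" by (simp add: cayley_V_eq cayley_W_eq)
    then obtain t where "t \<in> listset q" using mproj_obtain_coords by blast
    then show "cayley_phi (cayley_psi q) = q" using V[OF q] by blast
  qed
  ultimately show ?thesis unfolding isomorphism_def using U by blast
qed


section \<open>The surface X: irreducibility, dimension and smoothness\<close>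

text \<open>
  Stated for affine subspaces \<open>E\<close> of the space of parameters, so that it also covers the members of the
  chain of closed sets in \<open>krull_dim_cayley_X\<close>.
\<close>

lemma cayley_X_irreducible_part:
  assumes E: "\<And>a b c d a' b' c' d' t. E a b c d \<Longrightarrow> E a' b' c' d' \<Longrightarrow>
      E (a + t * (a' - a)) (b + t * (b' - b)) (c + t * (c' - c)) (d + t * (d' - d))"
    and S: "S \<subseteq> cayley_X" "S \<subseteq> Y" "S \<noteq> {}"
    and iff: "\<And>x0 s u v. x0 \<noteq> 0 \<or> s \<noteq> 0 \<Longrightarrow> u \<noteq> 0 \<or> v \<noteq> 0 \<Longrightarrow>
      map proj (X_param x0 s u v) \<in> S \<longleftrightarrow> E x0 s u (v :: 'k::field_char_0)"
  shows "irreducible_in (zariski_on [2, 1] Y) S"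
proof (rule irreducible_in_parametrized[where P = X_param and E = E, OF S(2) _ S(3)])
  show "S \<subseteq> mproj [2, 1]" using S(1) by (auto simp: cayley_X_eq)
next
  fix i j :: nat and a b c d :: "'k \<Rightarrow> 'k"
  assume ij: "i < length [2, 1 :: nat]" "j \<le> [2, 1] ! i" and abcd: "poly_fun a" "poly_fun b" "poly_fun c" "poly_fun d"
  have "i = 0 \<and> (j = 0 \<or> j = 1 \<or> j = 2) \<or> i = 1 \<and> (j = 0 \<or> j = 1)"
    using ij by (auto simp: less_Suc_eq)
  moreover have "poly_fun (\<lambda>t. b t * c t)" "poly_fun (\<lambda>t. b t * d t)"
    using abcd by (intro poly_fun_mult; simp)+
  ultimately show "poly_fun (\<lambda>t. X_param (a t) (b t) (c t) (d t) ! i ! j)"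
    using abcd unfolding X_param_def by (elim disjE conjE) simp_all
next
  fix p assume p: "p \<in> S"
  then have pX: "p \<in> cayley_X" using S(1) by blast
  then have pm: "p \<in> mproj [2, 1]" by (simp add: cayley_X_eq)
  then obtain x where x: "x \<in> listset p" using mproj_obtain_coords by blast
  obtain x0 s u v where xp: "x = X_param x0 s u v" "x0 \<noteq> 0 \<or> s \<noteq> 0" "u \<noteq> 0 \<or> v \<noteq> 0"
    by (rule cayley_X_obtain_param[OF pX x])
  have "p = map proj x" using coords_2_1[OF pm x] by simp
  then have "E x0 s u v" using iff[OF xp(2,3)] p xp(1) by simp
  then show "\<exists>a b c d. E a b c d \<and> (a \<noteq> 0 \<or> b \<noteq> 0) \<and> (c \<noteq> 0 \<or> d \<noteq> 0) \<and> X_param a b c d \<in> listset p"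
    using xp x by (intro exI[of _ x0] exI[of _ s] exI[of _ u] exI[of _ v]) simp
next
  fix a b c d :: 'k assume e: "E a b c d" and nz: "a \<noteq> 0 \<or> b \<noteq> 0" "c \<noteq> 0 \<or> d \<noteq> 0"
  show "\<exists>p\<in>S. X_param a b c d \<in> listset p"
    using in_listset_map_proj[OF X_param_in_coords(1)[OF nz]] iff[OF nz] e
    by (intro bexI[of _ "map proj (X_param a b c d)"]) simp_all
qed (rule E)

lemma irreducible_cayley_X:
  assumes "cayley_X \<subseteq> Y"
  shows "irreducible_in (zariski_on [2, 1] Y) (cayley_X :: 'k::field_char_0 mpoint set)"
proof (rule cayley_X_irreducible_part[where E = "\<lambda>_ _ _ _. True"])
  show "(cayley_X :: 'k mpoint set) \<noteq> {}" using X_param_in_coords(2)[of 1 0 1 0] by auto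
qed (use X_param_in_coords(2) assms in auto)

lemma cayley_phi_surj:
  assumes "q \<in> cayley_W" "t \<in> listset q"
  shows "\<exists>x\<in>homog_coords [2, 1]. map proj x \<in> cayley_X \<and> map proj (phi_coords x) = (q :: 'k::field_char_0 mpoint)"
proof (cases "t ! 0 ! 0 = 0")
  case False
  then show ?thesis using psi_coords_V[OF assms] by (auto simp: cayley_U_eq)
next
  case True
  have q: "q \<in> mproj [3]" "W_form t = 0" using assms by (auto simp: cayley_W_eq)
  obtain t1 t2 t3 where t: "t = [[0, t1, t2, t3]]" "t1 \<noteq> 0 \<or> t2 \<noteq> 0 \<or> t3 \<noteq> 0"
    using coords_3[OF q(1) assms(2)] True unfolding homog_coords_3 by auto
  have "t1 = 0" using q(2) by (simp add: t W_form_def)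
  then have "phi_coords (X_param t3 t2 0 1) = t" "t3 \<noteq> 0 \<or> t2 \<noteq> 0"
    using t by (auto simp: phi_coords_param)
  then show ?thesis
    using X_param_in_coords[of t3 t2 0 1] coords_3[OF q(1) assms(2)] by (metis zero_neq_one)
qed

lemma irreducible_cayley_W:
  assumes "cayley_W \<subseteq> Y"
  shows "irreducible_in (zariski_on [3] Y) (cayley_W :: 'k::field_char_0 mpoint set)"
proof (rule irreducible_in_parametrized[where P = "\<lambda>a b c d. phi_coords (X_param a b c d)"
      and E = "\<lambda>_ _ _ _. True", OF assms])
  show "cayley_W \<subseteq> mproj [3]" by (auto simp: cayley_W_eq)
next
  have "cayley_phi (map proj (X_param 1 0 1 0)) \<in> (cayley_W :: 'k mpoint set)"
    using phi_coords_X(3)[OF X_param_in_coords(2) in_listset_map_proj[OF X_param_in_coords(1)]]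
    by (metis zero_neq_one)
  then show "(cayley_W :: 'k mpoint set) \<noteq> {}" by blast
next
  fix i j :: nat and a b c d :: "'k \<Rightarrow> 'k"
  assume ij: "i < length [3 :: nat]" "j \<le> [3] ! i" and abcd: "poly_fun a" "poly_fun b" "poly_fun c" "poly_fun d"
  have "i = 0 \<and> (j = 0 \<or> j = 1 \<or> j = 2 \<or> j = 3)" using ij by auto
  moreover have "poly_fun (\<lambda>t. b t * c t ^ 2)" "poly_fun (\<lambda>t. b t * c t * d t)"
    "poly_fun (\<lambda>t. a t * c t + b t * d t ^ 2)" "poly_fun (\<lambda>t. a t * d t)"
    using abcd by (intro poly_fun_mult poly_fun_add poly_fun_power; simp)+
  ultimately show "poly_fun (\<lambda>t. phi_coords (X_param (a t) (b t) (c t) (d t)) ! i ! j)"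
    unfolding phi_coords_param by (elim disjE conjE) simp_all
next
  fix q :: "'k mpoint" assume q: "q \<in> cayley_W"
  then have "q \<in> mproj [3]" by (simp add: cayley_W_eq)
  then obtain t where "t \<in> listset q" using mproj_obtain_coords by blast
  then obtain x where x: "x \<in> homog_coords [2, 1]" "map proj x \<in> cayley_X" "map proj (phi_coords x) = q"
    using cayley_phi_surj[OF q] by blast
  have xl: "x \<in> listset (map proj x)" by (rule in_listset_map_proj[OF x(1)])
  obtain x0 s u v where xp: "x = X_param x0 s u v" "x0 \<noteq> 0 \<or> s \<noteq> 0" "u \<noteq> 0 \<or> v \<noteq> 0"
    by (rule cayley_X_obtain_param[OF x(2) xl])
  have "phi_coords x \<in> listset q"
    using in_listset_map_proj[OF phi_coords_X(1)[OF x(2) xl]] x(3) by simp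
  then show "\<exists>a b c d. True \<and> (a \<noteq> 0 \<or> b \<noteq> 0) \<and> (c \<noteq> 0 \<or> d \<noteq> 0) \<and> phi_coords (X_param a b c d) \<in> listset q"
    using xp by (intro exI[of _ x0] exI[of _ s] exI[of _ u] exI[of _ v]) simp
next
  fix a b c d :: 'k assume "a \<noteq> 0 \<or> b \<noteq> 0" "c \<noteq> 0 \<or> d \<noteq> 0"
  note X = X_param_in_coords[OF this]
  note phi = phi_coords_X[OF X(2) in_listset_map_proj[OF X(1)]]
  show "\<exists>p\<in>cayley_W. phi_coords (X_param a b c d) \<in> listset p"
    using phi(3) in_listset_map_proj[OF phi(1)] phi(2) by auto
qed simp

lemma variety_cayley_X: "variety [2, 1] (cayley_X :: 'k::field_char_0 mpoint set)"
  using variety_of_zero_set[OF form_fun_X_form, folded cayley_X_eq] irreducible_cayley_X[of UNIV]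
  by (metis subset_UNIV subtopology_UNIV)

lemma variety_cayley_W: "variety [3] (cayley_W :: 'k::field_char_0 mpoint set)"
  using variety_of_zero_set[OF form_fun_W_form, folded cayley_W_eq] irreducible_cayley_W[of UNIV]
  by (metis subset_UNIV subtopology_UNIV)

text \<open>
  A monomial of bidegree \<open>(D, D)\<close> becomes a monomial in the parameters, in which the exponents of \<open>s\<close> and
  \<open>u\<close> determine those of \<open>x\<^sub>0\<close> and \<open>v\<close>.  The first is at most \<open>D\<close> and the second at most \<open>2 * D\<close>.
\<close>

lemma indep_forms_cayley_X_bound:
  assumes "indep_forms [2, 1] (cayley_X :: 'k::field_char_0 mpoint set) D N"
  shows "N \<le> (D + 1) * (2 * D + 1)"
proof (rule ccontr)
  define B where "B = {..D} \<times> {..2 * D}"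
  assume "\<not> N \<le> (D + 1) * (2 * D + 1)"
  then have B: "finite B" "card B < N" by (auto simp: B_def)
  obtain g :: "nat \<Rightarrow> 'k list list \<Rightarrow> 'k" where
    g: "\<And>i. i < N \<Longrightarrow> form_fun [2, 1] (\<lambda>_. D) (g i)"
       "\<And>c i. vanishes_on (\<lambda>x. \<Sum>i<N. of_rat (c i) * g i x) cayley_X \<Longrightarrow> i < N \<Longrightarrow> c i = 0"
    using assms unfolding indep_forms_def by blast
  define par where "par = (\<lambda>(x0, s, u, v). X_param x0 s u v :: 'k list list)"
  define b where "b = (\<lambda>(j, k) (x0, s, u, v). x0 ^ (D - j) * s ^ j * u ^ k * v ^ (j + D - k) :: 'k)"
  have span: "\<exists>c. \<forall>w. g i (par w) = (\<Sum>\<beta>\<in>B. of_rat (c \<beta>) * b \<beta> w)" if i: "i < N" for i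
  proof -
    obtain F where F: "multihom [2, 1] (\<lambda>_. D) F" "\<And>x. g i x = peval F x"
      using g(1)[OF i] unfolding form_fun_def by auto
    define q where "q m = (Poly_Mapping.lookup m (0, 1) + Poly_Mapping.lookup m (0, 2),
        Poly_Mapping.lookup m (0, 1) + Poly_Mapping.lookup m (1, 0))"
      for m :: "nat \<times> nat \<Rightarrow>\<^sub>0 nat"
    have deg: "Poly_Mapping.lookup m (0, 0) + Poly_Mapping.lookup m (0, 1) + Poly_Mapping.lookup m (0, 2) = D"
      "Poly_Mapping.lookup m (1, 0) + Poly_Mapping.lookup m (1, 1) = D"
      if m: "m \<in> Poly_Mapping.keys F" for m
      using monomial_degree[OF F(1) m, of 0] monomial_degree[OF F(1) m, of 1]
      by (simp_all add: eval_nat_numeral)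
    have qB: "q ` Poly_Mapping.keys F \<subseteq> B" using deg by (fastforce simp: q_def B_def)
    have val: "monomial_value m (par w) = b (q m) w" if m: "m \<in> Poly_Mapping.keys F" for m w
    proof -
      obtain x0 s u v where w: "w = (x0, s, u, v)" by (metis prod_cases4)
      have "D - fst (q m) = Poly_Mapping.lookup m (0, 0)"
        "fst (q m) + D - snd (q m) = Poly_Mapping.lookup m (0, 2) + Poly_Mapping.lookup m (1, 1)"
        using deg[OF m] by (auto simp: q_def)
      then have "b (q m) w = x0 ^ Poly_Mapping.lookup m (0, 0) *
          s ^ (Poly_Mapping.lookup m (0, 1) + Poly_Mapping.lookup m (0, 2)) *
          u ^ (Poly_Mapping.lookup m (0, 1) + Poly_Mapping.lookup m (1, 0)) *
          v ^ (Poly_Mapping.lookup m (0, 2) + Poly_Mapping.lookup m (1, 1))"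
        by (simp add: b_def w q_def)
      moreover have "monomial_value m (par w) = x0 ^ Poly_Mapping.lookup m (0, 0) *
          (s * u) ^ Poly_Mapping.lookup m (0, 1) * (s * v) ^ Poly_Mapping.lookup m (0, 2) *
          u ^ Poly_Mapping.lookup m (1, 0) * v ^ Poly_Mapping.lookup m (1, 1)"
        unfolding monomial_value_multihom[OF F(1) m] par_def w X_param_def
        by (simp add: eval_nat_numeral)
      ultimately show ?thesis by (simp add: power_mult_distrib power_add mult_ac)
    qed
    have "g i (par w) = (\<Sum>\<beta>\<in>B. of_rat (\<Sum>m\<in>{m \<in> Poly_Mapping.keys F. q m = \<beta>}. Poly_Mapping.lookup F m) * b \<beta> w)"
      for w
    proof -
      have "g i (par w) = (\<Sum>m\<in>Poly_Mapping.keys F. of_rat (Poly_Mapping.lookup F m) * b (q m) w)"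
        unfolding F(2) peval_monomials by (intro sum.cong refl) (simp only: val)
      also have "\<dots> = (\<Sum>\<beta>\<in>B. \<Sum>m\<in>{m \<in> Poly_Mapping.keys F. q m = \<beta>}. of_rat (Poly_Mapping.lookup F m) * b (q m) w)"
        by (rule sum.group[OF _ B(1) qB, symmetric]) simp
      also have "\<dots> = (\<Sum>\<beta>\<in>B. of_rat (\<Sum>m\<in>{m \<in> Poly_Mapping.keys F. q m = \<beta>}. Poly_Mapping.lookup F m) * b \<beta> w)"
        by (intro sum.cong refl) (simp add: of_rat_sum sum_distrib_right)
      finally show ?thesis .
    qed
    then show ?thesis
      by (intro exI[of _ "\<lambda>\<beta>. \<Sum>m\<in>{m \<in> Poly_Mapping.keys F. q m = \<beta>}. Poly_Mapping.lookup F m"] allI)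
  qed
  have "\<exists>c. (\<exists>i<N. c i \<noteq> 0) \<and> (\<forall>w. (\<Sum>i<N. of_rat (c i) * g i (par w)) = 0)"
    by (rule rational_linear_relation[where h = "\<lambda>i w. g i (par w)" and b = b, OF B span])
  then obtain c where c: "\<exists>i<N. c i \<noteq> 0" "\<And>w. (\<Sum>i<N. of_rat (c i) * g i (par w)) = 0"
    by blast
  have "vanishes_on (\<lambda>x. \<Sum>i<N. of_rat (c i) * g i x) cayley_X"
    unfolding vanishes_on_def
  proof (intro ballI)
    fix p and x :: "'k list list" assume "p \<in> cayley_X" "x \<in> listset p"
    then obtain x0 s u v where "x = X_param x0 s u v" using cayley_X_obtain_param by metis
    then show "(\<Sum>i<N. of_rat (c i) * g i x) = 0" using c(2)[of "(x0, s, u, v)"] by (simp add: par_def)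
  qed
  then show False using g(2) c(1) by blast
qed

lemma krull_dim_cayley_X: "krull_dim (zariski_on [2, 1] (cayley_X :: 'k::field_char_0 mpoint set)) = 2"
proof (rule antisym)
  have "N \<le> 2 * (D + 1) ^ 2" if "indep_forms [2, 1] (cayley_X :: 'k mpoint set) D N" for D N
  proof -
    have "N \<le> (D + 1) * (2 * D + 1)" by (rule indep_forms_cayley_X_bound[OF that])
    also have "\<dots> \<le> 2 * (D + 1) ^ 2" by (simp add: power2_eq_square)
    finally show ?thesis .
  qed
  from krull_dim_le[OF this] show "krull_dim (zariski_on [2, 1] (cayley_X :: 'k mpoint set)) \<le> 2"
    by (simp add: numeral_eq_enat)
next
  let ?X = "cayley_X :: 'k mpoint set"
  define T where "T = zariski_on [2, 1] ?X"
  (* A chain of a point on a line on the surface: L is the fibre of the projection to the coordinate y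
     over (1, 0). *)
  define L where "L = {p \<in> ?X. \<forall>x\<in>listset p. x ! 1 ! 1 = 0}"
  define O' where "O' = {p \<in> L. \<forall>x\<in>listset p. x ! 0 ! 1 = 0}"
  have Xm: "?X \<inter> mproj [2, 1] = ?X" by (auto simp: cayley_X_eq)
  have zero_iff: "(\<forall>x'\<in>listset (map proj x). x' ! i ! j = 0) \<longleftrightarrow> x ! i ! j = 0"
    if "x \<in> homog_coords [2, 1]" "i < length [2, 1 :: nat]" "j \<le> [2, 1] ! i" for i j and x :: "'k list list"
    using form_fun_zero_iff[OF form_fun_var[OF that(2,3)] map_proj_in_mproj[OF that(1)]
        in_listset_map_proj[OF that(1)]] in_listset_map_proj[OF that(1)] by blast
  have L: "map proj (X_param x0 s u v) \<in> L \<longleftrightarrow> v = 0"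
    and O': "map proj (X_param x0 s u v) \<in> O' \<longleftrightarrow> v = 0 \<and> s = 0"
    if nz: "x0 \<noteq> 0 \<or> s \<noteq> 0" "u \<noteq> 0 \<or> v \<noteq> 0" for x0 s u v
    using zero_iff[OF X_param_in_coords(1)[OF nz], of 1 1] zero_iff[OF X_param_in_coords(1)[OF nz], of 0 1]
      X_param_in_coords(2)[OF nz] nz
    unfolding L_def O'_def by (auto simp: X_param_def)
  have closed: "closedin T ?X" "closedin T L" "closedin T O'"
  proof -
    show X: "closedin T ?X" using closedin_topspace[of T] Xm by (simp add: T_def topspace_subtopology Int_commute)
    show L: "closedin T L"
      using closedin_zero_set[OF form_fun_2_1(2)[of 1], of ?X] unfolding Xm by (simp add: T_def L_def)
    have "closedin T {p \<in> ?X. \<forall>x\<in>listset p. x ! 0 ! 1 = 0}"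
      using closedin_zero_set[OF form_fun_2_1(1)[of 1], of ?X] unfolding Xm by (simp add: T_def)
    moreover have "O' = L \<inter> {p \<in> ?X. \<forall>x\<in>listset p. x ! 0 ! 1 = 0}" by (auto simp: O'_def L_def)
    ultimately show "closedin T O'" using closedin_Int[OF L] by simp
  qed
  have ne: "O' \<noteq> {}" using O'[of 1 0 1 0] by auto
  have LX: "L \<subseteq> ?X" "O' \<subseteq> L" by (auto simp: L_def O'_def)
  have "irreducible_in T L" unfolding T_def
    by (rule cayley_X_irreducible_part[where E = "\<lambda>_ _ _ v. v = 0"]) (use LX ne L in auto)
  moreover have "irreducible_in T O'" unfolding T_def
    by (rule cayley_X_irreducible_part[where E = "\<lambda>_ s _ v. v = 0 \<and> s = 0"]) (use LX ne O' in auto)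
  moreover have "irreducible_in T ?X" unfolding T_def by (rule irreducible_cayley_X) simp
  moreover have "O' \<subset> L" using LX L[of 0 1 1 0] O'[of 0 1 1 0] by auto
  moreover have "L \<subset> ?X" using LX L[of 1 0 0 1] X_param_in_coords(2)[of 1 0 0 1] by auto
  ultimately have "(\<forall>i\<le>2. closedin T ([O', L, ?X] ! i) \<and> irreducible_in T ([O', L, ?X] ! i)) \<and>
      (\<forall>i<2. [O', L, ?X] ! i \<subset> [O', L, ?X] ! Suc i)"
    using closed by (auto simp: less_Suc_eq le_Suc_eq eval_nat_numeral)
  then have "enat 2 \<le> krull_dim T"
    unfolding krull_dim_def by (intro Sup_upper) blast
  then show "2 \<le> krull_dim (zariski_on [2, 1] ?X)" by (simp add: T_def numeral_eq_enat)
qed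

text \<open>
  With the other parameters fixed, \<open>X_param\<close> is linear in each of them, so four lines through the point lie on the cone over \<open>X\<close>, up
  to finitely many points.  The derivatives of \<open>F\<close> along them vanish, which leaves the multiples of
  the gradient of \<open>X_form\<close>.
\<close>

lemma gradient_vanishing_on_X:
  fixes F :: mpoly
  assumes F: "F \<in> vanishing_forms [2, 1] (cayley_X :: 'k::field_char_0 mpoint set)"
    and nz: "x0 \<noteq> 0 \<or> s \<noteq> 0" "u \<noteq> 0 \<or> v \<noteq> (0 :: 'k)"
  shows "\<exists>c. gradient F (X_param x0 s u v) = (\<lambda>w. c *
    (if w = (0, 1) then v else if w = (0, 2) then - u else
     if w = (1, 0) then - s * v else if w = (1, 1) then s * u else 0))"
proof -
  obtain d where d: "multihom [2, 1] d F" using F unfolding vanishing_forms_def by blast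
  define G where "G = gradient F (X_param x0 s u v)"
  have idx: "(i, j) \<in> {(0, 0), (0, 1), (0, 2), (1, 0), (1, 1)}"
    if "i < length [2, 1 :: nat]" "j \<le> [2, 1] ! i" for i j :: nat
    using that by (auto simp: less_Suc_eq)
  have line: "w0 * G (0, 0) + w1 * G (0, 1) + w2 * G (0, 2) + w3 * G (1, 0) + w4 * G (1, 1) = 0"
    if x: "\<And>t. X_param (a t) (b t) (c t) (e t) =
        [[x0 + t * w0, s * u + t * w1, s * v + t * w2], [u + t * w3, v + t * w4]]"
      and at0: "a 0 = x0" "b 0 = s" "c 0 = u" "e 0 = v"
      and P: "poly_fun a" "poly_fun b" "poly_fun c" "poly_fun e"
    for a b c e :: "'k \<Rightarrow> 'k" and w0 w1 w2 w3 w4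
  proof -
    define w where "w = (\<lambda>(i, j). [[w0, w1, w2], [w3, w4]] ! i ! j)"
    have xw: "X_param (a t) (b t) (c t) (e t) ! i ! j = X_param (a 0) (b 0) (c 0) (e 0) ! i ! j + t * w (i, j)"
      if "i < length [2, 1 :: nat]" "j \<le> [2, 1] ! i" for t i j
      using idx[OF that] unfolding x w_def by auto
    have "poly_fun (\<lambda>t. peval F (X_param (a t) (b t) (c t) (e t)))"
    proof (rule form_fun_on_curve[OF form_fun_peval[OF d]])
      fix i j :: nat assume ij: "i < length [2, 1 :: nat]" "j \<le> [2, 1] ! i"
      show "poly_fun (\<lambda>t. X_param (a t) (b t) (c t) (e t) ! i ! j)"
        by (subst xw[OF ij]) (intro poly_fun_add poly_fun_mult poly_fun_const poly_fun_id)
    qed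
    then obtain R where R: "\<And>t. peval F (X_param (a t) (b t) (c t) (e t)) = poly R t"
      unfolding poly_fun_def by blast
    have zero: "poly R t = 0" if "a t \<noteq> 0 \<or> b t \<noteq> 0" "c t \<noteq> 0 \<or> e t \<noteq> 0" for t
      using F X_param_in_coords(2)[OF that] in_listset_map_proj[OF X_param_in_coords(1)[OF that]] R
      unfolding vanishing_forms_def by force
    have fin: "finite {t. h t = 0 \<and> k t = 0}" if "poly_fun h" "poly_fun k" "h 0 \<noteq> 0 \<or> k 0 \<noteq> 0"
      for h k :: "'k \<Rightarrow> 'k"
      using that finite_zeros_poly_fun[of h 0] finite_zeros_poly_fun[of k 0]
      by (auto elim: rev_finite_subset)
    have "finite ({t. a t = 0 \<and> b t = 0} \<union> {t. c t = 0 \<and> e t = 0})"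
      using fin[OF P(1,2)] fin[OF P(3,4)] nz at0 by simp
    then have "infinite (UNIV - ({t. a t = 0 \<and> b t = 0} \<union> {t. c t = 0 \<and> e t = 0}))"
      using infinite_UNIV_char_0[where 'a = 'k] by (rule Diff_infinite_finite)
    moreover have "UNIV - ({t. a t = 0 \<and> b t = 0} \<union> {t. c t = 0 \<and> e t = 0}) \<subseteq> {t. poly R t = 0}"
      using zero by auto
    ultimately have "R = 0" using poly_roots_finite finite_subset by blast
    have "(\<Sum>i<length [2, 1 :: nat]. \<Sum>j\<le>[2, 1] ! i.
        w (i, j) * gradient F (X_param (a 0) (b 0) (c 0) (e 0)) (i, j)) = poly (pderiv R) 0"
      by (rule gradient_along_line[OF d xw R])
    then show ?thesis
      unfolding at0 G_def \<open>R = 0\<close> by (simp add: w_def eval_nat_numeral add_ac)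
  qed
  note pf = poly_fun_add poly_fun_mult poly_fun_const poly_fun_id
  have g00: "G (0, 0) = 0"
    using line[of "\<lambda>t. x0 + t" "\<lambda>_. s" "\<lambda>_. u" "\<lambda>_. v" 1 0 0 0 0]
    by (simp add: X_param_def pf)
  have g12: "u * G (0, 1) + v * G (0, 2) = 0"
    using line[of "\<lambda>_. x0" "\<lambda>t. s + t" "\<lambda>_. u" "\<lambda>_. v" 0 u v 0 0]
    by (simp add: X_param_def pf algebra_simps)
  have g10: "s * G (0, 1) + G (1, 0) = 0"
    using line[of "\<lambda>_. x0" "\<lambda>_. s" "\<lambda>t. u + t" "\<lambda>_. v" 0 s 0 1 0]
    by (simp add: X_param_def pf algebra_simps)
  have g11: "s * G (0, 2) + G (1, 1) = 0"
    using line[of "\<lambda>_. x0" "\<lambda>_. s" "\<lambda>_. u" "\<lambda>t. v + t" 0 0 s 0 1]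
    by (simp add: X_param_def pf algebra_simps)
  have "\<exists>c. G (0, 1) = c * v \<and> G (0, 2) = - c * u"
  proof (cases "v = 0")
    case True
    then show ?thesis using g12 nz(2) by (intro exI[of _ "- G (0, 2) / u"]) auto
  next
    case False
    then show ?thesis using g12
      by (intro exI[of _ "G (0, 1) / v"]) (simp add: field_simps eq_neg_iff_add_eq_0)
  qed
  then obtain c where c: "G (0, 1) = c * v" "G (0, 2) = - c * u" by blast
  have c': "G (1, 0) = c * (- s * v)" "G (1, 1) = c * (s * u)"
    using g10 g11 c by (simp_all add: add_eq_0_iff2 algebra_simps)
  have rest: "G w = 0" if "w \<notin> {(0, 0), (0, 1), (0, 2), (1, 0), (1, 1)}" for w
  proof -
    have "w \<notin> variables [2, 1]" using that idx by auto
    then show ?thesis unfolding G_def by (rule gradient_outside_variables[OF d])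
  qed
  have "G w = c * (if w = (0, 1) then v else if w = (0, 2) then - u else
     if w = (1, 0) then - s * v else if w = (1, 1) then s * u else 0)" for w
  proof (cases "w \<in> {(0, 0), (0, 1), (0, 2), (1, 0), (1, 1)}")
    case True
    then consider "w = (0, 0)" | "w = (0, 1)" | "w = (0, 2)" | "w = (1, 0)" | "w = (1, 1)" by blast
    then show ?thesis using g00 c c' by cases simp_all
  next
    case False
    then show ?thesis using rest[OF False] by simp
  qed
  then show ?thesis unfolding G_def by blast
qed

lemma nonsingular_cayley_X: "nonsingular [2, 1] (cayley_X :: 'k::field_char_0 mpoint set)"
  unfolding nonsingular_def
proof (intro ballI)
  fix p and x :: "'k list list" assume p: "p \<in> cayley_X" "x \<in> listset p"
  obtain x0 s u v where x: "x = X_param x0 s u v" and nz: "x0 \<noteq> 0 \<or> s \<noteq> 0" "u \<noteq> 0 \<or> v \<noteq> 0"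
    by (rule cayley_X_obtain_param[OF p])
  let ?V = "vanishing_forms [2, 1] (cayley_X :: 'k mpoint set)"
  define g0 :: "nat \<times> nat \<Rightarrow> 'k" where "g0 = (\<lambda>w. if w = (0, 1) then v else if w = (0, 2) then - u else
     if w = (1, 0) then - s * v else if w = (1, 1) then s * u else 0)"
  have multiple: "\<exists>c. gradient F x = (\<lambda>w. c * g0 w)" if "F \<in> ?V" for F
    using gradient_vanishing_on_X[OF that nz] unfolding x g0_def .
  obtain F where F: "multihom [2, 1] (\<lambda>_. 1) F" "\<And>x. X_form x = (peval F x :: 'k)"
    using form_fun_X_form unfolding form_fun_def by blast
  have FV: "F \<in> ?V" using F unfolding vanishing_forms_def by (auto simp: cayley_X_eq simp flip: F(2))
  (* The derivatives of the equation of the surface with respect to x1 and x2 are y2 and - y1. *)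
  have "gradient F x \<noteq> (\<lambda>w. 0)"
  proof
    assume g: "gradient F x = (\<lambda>w. 0)"
    have "poly (pderiv [:0, v:]) 0 = (0::'k)"
    proof (subst gradient_along_line[OF F(1), where x = "\<lambda>t. [[x0, s * u + t, s * v], [u, v]]"
          and w = "\<lambda>w. if w = (0, 1) then 1 else 0", symmetric])
      show "[[x0, s * u + t, s * v], [u, v]] ! i ! j = [[x0, s * u + 0, s * v], [u, v]] ! i ! j +
          t * (if (i, j) = (0, 1) then 1 else 0)" if "i < length [2, 1 :: nat]" "j \<le> [2, 1] ! i" for t i j
        using that by (auto simp: less_Suc_eq le_Suc_eq eval_nat_numeral)
      show "peval F [[x0, s * u + t, s * v], [u, v]] = poly [:0, v:] t" for t
        by (simp add: X_form_def algebra_simps flip: F(2))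
    qed (use g in \<open>simp add: x X_param_def\<close>)
    moreover have "poly (pderiv [:0, - u:]) 0 = (0::'k)"
    proof (subst gradient_along_line[OF F(1), where x = "\<lambda>t. [[x0, s * u, s * v + t], [u, v]]"
          and w = "\<lambda>w. if w = (0, 2) then 1 else 0", symmetric])
      show "[[x0, s * u, s * v + t], [u, v]] ! i ! j = [[x0, s * u, s * v + 0], [u, v]] ! i ! j +
          t * (if (i, j) = (0, 2) then 1 else 0)" if "i < length [2, 1 :: nat]" "j \<le> [2, 1] ! i" for t i j
        using that by (auto simp: less_Suc_eq le_Suc_eq eval_nat_numeral)
      show "peval F [[x0, s * u, s * v + t], [u, v]] = poly [:0, - u:] t" for t
        by (simp add: X_form_def algebra_simps flip: F(2))
    qed (use g in \<open>simp add: x X_param_def\<close>)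
    ultimately show False using nz(2) by (simp add: pderiv_pCons)
  qed
  interpret K: vector_space "\<lambda>(c::'k) w (v::nat \<times> nat). c * w v"
    by unfold_locales (auto simp: fun_eq_iff algebra_simps)
  obtain c0 where c0: "gradient F x = (\<lambda>w. c0 * g0 w)" using multiple[OF FV] by blast
  have c0nz: "c0 \<noteq> 0" using c0 \<open>gradient F x \<noteq> (\<lambda>w. 0)\<close> by auto
  have "K.dim {gradient F x | F. F \<in> ?V} = 1"
  proof (rule K.dim_unique[where B = "{gradient F x}"])
    show "{gradient F x | F. F \<in> ?V} \<subseteq> K.span {gradient F x}"
    proof clarify
      fix H assume "H \<in> ?V"
      then obtain c where "gradient H x = (\<lambda>w. c * g0 w)" using multiple by blast
      then have "gradient H x = (\<lambda>w. (c / c0) * gradient F x w)" using c0nz by (simp add: c0)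
      moreover have "(\<lambda>w. (c / c0) * gradient F x w) \<in> K.span {gradient F x}"
        by (rule K.span_scale[OF K.span_base]) simp
      ultimately show "gradient H x \<in> K.span {gradient F x}" by simp
    qed
    show "K.independent {gradient F x}"
      using \<open>gradient F x \<noteq> (\<lambda>w. 0)\<close> by (simp add: K.dependent_single zero_fun_def)
  qed (use FV in auto)
  then have "jacobian_rank [2, 1] cayley_X x = 1" unfolding jacobian_rank_def by simp
  then show "enat (jacobian_rank [2, 1] cayley_X x) + krull_dim (zariski_on [2, 1] cayley_X) =
      enat (sum_list [2, 1])"
    unfolding krull_dim_cayley_X by (simp add: numeral_eq_enat one_enat_def)
qed

lemma birational_cayley_phi:
  "birational_morphism [2, 1] cayley_X [3] (cayley_W :: 'k::field_char_0 mpoint set) cayley_phi"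
  unfolding birational_morphism_def
proof (intro conjI exI)
  have phi: "cayley_phi p \<in> cayley_W" if "p \<in> cayley_X" for p :: "'k mpoint"
    using that phi_coords_X(3) mproj_obtain_coords by (metis (no_types, lifting) cayley_X_eq mem_Collect_eq)
  show "morphism [2, 1] cayley_X [3] (cayley_W :: 'k mpoint set) cayley_phi"
    by (rule morphism_cayley_phi) (use phi in auto)
  have sub: "cayley_X \<subseteq> (mproj [2, 1] :: 'k mpoint set)" "cayley_W \<subseteq> (mproj [3] :: 'k mpoint set)"
    by (auto simp: cayley_X_eq cayley_W_eq)
  have eqU: "cayley_U = {p \<in> cayley_X \<inter> mproj [2, 1]. \<exists>x\<in>listset p. x ! 0 ! 1 \<noteq> (0 :: 'k)}"
    unfolding cayley_U_eq by (rule nonvanishing_set_eq[OF form_fun_2_1(1) sub(1), symmetric]) simp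
  have eqV: "cayley_V = {p \<in> cayley_W \<inter> mproj [3]. \<exists>x\<in>listset p. x ! 0 ! 0 \<noteq> (0 :: 'k)}"
    unfolding cayley_V_eq by (rule nonvanishing_set_eq[OF form_fun_3 sub(2), symmetric]) simp
  have "map proj (X_param 0 1 1 0) \<in> (cayley_U :: 'k mpoint set)"
    by (rule map_proj_in_cayley_U[OF X_param_in_coords(2,1)]) (simp_all add: X_param_def)
  moreover have "cayley_phi ` cayley_U \<subseteq> (cayley_V :: 'k mpoint set)"
    using isomorphism_cayley_U_V unfolding isomorphism_def morphism_def by (elim conjE)
  ultimately have ne: "(cayley_U :: 'k mpoint set) \<noteq> {}" "(cayley_V :: 'k mpoint set) \<noteq> {}"
    by blast+
  show U: "openin (zariski_on [2, 1] cayley_X) (cayley_U :: 'k mpoint set)"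
    unfolding eqU by (rule openin_nonvanishing[OF form_fun_2_1(1)]) simp
  show V: "openin (zariski_on [3] cayley_W) (cayley_V :: 'k mpoint set)"
    unfolding eqV by (rule openin_nonvanishing[OF form_fun_3]) simp
  show "zariski_on [2, 1] cayley_X closure_of cayley_U = (cayley_X :: 'k mpoint set)"
    by (rule irreducible_open_dense[OF irreducible_cayley_X[OF order_refl] _ U ne(1)])
      (auto simp: topspace_subtopology cayley_X_eq)
  show "zariski_on [3] cayley_W closure_of cayley_V = (cayley_W :: 'k mpoint set)"
    by (rule irreducible_open_dense[OF irreducible_cayley_W[OF order_refl] _ V ne(2)])
      (auto simp: topspace_subtopology cayley_W_eq)
  show "isomorphism [2, 1] cayley_U [3] (cayley_V :: 'k mpoint set) cayley_phi"
    by (rule isomorphism_cayley_U_V)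
qed


section \<open>Properness\<close>

text \<open>
  A combination of two formulas for the point of \<open>X\<close> over \<open>t\<close> with given \<open>y\<close>, both of degree 2 in \<open>y\<close> and 1
  in \<open>t\<close>.  The formula with coefficient \<open>a\<close> multiplies \<open>x\<close> by \<open>y\<^sub>1\<^sup>3\<close>, the one with coefficient \<open>b\<close> by
  \<open>y\<^sub>2\<^sup>3\<close>, up to the common factor that relates \<open>t\<close> to \<open>\<phi>\<close>.
\<close>

definition lift_coords :: "'k::field \<Rightarrow> 'k \<Rightarrow> 'k list \<Rightarrow> 'k list \<Rightarrow> 'k list list" where
  "lift_coords a b y t =
    [[a * (t ! 2 * y ! 0 ^ 2 - t ! 0 * y ! 1 ^ 2) + b * (t ! 3 * y ! 1 ^ 2),
      a * (t ! 0 * y ! 0 ^ 2) + b * (t ! 2 * (y ! 0 * y ! 1) - t ! 3 * y ! 0 ^ 2),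
      a * (t ! 0 * (y ! 0 * y ! 1)) + b * (t ! 2 * y ! 1 ^ 2 - t ! 3 * (y ! 0 * y ! 1))],
     [y ! 0, y ! 1]]"

lemma lift_coords_phi:
  fixes c :: "'k::field"
  assumes "t = map ((*) c) (phi_coords (X_param x0 s u v) ! 0)"
  shows "lift_coords a b [u, v] t =
    (let l = c * (a * u ^ 3 + b * v ^ 3) in [[l * x0, l * (s * u), l * (s * v)], [1 * u, 1 * v]])"
  by (simp add: assms phi_coords_param lift_coords_def Let_def eval_nat_numeral algebra_simps)

lemma quadric_phi:
  fixes c :: "'k::field"
  assumes "t = map ((*) c) (phi_coords (X_param x0 s u v) ! 0)"
  shows "t ! 3 * u ^ 2 - t ! 2 * u * v + t ! 1 * v ^ 2 = 0"
  by (simp add: assms phi_coords_param eval_nat_numeral algebra_simps)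

lemma index_2_1_cases:
  fixes i j :: nat
  assumes "i < length ([2, 1] @ ks)" "j \<le> ([2, 1] @ ks) ! i"
  shows "i = 0 \<and> (j = 0 \<or> j = 1 \<or> j = 2) \<or> i = 1 \<and> (j = 0 \<or> j = 1) \<or> (\<exists>k. i = Suc (Suc k))"
proof (cases i)
  case 0
  then show ?thesis using assms by auto
next
  case (Suc k)
  then show ?thesis using assms by (cases k) auto
qed

lemma form_fun_rescale_2_1:
  assumes "form_fun ([2, 1] @ ks) e f"
  shows "f ([[l * a0, l * a1, l * a2], [m * b0, m * b1]] @ z) =
    l ^ e 0 * m ^ e 1 * f ([[a0, a1, a2], [b0, b1]] @ z)"
proof -
  let ?c = "\<lambda>i::nat. if i = 0 then l else if i = 1 then m else 1"
  have "f ([[l * a0, l * a1, l * a2], [m * b0, m * b1]] @ z) =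
      (\<Prod>i<length ([2, 1] @ ks). ?c i ^ e i) * f ([[a0, a1, a2], [b0, b1]] @ z)"
  proof (rule form_fun_rescale[OF assms])
    fix i j assume ij: "i < length ([2, 1] @ ks)" "j \<le> ([2, 1] @ ks) ! i"
    consider "i = 0" "j = 0 \<or> j = 1 \<or> j = 2" | "i = 1" "j = 0 \<or> j = 1" | k where "i = Suc (Suc k)"
      using index_2_1_cases[OF ij] by blast
    then show "([[l * a0, l * a1, l * a2], [m * b0, m * b1]] @ z) ! i ! j =
        ?c i * ([[a0, a1, a2], [b0, b1]] @ z) ! i ! j"
      by cases auto
  qed
  also have "(\<Prod>i<length ([2, 1] @ ks). ?c i ^ e i) = l ^ e 0 * m ^ e 1"
    by (simp add: prod.lessThan_Suc_shift del: prod.lessThan_Suc)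
  finally show ?thesis .
qed

lemma form_fun_rescale_1:
  assumes "form_fun (1 # ks) e f"
  shows "f ([l * b0, l * b1] # z) = l ^ e 0 * f ([b0, b1] # z)"
proof -
  let ?c = "\<lambda>i::nat. if i = 0 then l else 1"
  have "f ([l * b0, l * b1] # z) = (\<Prod>i<length (1 # ks). ?c i ^ e i) * f ([b0, b1] # z)"
  proof (rule form_fun_rescale[OF assms])
    fix i j assume ij: "i < length (1 # ks)" "j \<le> (1 # ks) ! i"
    then show "([l * b0, l * b1] # z) ! i ! j = ?c i * ([b0, b1] # z) ! i ! j"
      by (cases i; cases j) auto
  qed
  also have "(\<Prod>i<length (1 # ks). ?c i ^ e i) = l ^ e 0"
    by (simp add: prod.lessThan_Suc_shift del: prod.lessThan_Suc)
  finally show ?thesis .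
qed

lemma form_fun_lift_coords:
  fixes f :: "'k::field_char_0 list list \<Rightarrow> 'k"
  assumes f: "form_fun ([2, 1] @ ks) e f" and r: "\<And>j. j \<le> 3 \<Longrightarrow> form_fun ks d (\<lambda>z. r z ! j)"
  obtains e' h where "form_fun (1 # ks) e' h"
    "\<And>y1 y2 z. length z = length ks \<Longrightarrow>
      h ([y1, y2] # z) = f (lift_coords (of_rat a) (of_rat b) [y1, y2] (r z) @ z)"
proof -
  define T :: "'k list list \<Rightarrow> 'k list list" where "T w = map (\<lambda>i. w ! Suc i) [0..<length ks]" for w
  have T: "T (y # z) = z" if "length z = length ks" for y z
    using map_nth[of z] that by (simp add: T_def)
  define Y :: "nat \<Rightarrow> nat" where "Y k = (if k = 0 then 1 else 0)" for k
  define D where "D k = (\<Sum>i<length ks. d i * (if k = Suc i then 1 else 0))" for k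
  define E where "E k = D k + (Y k + Y k)" for k
  have y: "form_fun (1 # ks) Y (\<lambda>w. w ! 0 ! j)" if "j \<le> 1" for j
    using form_fun_var[of 0 "1 # ks" j] that unfolding Y_def by simp
  have t: "form_fun (1 # ks) D (\<lambda>w. r (T w) ! j)" if "j \<le> 3" for j
    unfolding D_def
  proof (rule form_fun_compose[OF r[OF that]])
    fix i l assume "i < length ks" "l \<le> ks ! i"
    then show "form_fun (1 # ks) (\<lambda>k. if k = Suc i then 1 else 0) (\<lambda>w. T w ! i ! l)"
      using form_fun_var[of "Suc i" "1 # ks" l] by (simp add: T_def)
  qed
  have quadratic_in_y: "form_fun (1 # ks) E (\<lambda>w. r (T w) ! j * (w ! 0 ! i * w ! 0 ! l))"
    if "j \<le> 3" "i \<le> 1" "l \<le> 1" for i j l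
    unfolding E_def by (intro form_fun_mult t y that)
  define S where "S w = lift_coords (of_rat a) (of_rat b) (w ! 0) (r (T w)) @ T w" for w
  have S: "form_fun (1 # ks) (if i = 0 then E else if i = 1 then Y else (\<lambda>k. if k = i - 1 then 1 else 0))
      (\<lambda>w. S w ! i ! j)" if ij: "i < length ([2, 1] @ ks)" "j \<le> ([2, 1] @ ks) ! i" for i j
  proof -
    consider "i = 0" "j = 0 \<or> j = 1 \<or> j = 2" | "i = 1" "j = 0 \<or> j = 1" | k where "i = Suc (Suc k)"
      using index_2_1_cases[OF ij] by blast
    then show ?thesis
    proof cases
      case 1
      have "form_fun (1 # ks) E (\<lambda>w. of_rat a * (r (T w) ! 2 * (w ! 0 ! 0 * w ! 0 ! 0) -
          r (T w) ! 0 * (w ! 0 ! 1 * w ! 0 ! 1)) + of_rat b * (r (T w) ! 3 * (w ! 0 ! 1 * w ! 0 ! 1)))"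
        "form_fun (1 # ks) E (\<lambda>w. of_rat a * (r (T w) ! 0 * (w ! 0 ! 0 * w ! 0 ! 0)) +
          of_rat b * (r (T w) ! 2 * (w ! 0 ! 0 * w ! 0 ! 1) - r (T w) ! 3 * (w ! 0 ! 0 * w ! 0 ! 0)))"
        "form_fun (1 # ks) E (\<lambda>w. of_rat a * (r (T w) ! 0 * (w ! 0 ! 0 * w ! 0 ! 1)) +
          of_rat b * (r (T w) ! 2 * (w ! 0 ! 1 * w ! 0 ! 1) - r (T w) ! 3 * (w ! 0 ! 0 * w ! 0 ! 1)))"
        by (intro form_fun_add form_fun_diff form_fun_scale quadratic_in_y; simp)+
      then show ?thesis using 1 unfolding S_def lift_coords_def power2_eq_square
        by (elim disjE) simp_all
    next
      case 2
      then show ?thesis using y[of 0] y[of 1] unfolding S_def lift_coords_def by (elim disjE) simp_all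
    next
      case (3 k)
      then show ?thesis using form_fun_var[of "Suc k" "1 # ks" j] ij by (simp add: S_def lift_coords_def T_def)
    qed
  qed
  have "form_fun (1 # ks) (\<lambda>k. \<Sum>i<length ([2, 1] @ ks). e i *
      (if i = 0 then E else if i = 1 then Y else (\<lambda>k. if k = i - 1 then 1 else 0)) k) (\<lambda>w. f (S w))"
    by (rule form_fun_compose[OF f S])
  then show ?thesis
    by (rule that) (simp add: S_def T)
qed

lemma in_listset_append: "x \<in> listset p \<Longrightarrow> z \<in> listset q \<Longrightarrow> x @ z \<in> listset (p @ q)"
  unfolding in_listset by (rule list_all2_appendI)

lemma mproj_append: "p \<in> mproj ns \<Longrightarrow> q \<in> mproj ks \<Longrightarrow> p @ q \<in> mproj (ns @ ks)"
  unfolding mproj_def mem_Collect_eq by (rule list_all2_appendI)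

text \<open>
  Let \<open>q0\<close> be a point of \<open>Z\<close> over which \<open>C\<close> has no point; \<open>t\<close> denotes the coordinates of \<open>g\<close> near \<open>q0\<close>.
  If \<open>t\<^sub>0\<close> does not vanish at \<open>q0\<close>, then a form that separates the only point of the fibre product over
  \<open>q0\<close> from \<open>C\<close> becomes a form on \<open>Z\<close> by means of the inverse of \<open>\<phi>\<close>.

  Otherwise \<open>t\<^sub>1\<close> vanishes too, by the equation of \<open>W\<close>, and the roots of the quadratic form are \<open>(0, 1)\<close>
  and \<open>(t\<^sub>2, t\<^sub>3)\<close>.  Both come from points of \<open>X\<close> over \<open>q0\<close>.  Forms that separate these two points from \<open>C\<close>
  are pulled back to forms in \<open>y\<close> and \<open>z\<close>, and one combination of them vanishes at neither root; its norm
  separates \<open>q0\<close> from the image of \<open>C\<close>.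
\<close>

lemma cayley_fibre_separation:
  fixes Z :: "'k::{alg_closed_field, field_char_0} mpoint set"
  assumes Z: "Z \<subseteq> mproj ks" and g: "morphism ks Z [3] cayley_W g"
    and C: "closedin (zariski_on ([2, 1] @ ks) (fibre_product cayley_X Z cayley_phi g)) C"
    and q0: "q0 \<in> Z" "q0 \<notin> drop (length [2, 1 :: nat]) ` C"
  shows "\<exists>c N. form_fun ks c N \<and> (\<exists>z\<in>listset q0. N z \<noteq> 0) \<and> vanishes_on N (drop (length [2, 1 :: nat]) ` C)"
proof -
  let ?FP = "fibre_product cayley_X Z cayley_phi g"
  have CF: "C \<subseteq> ?FP" using closedin_subset[OF C] by (simp add: topspace_subtopology)
  have q0m: "q0 \<in> mproj ks" using q0 Z by blast
  obtain z0 where z0: "z0 \<in> listset q0" "z0 \<in> homog_coords ks" by (rule mproj_obtain_coords[OF q0m])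
  obtain Fs where Fs: "form_system ks [3] Fs" "\<And>z. z \<in> listset q0 \<Longrightarrow> defined_at Fs z"
    "\<And>q z. q \<in> Z \<Longrightarrow> z \<in> listset q \<Longrightarrow> defined_at Fs z \<Longrightarrow> g q = form_value Fs z"
  proof -
    have "\<forall>p\<in>Z. \<exists>Fs. form_system ks [3] Fs \<and> (\<forall>x\<in>listset p. defined_at Fs x) \<and>
        (\<forall>q\<in>Z. \<forall>x\<in>listset q. defined_at Fs x \<longrightarrow> g q = form_value Fs x)"
      using g unfolding morphism_def by (rule conjunct2)
    from bspec[OF this q0(1)] show ?thesis using that by auto
  qed
  obtain G d where G: "Fs = [G]" "length G = 4" "\<And>F. F \<in> set G \<Longrightarrow> multihom ks d F"
    using Fs(1) unfolding form_system_def by (auto simp: list_all2_Cons2)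
  define t where "t z = map (\<lambda>F. peval F z) G" for z :: "'k list list"
  have len_t: "length (t z) = 4" for z by (simp add: t_def G(2))
  have t: "form_fun ks d (\<lambda>z. t z ! j)" if "j \<le> 3" for j
    using form_fun_peval[OF G(3)[of "G ! j"]] that G(2) by (simp add: t_def)
  have gW: "g q \<in> cayley_W" if "q \<in> Z" for q using g that unfolding morphism_def by blast
  have defined: "g q = [proj (t z)]" if "q \<in> Z" "z \<in> listset q" "t z ! j \<noteq> 0" "j \<le> 3" for q z j
  proof -
    have "defined_at Fs z"
      using that(3,4) G(2) unfolding defined_at_def G(1) t_def
      by (auto intro!: bexI[of _ "G ! j"])
    then show ?thesis using Fs(3)[OF that(1,2)] by (simp add: G(1) form_value_def t_def)
  qed
  have related: "\<exists>c. c \<noteq> 0 \<and> t z = map ((*) c) (phi_coords x ! 0)"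
    if "p \<in> cayley_X" "x \<in> listset p" "q \<in> Z" "cayley_phi p = g q" "z \<in> listset q" "t z ! j \<noteq> 0" "j \<le> 3"
    for p x q z j
  proof -
    have "[proj (t z)] = map proj (phi_coords x)"
      using defined[OF that(3,5,6,7)] phi_coords_X(2)[OF that(1,2)] that(4) by simp
    then have "t z \<in> proj (phi_coords x ! 0)"
      using self_in_proj[of "t z"] by (simp add: phi_coords_def)
    then show ?thesis unfolding proj_def by blast
  qed
  have nonzero_at: "\<exists>e f. form_fun ([2, 1] @ ks) e f \<and> f (x @ z0) \<noteq> 0 \<and> vanishes_on f C"
    if x: "x \<in> homog_coords [2, 1]" "map proj x \<in> cayley_X" "map proj (phi_coords x) = g q0" for x
  proof -
    have "cayley_phi (map proj x) = g q0"
      using phi_coords_X(2)[OF x(2) in_listset_map_proj[OF x(1)]] x(3) by simp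
    then have "map proj x @ q0 \<in> ?FP"
      unfolding fibre_product_def using x(2) q0(1) by blast
    moreover have "map proj x @ q0 \<in> mproj ([2, 1] @ ks)"
      by (rule mproj_append[OF map_proj_in_mproj[OF x(1)] q0m])
    moreover have "map proj x @ q0 \<notin> C"
    proof
      assume "map proj x @ q0 \<in> C"
      then have "drop (length [2, 1 :: nat]) (map proj x @ q0) \<in> drop (length [2, 1 :: nat]) ` C" by (rule imageI)
      moreover have "length x = 2" using homog_coordsD(1)[OF x(1)] by simp
      ultimately show False using q0(2) by simp
    qed
    ultimately obtain e f where "form_fun ([2, 1] @ ks) e f"
      "\<And>w. w \<in> listset (map proj x @ q0) \<Longrightarrow> f w \<noteq> 0" "vanishes_on f C"
      using closedin_separate[OF C] by blast
    then show ?thesis using in_listset_append[OF in_listset_map_proj[OF x(1)] z0(1)] by blast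
  qed
  have image: "\<exists>p x x0 s u v. p \<in> cayley_X \<and> x \<in> listset p \<and> x = X_param x0 s u v \<and> (u \<noteq> 0 \<or> v \<noteq> 0) \<and>
      q \<in> Z \<and> cayley_phi p = g q \<and> length z = length ks \<and> (\<forall>f. vanishes_on f C \<longrightarrow> f (x @ z) = 0)"
    if q: "q \<in> drop (length [2, 1 :: nat]) ` C" and z: "z \<in> listset q" for q z
  proof -
    obtain p q' where p: "p @ q' \<in> C" "q = drop (length [2, 1 :: nat]) (p @ q')" "p \<in> cayley_X" "q' \<in> Z" "cayley_phi p = g q'"
    proof -
      obtain r where r: "r \<in> C" "q = drop (length [2, 1 :: nat]) r" using q by blast
      then have "r \<in> ?FP" using CF by blast
      then obtain p q' where "r = p @ q'" "p \<in> cayley_X" "q' \<in> Z" "cayley_phi p = g q'"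
        unfolding fibre_product_def by blast
      then show ?thesis using that r by blast
    qed
    have pm: "p \<in> mproj [2, 1]" using p(3) by (simp add: cayley_X_eq)
    obtain x where x: "x \<in> listset p" by (rule mproj_obtain_coords[OF pm])
    have "length p = 2" using coords_2_1[OF pm x] homog_coordsD(1)[of x "[2, 1]"] by simp
    then have qq: "q = q'" using p(2) by simp
    obtain x0 s u v where xp: "x = X_param x0 s u v" "u \<noteq> 0 \<or> v \<noteq> 0"
      by (rule cayley_X_obtain_param[OF p(3) x])
    have "length z = length ks"
      using mproj_coords[of q ks z] homog_coordsD(1) z p(4) Z qq by blast
    moreover have "\<forall>f. vanishes_on f C \<longrightarrow> f (x @ z) = 0"
      using in_listset_append[OF x z] p(1) qq unfolding vanishes_on_def by blast
    ultimately show ?thesis using p x xp qq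
      by (intro exI[of _ p] exI[of _ x] exI[of _ x0] exI[of _ s] exI[of _ u] exI[of _ v]) simp
  qed
  obtain j0 where j0: "j0 \<le> 3" "t z0 ! j0 \<noteq> 0"
  proof -
    obtain F where "F \<in> set G" "peval F z0 \<noteq> 0"
      using Fs(2)[OF z0(1)] unfolding defined_at_def G(1) by auto
    then obtain j where "j < length G" "peval (G ! j) z0 \<noteq> 0" by (auto simp: in_set_conv_nth)
    then show ?thesis using that[of j] G(2) by (simp add: t_def)
  qed
  have g0: "g q0 = [proj (t z0)]" by (rule defined[OF q0(1) z0(1) j0(2,1)])
  obtain t0 t1 t2 t3 where t03: "t z0 = [t0, t1, t2, t3]"
    using len_t[of z0] by (auto simp: length_Suc_conv eval_nat_numeral)
  have tc: "[t z0] \<in> listset (g q0)" unfolding g0 using self_in_proj by (simp add: set_Cons_def)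
  have W0: "t0 * t1 * t2 - t0^2 * t3 - t1^3 = 0"
    using gW[OF q0(1)] tc unfolding cayley_W_eq by (auto simp: t03 W_form_def)
  have t_eq: "g q0 = map proj [t z0]" using g0 by simp
  show ?thesis
  proof (cases "t0 = 0")
    case False
    have psi: "psi_coords [t z0] \<in> homog_coords [2, 1]" "map proj (psi_coords [t z0]) \<in> cayley_U"
      "map proj (phi_coords (psi_coords [t z0])) = g q0"
      using psi_coords_V[OF gW[OF q0(1)] tc] False by (simp_all add: t03)
    obtain e f where f: "form_fun ([2, 1] @ ks) e f" "f (psi_coords [t z0] @ z0) \<noteq> 0" "vanishes_on f C"
      using nonzero_at[OF psi(1) _ psi(3)] psi(2) unfolding cayley_U_eq by blast
    (* The factor t0 makes N vanish where the inverse of phi is not available. *)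
    define N where "N z = t z ! 0 * f (psi_coords [t z] @ z)" for z
    have psi_form: "form_fun ks (\<lambda>k. \<Sum>l<length [3 :: nat]. (if i = 0 then 2 else 1) * d k)
        (\<lambda>z. psi_coords [t z] ! i ! j)" if "i < length [2, 1 :: nat]" "j \<le> [2, 1] ! i" for i j
      by (rule form_fun_compose[OF form_fun_psi_coords[OF that]]) (use t in simp)
    have "form_fun ks (\<lambda>k. \<Sum>i<length ([2, 1] @ ks). e i *
        (if i < 2 then (\<lambda>k. \<Sum>l<length [3 :: nat]. (if i = 0 then 2 else 1) * d k)
         else (\<lambda>k. if k = i - 2 then 1 else 0)) k) (\<lambda>z. f (psi_coords [t z] @ z))"
    proof (rule form_fun_compose[OF f(1)])
      fix i j assume ij: "i < length ([2, 1] @ ks)" "j \<le> ([2, 1] @ ks) ! i"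
      show "form_fun ks (if i < 2 then (\<lambda>k. \<Sum>l<length [3 :: nat]. (if i = 0 then 2 else 1) * d k)
         else (\<lambda>k. if k = i - 2 then 1 else 0)) (\<lambda>z. (psi_coords [t z] @ z) ! i ! j)"
      proof (cases "i < 2")
        case True
        then have "i < length [2, 1 :: nat]" "j \<le> [2, 1] ! i" using ij(2) by (auto simp: less_2_cases_iff)
        note psi_ij = psi_form[OF this]
        have "(psi_coords [t z] @ z) ! i = psi_coords [t z] ! i" for z
          using True by (auto simp: less_2_cases_iff psi_coords_def)
        then show ?thesis using psi_ij True by simp
      next
        case False
        then obtain k where k: "i = Suc (Suc k)" by (metis add_2_eq_Suc le_Suc_ex not_less)
        then show ?thesis using form_fun_var[of k ks j] ij by (simp add: psi_coords_def)
      qed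
    qed
    from form_fun_mult[OF t[of 0] this] obtain c where "form_fun ks c N" unfolding N_def by blast
    moreover have "N z0 \<noteq> 0" using f(2) False by (simp add: N_def t03)
    moreover have "vanishes_on N (drop (length [2, 1 :: nat]) ` C)"
      unfolding vanishes_on_def
    proof (intro ballI)
      fix q z assume q: "q \<in> drop (length [2, 1 :: nat]) ` C" and z: "z \<in> listset q"
      obtain p x x0 s u v where p: "p \<in> cayley_X" "x \<in> listset p" "x = X_param x0 s u v" "q \<in> Z"
        "cayley_phi p = g q" "\<And>f. vanishes_on f C \<Longrightarrow> f (x @ z) = 0"
        using image[OF q z] by blast
      show "N z = 0"
      proof (cases "t z ! 0 = 0")
        case False
        obtain c where c: "c \<noteq> 0" "t z = map ((*) c) (phi_coords x ! 0)"
          using related[OF p(1,2,4,5) z False] by blast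
        define l where "l = c^2 * s * u^3"
        have "psi_coords [t z] = [[l * x0, l * (s * u), l * (s * v)], [c * s * u * u, c * s * u * v]]"
          unfolding c(2) p(3) phi_coords_param l_def
          by (simp add: psi_coords_def eval_nat_numeral algebra_simps)
        then have "f (psi_coords [t z] @ z) = l ^ e 0 * (c * s * u) ^ e 1 * f (x @ z)"
          using form_fun_rescale_2_1[OF f(1), of l x0 "s * u" "s * v" "c * s * u" u v z]
          by (simp add: p(3) X_param_def)
        then show ?thesis using p(6)[OF f(3)] by (simp add: N_def)
      qed (simp add: N_def)
    qed
    ultimately show ?thesis using z0(1) by blast
  next
    case True
    then have t1: "t1 = 0" using W0 by simp
    have t23: "t2 \<noteq> 0 \<or> t3 \<noteq> 0"
      using j0 True t1 t03 by (auto simp: le_Suc_eq eval_nat_numeral)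
    obtain j1 where j1: "j1 \<le> 3" "t z0 ! j1 \<noteq> 0" using j0 by blast
    (* The points of the surface over q0, with y = (0, 1) and y = (t2, t3). *)
    let ?P1 = "X_param t3 t2 0 1" and ?P2 = "X_param 1 0 t2 t3"
    have "t3 \<noteq> 0 \<or> t2 \<noteq> 0" "(0::'k) \<noteq> 0 \<or> (1::'k) \<noteq> 0" using t23 by auto
    note P1 = X_param_in_coords[OF this]
    have "(1::'k) \<noteq> 0 \<or> (0::'k) \<noteq> 0" by simp
    note P2 = X_param_in_coords[OF this t23]
    obtain e1 f1 where f1: "form_fun ([2, 1] @ ks) e1 f1" "f1 (?P1 @ z0) \<noteq> 0" "vanishes_on f1 C"
      using nonzero_at[OF P1] True t1 by (auto simp: phi_coords_param t_eq t03)
    obtain e2 f2 where f2: "form_fun ([2, 1] @ ks) e2 f2" "f2 (?P2 @ z0) \<noteq> 0" "vanishes_on f2 C"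
      using nonzero_at[OF P2] True t1 by (auto simp: phi_coords_param t_eq t03)
    (* For the second point the formula is chosen according to a nonzero coordinate of y = (t2, t3). *)
    define a b :: rat where "a = (if t3 = 0 then 1 else 0)" and "b = (if t3 = 0 then 0 else 1)"
    obtain d1 h1 where h1: "form_fun (1 # ks) d1 h1" "\<And>y1 y2 z. length z = length ks \<Longrightarrow>
        h1 ([y1, y2] # z) = f1 (lift_coords (of_rat 0) (of_rat 1) [y1, y2] (t z) @ z)"
      using form_fun_lift_coords[OF f1(1) t] by blast
    obtain d2 h2 where h2: "form_fun (1 # ks) d2 h2" "\<And>y1 y2 z. length z = length ks \<Longrightarrow>
        h2 ([y1, y2] # z) = f2 (lift_coords (of_rat a) (of_rat b) [y1, y2] (t z) @ z)"
      using form_fun_lift_coords[OF f2(1) t] by blast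
    have len0: "length z0 = length ks" by (rule homog_coordsD(1)[OF z0(2)])
    have h1nz: "h1 ([0, 1] # z0) \<noteq> 0"
      using f1(2) True t1 by (simp add: h1(2)[OF len0] lift_coords_def t03 X_param_def)
    have h2nz: "h2 ([t2, t3] # z0) \<noteq> 0"
    proof -
      define l where "l = (if t3 = 0 then t2 ^ 3 else t3 ^ 3)"
      have "lift_coords (of_rat a) (of_rat b) [t2, t3] (t z0) =
          [[l * 1, l * 0, l * 0], [1 * t2, 1 * t3]]"
        using True by (simp add: lift_coords_def t03 a_def b_def l_def eval_nat_numeral algebra_simps)
      then have "h2 ([t2, t3] # z0) = l ^ e2 0 * 1 ^ e2 1 * f2 (?P2 @ z0)"
        using form_fun_rescale_2_1[OF f2(1), of l 1 0 0 1 t2 t3 z0]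
        unfolding h2(2)[OF len0] by (simp add: X_param_def)
      moreover have "l \<noteq> 0" using t23 by (auto simp: l_def)
      ultimately show ?thesis using f2(2) by simp
    qed
    define m where "m i = max (d1 i) (d2 i)" for i
    have w: "[0, 1] # z0 \<in> homog_coords (1 # ks)" "[t2, t3] # z0 \<in> homog_coords (1 # ks)"
      using z0(2) t23 unfolding homog_coords_def by auto
    obtain g1 where g1: "form_fun (1 # ks) m g1" "g1 ([0, 1] # z0) \<noteq> 0" "\<And>y. h1 y = 0 \<Longrightarrow> g1 y = 0"
      using form_fun_raise_degree[OF h1(1) w(1) h1nz, of m] unfolding m_def by auto
    obtain g2 where g2: "form_fun (1 # ks) m g2" "g2 ([t2, t3] # z0) \<noteq> 0" "\<And>y. h2 y = 0 \<Longrightarrow> g2 y = 0"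
      using form_fun_raise_degree[OF h2(1) w(2) h2nz, of m] unfolding m_def by auto
    obtain f where f: "form_fun (1 # ks) m f" "f ([0, 1] # z0) \<noteq> 0" "f ([t2, t3] # z0) \<noteq> 0"
      "\<And>y. h1 y = 0 \<Longrightarrow> h2 y = 0 \<Longrightarrow> f y = 0"
    proof -
      (* If g1 vanishes at the second root and g2 at the first, then g1 + g2 vanishes at neither. *)
      consider "g1 ([t2, t3] # z0) \<noteq> 0" | "g2 ([0, 1] # z0) \<noteq> 0"
        | "g1 ([t2, t3] # z0) = 0" "g2 ([0, 1] # z0) = 0" by blast
      then show ?thesis
      proof cases
        case 1
        then show ?thesis using that[OF g1(1,2)] g1(3) by blast
      next
        case 2
        then show ?thesis using that[OF g2(1) _ g2(2)] g2(3) by blast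
      next
        case 3
        then show ?thesis using that[OF form_fun_add[OF g1(1) g2(1)]] g1(2,3) g2(2,3) by simp
      qed
    qed
    have nz: "f ([y1, y2] # z0) \<noteq> 0"
      if y: "y1 \<noteq> 0 \<or> y2 \<noteq> 0" "t z0 ! 3 * y1^2 - t z0 ! 2 * y1 * y2 + t z0 ! 1 * y2^2 = 0" for y1 y2
    proof -
      have "y1 * (t3 * y1 - t2 * y2) = 0"
        using y(2) t1 by (simp add: t03 power2_eq_square algebra_simps)
      then consider "y1 = 0" | "y1 \<noteq> 0" "t3 * y1 = t2 * y2" by auto
      then show ?thesis
      proof cases
        case 1
        then show ?thesis using form_fun_rescale_1[OF f(1), of y2 0 1 z0] y(1) f(2) by simp
      next
        case 2
        then have "t2 \<noteq> 0" using t23 by auto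
        then have "y1 = y1 / t2 * t2" "y2 = y1 / t2 * t3" using 2 by (simp_all add: field_simps)
        then have "f ([y1, y2] # z0) = (y1 / t2) ^ m 0 * f ([t2, t3] # z0)"
          using form_fun_rescale_1[OF f(1), of "y1 / t2" t2 t3 z0] by metis
        then show ?thesis using f(3) 2 \<open>t2 \<noteq> 0\<close> by simp
      qed
    qed
    obtain c N where N: "form_fun ks c N" "N z0 \<noteq> 0"
      "\<And>z y1 y2. length z = length ks \<Longrightarrow> y1 \<noteq> 0 \<or> y2 \<noteq> 0 \<Longrightarrow>
        t z ! 3 * y1^2 - t z ! 2 * y1 * y2 + t z ! 1 * y2^2 = 0 \<Longrightarrow> f ([y1, y2] # z) = 0 \<Longrightarrow> N z = 0"
    proof (rule eliminate_quadratic_root[OF f(1) t[of 3] t[of 2] t[of 1] len0])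
      show "t z0 ! 3 \<noteq> 0 \<or> t z0 ! 2 \<noteq> 0 \<or> t z0 ! 1 \<noteq> 0" using t23 by (auto simp: t03)
    qed (use nz that in auto)
    (* The factor t_j1 makes the form vanish where t does not represent g. *)
    have "form_fun ks (\<lambda>i. d i + c i) (\<lambda>z. t z ! j1 * N z)"
      by (rule form_fun_mult[OF t[OF j1(1)] N(1)])
    moreover have "t z0 ! j1 * N z0 \<noteq> 0" using N(2) j1(2) by simp
    moreover have "vanishes_on (\<lambda>z. t z ! j1 * N z) (drop (length [2, 1 :: nat]) ` C)"
      unfolding vanishes_on_def
    proof (intro ballI)
      fix q z assume q: "q \<in> drop (length [2, 1 :: nat]) ` C" and z: "z \<in> listset q"
      obtain p x x0 s u v where p: "p \<in> cayley_X" "x \<in> listset p" "x = X_param x0 s u v" "q \<in> Z"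
        "cayley_phi p = g q" "\<And>f. vanishes_on f C \<Longrightarrow> f (x @ z) = 0" and uv: "u \<noteq> 0 \<or> v \<noteq> 0"
        and len: "length z = length ks"
        using image[OF q z] by blast
      show "t z ! j1 * N z = 0"
      proof (cases "t z ! j1 = 0")
        case False
        obtain c where c: "t z = map ((*) c) (phi_coords (X_param x0 s u v) ! 0)"
          using related[OF p(1,2,4,5) z False j1(1)] p(3) by blast
        have lift: "F (lift_coords a b [u, v] (t z) @ z) = 0"
          if "form_fun ([2, 1] @ ks) e F" "vanishes_on F C" for F e a b
          using form_fun_rescale_2_1[OF that(1), of "c * (a * u ^ 3 + b * v ^ 3)" x0 "s * u" "s * v" 1 u v z]
            p(6)[OF that(2)] unfolding lift_coords_phi[OF c] Let_def by (simp add: p(3) X_param_def)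
        have "f ([u, v] # z) = 0"
          by (rule f(4)) (simp_all only: h1(2)[OF len] h2(2)[OF len] lift[OF f1(1,3)] lift[OF f2(1,3)])
        then have "N z = 0" using N(3)[OF len uv quadric_phi[OF c]] by blast
        then show ?thesis by simp
      qed simp
    qed
    ultimately show ?thesis using z0(1) by blast
  qed
qed

lemma proper_cayley_phi:
  "proper_morphism [2, 1] cayley_X [3] (cayley_W :: 'k::{alg_closed_field, field_char_0} mpoint set) cayley_phi"
  unfolding proper_morphism_def
proof (intro conjI allI impI)
  show "morphism [2, 1] cayley_X [3] (cayley_W :: 'k mpoint set) cayley_phi"
    using birational_cayley_phi unfolding birational_morphism_def by (elim conjE)
  fix ks and Z :: "'k mpoint set" and g
  assume "quasi_projective ks Z \<and> morphism ks Z [3] cayley_W g"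
  then have Zq: "quasi_projective ks Z" and g: "morphism ks Z [3] cayley_W g" by auto
  have Z: "Z \<subseteq> mproj ks"
    using Zq openin_subset unfolding quasi_projective_def by fastforce
  show "closed_map (zariski_on ([2, 1] @ ks) (fibre_product cayley_X Z cayley_phi g))
      (zariski_on ks Z) (drop (length [2, 1 :: nat]))"
    unfolding closed_map_def
  proof (intro allI impI closedin_zariskiI)
    fix C assume C: "closedin (zariski_on ([2, 1] @ ks) (fibre_product cayley_X Z cayley_phi g)) C"
    have "C \<subseteq> fibre_product cayley_X Z cayley_phi g"
      using closedin_subset[OF C] by (simp add: topspace_subtopology)
    moreover have "length p = 2" if "p \<in> cayley_X" for p :: "'k mpoint"
      using that list_all2_lengthD unfolding cayley_X_def mproj_def by fastforce
    ultimately show CZ: "drop (length [2, 1 :: nat]) ` C \<subseteq> Z" unfolding fibre_product_def by fastforce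
    then show "drop (length [2, 1 :: nat]) ` C \<subseteq> mproj ks" using Z by blast
    fix q assume "q \<in> Z" "q \<notin> drop (length [2, 1 :: nat]) ` C"
    then show "\<exists>d f. form_fun ks d f \<and> (\<exists>x\<in>listset q. f x \<noteq> 0) \<and>
        vanishes_on f (drop (length [2, 1 :: nat]) ` C)"
      by (rule cayley_fibre_separation[OF Z g C])
  qed
qed

theorem theorem1p2:
  shows "desingularisation [2, 1] (cayley_X :: 'k::{alg_closed_field, field_char_0} mpoint set)
           [3] cayley_W cayley_phi \<and>
         isomorphism [2, 1] (cayley_U :: 'k mpoint set) [3] cayley_V cayley_phi"
  unfolding desingularisation_def
  using variety_cayley_X nonsingular_cayley_X variety_cayley_W proper_cayley_phi
    birational_cayley_phi isomorphism_cayley_U_V by (intro conjI)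

end
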